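(* Let $(\mathcal{C},\mathbb{E},\mathfrak{s})$ be a small $R$-linear extriangulated category. The following are equivalent. (1) $(\mathcal{C},\mathbb{E},\mathfrak{s})$ has enough projective morphisms. (2) $\mathbb{E}(C,-)$ is finitely generated for every $C\in\mathcal{C}$. (3) $\mathbb{E}^n(C,-)$ is finitely presented for every $C\in\mathcal{C}$ and every integer $n\ge0$.
   Context: $R$ is a commutative ring with $1$; $\mathcal{C}$ is an additive $R$-linear category. Extriangulated categories: let $\mathbb{E}\colon\mathcal{C}^{\mathrm{op}}\times\mathcal{C}\to\mathrm{Mod}\,R$ be an $R$-bilinear functor. An element $\delta\in\mathbb{E}(C,A)$ is called an extension; for $a\colon A\to A'$ and $c\colon C'\to C$ put $a_*\delta=\mathbb{E}(C,a)(\delta)$ and $c^*\delta=\mathbb{E}(c,A)(\delta)$. A morphism of extensions from $\delta\in\mathbb{E}(C,A)$ to $\delta'\in\mathbb{E}(C',A')$ is a pair $(a\colon A\to A',\,c\colon C\to C')$ with $a_*\delta=c^*\delta'$. The extension $\delta\oplus\delta'\in\mathbb{E}(C\oplus C',A\oplus A')$ is the one with diagonal components $\delta,\delta'$ and zero off-diagonal components. Sequences $A\xrightarrow{x}B\xrightarrow{y}C$ and $A\xrightarrow{x'}B'\xrightarrow{y'}C$ are equivalent if there is an isomorphism $b\colon B\to B'$ with $bx=x'$, $y'b=y$; the class is written $[A\xrightarrow{x}B\xrightarrow{y}C]$. An additive realization $\mathfrak{s}$ assigns to each $\delta\in\mathbb{E}(C,A)$ such a class $\mathfrak{s}(\delta)=[A\xrightarrow{x}B\xrightarrow{y}C]$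 so that: for each morphism $(a,c)\colon\delta\to\delta'$ with $\mathfrak{s}(\delta')=[A'\xrightarrow{x'}B'\xrightarrow{y'}C']$ there is $b\colon B\to B'$ with $bx=x'a$, $y'b=cy$; $\mathfrak{s}(0)=[A\to A\oplus C\to C]$ (canonical maps); and $\mathfrak{s}(\delta\oplus\delta')=\mathfrak{s}(\delta)\oplus\mathfrak{s}(\delta')$. The triple $(\mathcal{C},\mathbb{E},\mathfrak{s})$ is an ($R$-linear) extriangulated category if moreover: (ET3) if $\mathfrak{s}(\delta)=[A\xrightarrow{x}B\xrightarrow{y}C]$, $\mathfrak{s}(\delta')=[A'\xrightarrow{x'}B'\xrightarrow{y'}C']$ and $bx=x'a$, then there is $c$ with $cy=y'b$ and $a_*\delta=c^*\delta'$; (ET3)$^{\mathrm{op}}$ the dual; (ET4) if $\delta\in\mathbb{E}(D,A)$ and $\delta'\in\mathbb{E}(F,B)$ are realized by $A\xrightarrow{f}B\xrightarrow{f'}D$ and $B\xrightarrow{g}C\xrightarrow{g'}F$, then there are an object $E$, morphisms $d\colon D\to E$, $e\colon E\to F$, $h=gf$, $h'\colon C\to E$ with $h'g=df'$, $eh'=g'$, and $\delta''\in\mathbb{E}(E,A)$ realized by $A\xrightarrow{h}C\xrightarrow{h'}E$, such that $D\xrightarrow{d}E\xrightarrow{e}F$ realizes $f'_*\delta'$, $d^*\delta''=\delta$ and $f_*\delta''=e^*\delta'$; (ET4)$^{\mathrm{op}}$ the dual. If $\mathfrak{s}(\delta)=[A\xrightarrow{x}B\xrightarrow{y}C]$ one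 writes $A\xrightarrow{x}B\xrightarrow{y}C\overset{\delta}{\dashrightarrow}$ and calls it an $\mathfrak{s}$-triangle; $x$ is an inflation, $y$ a deflation, $A\to B\to C$ a conflation. A morphism $f$ is projective if $\mathbb{E}(f,-)=0$. A projective deflation is a deflation that is a projective morphism. There are enough projective morphisms if every object $C$ admits a projective deflation $G\to C$. Positive extensions: $\mathbb{E}^0=\mathcal{C}(-,-)$, $\mathbb{E}^1=\mathbb{E}$ and inductively $\mathbb{E}^n(X,Y)=\int^{M\in\mathcal{C}}\mathbb{E}^{n-1}(M,Y)\otimes_R\mathbb{E}(X,M)$ (coend). An $R$-linear functor $M\colon\mathcal{C}\to\mathrm{Mod}\,R$ is finitely generated if there is an epimorphism $\mathcal{C}(X,-)\to M$ from a representable functor, and finitely presented if it is the cokernel of a morphism between representable functors. *)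

theory Defs
  imports "HOL-Algebra.Module" "HOL-Algebra.AbelCoset"
begin

section \<open>Modules over a commutative ring\<close>

definition mod_hom :: "'r ring \<Rightarrow> ('r, 'a) module \<Rightarrow> ('r, 'b) module \<Rightarrow> ('a \<Rightarrow> 'b) set" where
  "mod_hom R M N =
    {h \<in> carrier M \<rightarrow> carrier N.
      (\<forall>x\<in>carrier M. \<forall>y\<in>carrier M. h (x \<oplus>\<^bsub>M\<^esub> y) = h x \<oplus>\<^bsub>N\<^esub> h y) \<and>
      (\<forall>r\<in>carrier R. \<forall>x\<in>carrier M. h (r \<odot>\<^bsub>M\<^esub> x) = r \<odot>\<^bsub>N\<^esub> h x)}"

text \<open>The multiplicative part of a module record is irrelevant, hence left undefined below.\<close>

definition gen_submodule :: "'r ring \<Rightarrow> ('r, 'a) module \<Rightarrow> 'a set \<Rightarrow> 'a set" where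
  "gen_submodule R M S = \<Inter>{H. submodule H R M \<and> S \<subseteq> H}"

text \<open>The map \<open>M/H \<rightarrow> M'/H'\<close> induced by a map \<open>h\<close> from \<open>M\<close> to \<open>M'\<close> with \<open>h(H) \<subseteq> H'\<close>.\<close>

definition quotient_map :: "('r, 'b) module \<Rightarrow> 'b set \<Rightarrow> ('a \<Rightarrow> 'b) \<Rightarrow> 'a set \<Rightarrow> 'b set" where
  "quotient_map M' H' h c = the_elem ((\<lambda>u. H' +>\<^bsub>M'\<^esub> h u) ` c)"

definition quotient_module :: "('r, 'a) module \<Rightarrow> 'a set \<Rightarrow> ('r, 'a set) module" where
  "quotient_module M H =
    \<lparr>carrier = a_rcosets\<^bsub>M\<^esub> H, mult = undefined, one = undefined,
     zero = H, add = (\<lambda>X Y. X <+>\<^bsub>M\<^esub> Y),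
     smult = (\<lambda>r. quotient_map M H (\<lambda>x. r \<odot>\<^bsub>M\<^esub> x))\<rparr>"

definition direct_sum :: "'i set \<Rightarrow> ('i \<Rightarrow> ('r, 'a) module) \<Rightarrow> ('r, 'i \<Rightarrow> 'a) module" where
  "direct_sum I M =
    \<lparr>carrier = {x \<in> \<Pi>\<^sub>E i\<in>I. carrier (M i). finite {i \<in> I. x i \<noteq> \<zero>\<^bsub>M i\<^esub>}},
     mult = undefined, one = undefined,
     zero = (\<lambda>i\<in>I. \<zero>\<^bsub>M i\<^esub>), add = (\<lambda>x y. \<lambda>i\<in>I. x i \<oplus>\<^bsub>M i\<^esub> y i),
     smult = (\<lambda>r x. \<lambda>i\<in>I. r \<odot>\<^bsub>M i\<^esub> x i)\<rparr>"

definition direct_sum_inj :: "'i set \<Rightarrow> ('i \<Rightarrow> ('r, 'a) module) \<Rightarrow> 'i \<Rightarrow> 'a \<Rightarrow> 'i \<Rightarrow> 'a" where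
  "direct_sum_inj I M i x = (\<lambda>j\<in>I. if j = i then x else \<zero>\<^bsub>M j\<^esub>)"

definition regular_module :: "'r ring \<Rightarrow> ('r, 'r) module" where
  "regular_module R =
    \<lparr>carrier = carrier R, mult = undefined, one = undefined,
     zero = \<zero>\<^bsub>R\<^esub>, add = (\<lambda>x y. x \<oplus>\<^bsub>R\<^esub> y), smult = (\<lambda>r x. r \<otimes>\<^bsub>R\<^esub> x)\<rparr>"

definition free_module :: "'r ring \<Rightarrow> 'i set \<Rightarrow> ('r, 'i \<Rightarrow> 'r) module" where
  "free_module R I = direct_sum I (\<lambda>_. regular_module R)"

definition free_gen :: "'r ring \<Rightarrow> 'i set \<Rightarrow> 'i \<Rightarrow> 'i \<Rightarrow> 'r" where
  "free_gen R I i = direct_sum_inj I (\<lambda>_. regular_module R) i \<one>\<^bsub>R\<^esub>"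

subsection \<open>Tensor products\<close>

abbreviation tensor_free :: "'r ring \<Rightarrow> ('r, 'a) module \<Rightarrow> ('r, 'b) module \<Rightarrow> ('r, 'a \<times> 'b \<Rightarrow> 'r) module" where
  "tensor_free R A B \<equiv> free_module R (carrier A \<times> carrier B)"

abbreviation tensor_gen :: "'r ring \<Rightarrow> ('r, 'a) module \<Rightarrow> ('r, 'b) module \<Rightarrow> 'a \<Rightarrow> 'b \<Rightarrow> 'a \<times> 'b \<Rightarrow> 'r" where
  "tensor_gen R A B a b \<equiv> free_gen R (carrier A \<times> carrier B) (a, b)"

definition tensor_rel :: "'r ring \<Rightarrow> ('r, 'a) module \<Rightarrow> ('r, 'b) module \<Rightarrow> ('a \<times> 'b \<Rightarrow> 'r) set" where
  "tensor_rel R A B = (let T = tensor_free R A B; g = tensor_gen R A B in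
    gen_submodule R T
     ({g (a \<oplus>\<^bsub>A\<^esub> a') b \<ominus>\<^bsub>T\<^esub> (g a b \<oplus>\<^bsub>T\<^esub> g a' b) | a a' b.
         a \<in> carrier A \<and> a' \<in> carrier A \<and> b \<in> carrier B} \<union>
      {g a (b \<oplus>\<^bsub>B\<^esub> b') \<ominus>\<^bsub>T\<^esub> (g a b \<oplus>\<^bsub>T\<^esub> g a b') | a b b'.
         a \<in> carrier A \<and> b \<in> carrier B \<and> b' \<in> carrier B} \<union>
      {g (r \<odot>\<^bsub>A\<^esub> a) b \<ominus>\<^bsub>T\<^esub> r \<odot>\<^bsub>T\<^esub> g a b | r a b.
         r \<in> carrier R \<and> a \<in> carrier A \<and> b \<in> carrier B} \<union>
      {g a (r \<odot>\<^bsub>B\<^esub> b) \<ominus>\<^bsub>T\<^esub> r \<odot>\<^bsub>T\<^esub> g a b | r a b.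
         r \<in> carrier R \<and> a \<in> carrier A \<and> b \<in> carrier B}))"

definition tensor_module :: "'r ring \<Rightarrow> ('r, 'a) module \<Rightarrow> ('r, 'b) module \<Rightarrow> ('r, ('a \<times> 'b \<Rightarrow> 'r) set) module" where
  "tensor_module R A B = quotient_module (tensor_free R A B) (tensor_rel R A B)"

definition tensor_elem :: "'r ring \<Rightarrow> ('r, 'a) module \<Rightarrow> ('r, 'b) module \<Rightarrow> 'a \<Rightarrow> 'b \<Rightarrow> ('a \<times> 'b \<Rightarrow> 'r) set" where
  "tensor_elem R A B a b = tensor_rel R A B +>\<^bsub>tensor_free R A B\<^esub> tensor_gen R A B a b"

text \<open>The map \<open>f \<otimes> g\<close> from \<open>A \<otimes> B\<close> to \<open>A' \<otimes> B'\<close>.\<close>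

definition tensor_map ::
  "'r ring \<Rightarrow> ('r, 'a) module \<Rightarrow> ('r, 'b) module \<Rightarrow> ('r, 'c) module \<Rightarrow> ('r, 'd) module \<Rightarrow>
   ('a \<Rightarrow> 'c) \<Rightarrow> ('b \<Rightarrow> 'd) \<Rightarrow> ('a \<times> 'b \<Rightarrow> 'r) set \<Rightarrow> ('c \<times> 'd \<Rightarrow> 'r) set" where
  "tensor_map R A B A' B' f g =
    quotient_map (tensor_free R A' B') (tensor_rel R A' B')
      (\<lambda>u. \<Oplus>\<^bsub>tensor_free R A' B'\<^esub> p \<in> {p \<in> carrier A \<times> carrier B. u p \<noteq> \<zero>\<^bsub>R\<^esub>}.
             u p \<odot>\<^bsub>tensor_free R A' B'\<^esub> tensor_gen R A' B' (f (fst p)) (g (snd p)))"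


section \<open>Linear and additive categories\<close>

record ('r, 'o, 'm) lincat =
  Obj :: "'o set"
  Dom :: "'m \<Rightarrow> 'o"
  Cod :: "'m \<Rightarrow> 'o"
  Hom :: "'o \<Rightarrow> 'o \<Rightarrow> ('r, 'm) module"
  Ident :: "'o \<Rightarrow> 'm"
  Comp :: "'m \<Rightarrow> 'm \<Rightarrow> 'm"  (infixl \<open>\<cdot>\<index>\<close> 70)

abbreviation mor :: "('r, 'o, 'm) lincat \<Rightarrow> 'o \<Rightarrow> 'o \<Rightarrow> 'm set" where
  "mor C A B \<equiv> carrier (Hom C A B)"

locale linear_category =
  fixes R :: "'r ring" and C :: "('r, 'o, 'm) lincat" (structure)
  assumes cring: "cring R"
    and Hom_module: "\<lbrakk>X \<in> Obj C; Y \<in> Obj C\<rbrakk> \<Longrightarrow> module R (Hom C X Y)"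
    and Dom_Cod: "\<lbrakk>X \<in> Obj C; Y \<in> Obj C; f \<in> mor C X Y\<rbrakk> \<Longrightarrow> Dom C f = X \<and> Cod C f = Y"
    and Ident_mor: "X \<in> Obj C \<Longrightarrow> Ident C X \<in> mor C X X"
    and Ident_left: "\<lbrakk>X \<in> Obj C; Y \<in> Obj C; f \<in> mor C X Y\<rbrakk> \<Longrightarrow> Ident C Y \<cdot> f = f"
    and Ident_right: "\<lbrakk>X \<in> Obj C; Y \<in> Obj C; f \<in> mor C X Y\<rbrakk> \<Longrightarrow> f \<cdot> Ident C X = f"
    and Comp_assoc:
      "\<lbrakk>X \<in> Obj C; Y \<in> Obj C; Z \<in> Obj C; W \<in> Obj C;
        f \<in> mor C X Y; g \<in> mor C Y Z; h \<in> mor C Z W\<rbrakk> \<Longrightarrow> h \<cdot> g \<cdot> f = h \<cdot> (g \<cdot> f)"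
    and Comp_linear_left:
      "\<lbrakk>X \<in> Obj C; Y \<in> Obj C; Z \<in> Obj C; f \<in> mor C X Y\<rbrakk> \<Longrightarrow>
        (\<lambda>g. g \<cdot> f) \<in> mod_hom R (Hom C Y Z) (Hom C X Z)"
    and Comp_linear_right:
      "\<lbrakk>X \<in> Obj C; Y \<in> Obj C; Z \<in> Obj C; g \<in> mor C Y Z\<rbrakk> \<Longrightarrow>
        (\<lambda>f. g \<cdot> f) \<in> mod_hom R (Hom C X Y) (Hom C X Z)"

definition is_iso :: "('r, 'o, 'm) lincat \<Rightarrow> 'o \<Rightarrow> 'o \<Rightarrow> 'm \<Rightarrow> bool" where
  "is_iso C X Y f \<longleftrightarrow> f \<in> mor C X Y \<and>
    (\<exists>g\<in>mor C Y X. g \<cdot>\<^bsub>C\<^esub> f = Ident C X \<and> f \<cdot>\<^bsub>C\<^esub> g = Ident C Y)"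

definition is_zero_object :: "('r, 'o, 'm) lincat \<Rightarrow> 'o \<Rightarrow> bool" where
  "is_zero_object C Z \<longleftrightarrow> Z \<in> Obj C \<and>
    (\<forall>X\<in>Obj C. (\<exists>!f. f \<in> mor C X Z) \<and> (\<exists>!f. f \<in> mor C Z X))"

text \<open>\<open>P = A \<oplus> B\<close> with injections \<open>i\<close>, \<open>j\<close> and projections \<open>p\<close>, \<open>q\<close>.\<close>

definition is_biproduct ::
  "('r, 'o, 'm) lincat \<Rightarrow> 'o \<Rightarrow> 'o \<Rightarrow> 'o \<Rightarrow> 'm \<Rightarrow> 'm \<Rightarrow> 'm \<Rightarrow> 'm \<Rightarrow> bool" where
  "is_biproduct C A B P i j p q \<longleftrightarrow>
    A \<in> Obj C \<and> B \<in> Obj C \<and> P \<in> Obj C \<and>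
    i \<in> mor C A P \<and> j \<in> mor C B P \<and> p \<in> mor C P A \<and> q \<in> mor C P B \<and>
    p \<cdot>\<^bsub>C\<^esub> i = Ident C A \<and> q \<cdot>\<^bsub>C\<^esub> j = Ident C B \<and>
    q \<cdot>\<^bsub>C\<^esub> i = \<zero>\<^bsub>Hom C A B\<^esub> \<and> p \<cdot>\<^bsub>C\<^esub> j = \<zero>\<^bsub>Hom C B A\<^esub> \<and>
    i \<cdot>\<^bsub>C\<^esub> p \<oplus>\<^bsub>Hom C P P\<^esub> j \<cdot>\<^bsub>C\<^esub> q = Ident C P"

locale additive_linear_category = linear_category +
  assumes zero_object: "\<exists>Z. is_zero_object C Z"
    and biproducts:
      "\<lbrakk>A \<in> Obj C; B \<in> Obj C\<rbrakk> \<Longrightarrow> \<exists>P i j p q. is_biproduct C A B P i j p q"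


section \<open>Module-valued functors\<close>

record ('r, 'o, 'm, 'a) modfun =
  FObj :: "'o \<Rightarrow> ('r, 'a) module"
  FMap :: "'m \<Rightarrow> 'a \<Rightarrow> 'a"

text \<open>Functors \<open>C\<^sup>o\<^sup>p \<times> C \<rightarrow> Mod R\<close>, contravariant in the first argument: for \<open>x : X' \<rightarrow> X\<close> and
  \<open>y : Y \<rightarrow> Y'\<close>, \<open>BMap F x y\<close> maps \<open>BObj F X Y\<close> to \<open>BObj F X' Y'\<close>.\<close>

record ('r, 'o, 'm, 'a) bifun =
  BObj :: "'o \<Rightarrow> 'o \<Rightarrow> ('r, 'a) module"
  BMap :: "'m \<Rightarrow> 'm \<Rightarrow> 'a \<Rightarrow> 'a"

locale linear_bifunctor = linear_category +
  fixes F :: "('r, 'o, 'm, 'a) bifun"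
  assumes BObj_module: "\<lbrakk>X \<in> Obj C; Y \<in> Obj C\<rbrakk> \<Longrightarrow> module R (BObj F X Y)"
    and BMap_hom:
      "\<lbrakk>X \<in> Obj C; X' \<in> Obj C; Y \<in> Obj C; Y' \<in> Obj C; x \<in> mor C X' X; y \<in> mor C Y Y'\<rbrakk> \<Longrightarrow>
        BMap F x y \<in> mod_hom R (BObj F X Y) (BObj F X' Y')"
    and BMap_Ident:
      "\<lbrakk>X \<in> Obj C; Y \<in> Obj C; e \<in> carrier (BObj F X Y)\<rbrakk> \<Longrightarrow>
        BMap F (Ident C X) (Ident C Y) e = e"
    and BMap_Comp:
      "\<lbrakk>X \<in> Obj C; X' \<in> Obj C; X'' \<in> Obj C; Y \<in> Obj C; Y' \<in> Obj C; Y'' \<in> Obj C;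
        x \<in> mor C X' X; x' \<in> mor C X'' X'; y \<in> mor C Y Y'; y' \<in> mor C Y' Y'';
        e \<in> carrier (BObj F X Y)\<rbrakk> \<Longrightarrow>
        BMap F (x \<cdot> x') (y' \<cdot> y) e = BMap F x' y' (BMap F x y e)"
    and BMap_linear_left:
      "\<lbrakk>X \<in> Obj C; X' \<in> Obj C; Y \<in> Obj C; Y' \<in> Obj C; y \<in> mor C Y Y';
        e \<in> carrier (BObj F X Y)\<rbrakk> \<Longrightarrow>
        (\<lambda>x. BMap F x y e) \<in> mod_hom R (Hom C X' X) (BObj F X' Y')"
    and BMap_linear_right:
      "\<lbrakk>X \<in> Obj C; X' \<in> Obj C; Y \<in> Obj C; Y' \<in> Obj C; x \<in> mor C X' X;
        e \<in> carrier (BObj F X Y)\<rbrakk> \<Longrightarrow>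
        (\<lambda>y. BMap F x y e) \<in> mod_hom R (Hom C Y Y') (BObj F X' Y')"

definition Hom_bifun :: "('r, 'o, 'm) lincat \<Rightarrow> ('r, 'o, 'm, 'm) bifun" where
  "Hom_bifun C = \<lparr>BObj = Hom C, BMap = (\<lambda>x y f. y \<cdot>\<^bsub>C\<^esub> f \<cdot>\<^bsub>C\<^esub> x)\<rparr>"

text \<open>The covariant functor \<open>F(X, -)\<close>.\<close>

definition covariant_part ::
  "('r, 'o, 'm) lincat \<Rightarrow> ('r, 'o, 'm, 'a) bifun \<Rightarrow> 'o \<Rightarrow> ('r, 'o, 'm, 'a) modfun" where
  "covariant_part C F X = \<lparr>FObj = BObj F X, FMap = BMap F (Ident C X)\<rparr>"

definition representable :: "('r, 'o, 'm) lincat \<Rightarrow> 'o \<Rightarrow> ('r, 'o, 'm, 'm) modfun" where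
  "representable C X = \<lparr>FObj = Hom C X, FMap = (\<lambda>f g. f \<cdot>\<^bsub>C\<^esub> g)\<rparr>"

definition nat_trans ::
  "'r ring \<Rightarrow> ('r, 'o, 'm) lincat \<Rightarrow> ('r, 'o, 'm, 'a) modfun \<Rightarrow> ('r, 'o, 'm, 'b) modfun \<Rightarrow>
   ('o \<Rightarrow> 'a \<Rightarrow> 'b) \<Rightarrow> bool" where
  "nat_trans R C F G \<eta> \<longleftrightarrow>
    (\<forall>X\<in>Obj C. \<eta> X \<in> mod_hom R (FObj F X) (FObj G X)) \<and>
    (\<forall>X\<in>Obj C. \<forall>Y\<in>Obj C. \<forall>f\<in>mor C X Y. \<forall>e\<in>carrier (FObj F X).
      \<eta> Y (FMap F f e) = FMap G f (\<eta> X e))"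

definition nat_epi ::
  "'r ring \<Rightarrow> ('r, 'o, 'm) lincat \<Rightarrow> ('r, 'o, 'm, 'a) modfun \<Rightarrow> ('r, 'o, 'm, 'b) modfun \<Rightarrow>
   ('o \<Rightarrow> 'a \<Rightarrow> 'b) \<Rightarrow> bool" where
  "nat_epi R C F G \<eta> \<longleftrightarrow> nat_trans R C F G \<eta> \<and>
    (\<forall>X\<in>Obj C. \<eta> X ` carrier (FObj F X) = carrier (FObj G X))"

definition nat_iso ::
  "'r ring \<Rightarrow> ('r, 'o, 'm) lincat \<Rightarrow> ('r, 'o, 'm, 'a) modfun \<Rightarrow> ('r, 'o, 'm, 'b) modfun \<Rightarrow>
   ('o \<Rightarrow> 'a \<Rightarrow> 'b) \<Rightarrow> bool" where
  "nat_iso R C F G \<eta> \<longleftrightarrow> nat_trans R C F G \<eta> \<and>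
    (\<forall>X\<in>Obj C. bij_betw (\<eta> X) (carrier (FObj F X)) (carrier (FObj G X)))"

definition cokernel_functor ::
  "('r, 'o, 'm) lincat \<Rightarrow> ('r, 'o, 'm, 'a) modfun \<Rightarrow> ('r, 'o, 'm, 'b) modfun \<Rightarrow>
   ('o \<Rightarrow> 'a \<Rightarrow> 'b) \<Rightarrow> ('r, 'o, 'm, 'b set) modfun" where
  "cokernel_functor C F G \<eta> = (let im = (\<lambda>X. \<eta> X ` carrier (FObj F X)) in
    \<lparr>FObj = (\<lambda>X. quotient_module (FObj G X) (im X)),
     FMap = (\<lambda>f. quotient_map (FObj G (Cod C f)) (im (Cod C f)) (FMap G f))\<rparr>)"

definition finitely_generated ::
  "'r ring \<Rightarrow> ('r, 'o, 'm) lincat \<Rightarrow> ('r, 'o, 'm, 'a) modfun \<Rightarrow> bool" where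
  "finitely_generated R C M \<longleftrightarrow> (\<exists>X\<in>Obj C. \<exists>\<eta>. nat_epi R C (representable C X) M \<eta>)"

definition finitely_presented ::
  "'r ring \<Rightarrow> ('r, 'o, 'm) lincat \<Rightarrow> ('r, 'o, 'm, 'a) modfun \<Rightarrow> bool" where
  "finitely_presented R C M \<longleftrightarrow>
    (\<exists>X\<in>Obj C. \<exists>Y\<in>Obj C. \<exists>\<eta> \<theta>.
      nat_trans R C (representable C Y) (representable C X) \<eta> \<and>
      nat_iso R C (cokernel_functor C (representable C Y) (representable C X) \<eta>) M \<theta>)"


section \<open>Coends\<close>

text \<open>The coend of \<open>T : C\<^sup>o\<^sup>p \<times> C \<rightarrow> Mod R\<close> is the quotient of the direct sum of all \<open>T(M, M)\<close> that
  identifies \<open>T(f, M)(t) \<in> T(M, M)\<close> with \<open>T(N, f)(t) \<in> T(N, N)\<close>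
  for \<open>f : M \<rightarrow> N\<close> and \<open>t \<in> T(N, M)\<close>.\<close>

definition coend_sum :: "('r, 'o, 'm) lincat \<Rightarrow> ('r, 'o, 'm, 'a) bifun \<Rightarrow> ('r, 'o \<Rightarrow> 'a) module" where
  "coend_sum C T = direct_sum (Obj C) (\<lambda>M. BObj T M M)"

definition coend_inj :: "('r, 'o, 'm) lincat \<Rightarrow> ('r, 'o, 'm, 'a) bifun \<Rightarrow> 'o \<Rightarrow> 'a \<Rightarrow> 'o \<Rightarrow> 'a" where
  "coend_inj C T = direct_sum_inj (Obj C) (\<lambda>M. BObj T M M)"

definition coend_rel :: "'r ring \<Rightarrow> ('r, 'o, 'm) lincat \<Rightarrow> ('r, 'o, 'm, 'a) bifun \<Rightarrow> ('o \<Rightarrow> 'a) set" where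
  "coend_rel R C T =
    gen_submodule R (coend_sum C T)
     {coend_inj C T M (BMap T f (Ident C M) t) \<ominus>\<^bsub>coend_sum C T\<^esub>
        coend_inj C T N (BMap T (Ident C N) f t) | M N f t.
       M \<in> Obj C \<and> N \<in> Obj C \<and> f \<in> mor C M N \<and> t \<in> carrier (BObj T N M)}"

definition coend :: "'r ring \<Rightarrow> ('r, 'o, 'm) lincat \<Rightarrow> ('r, 'o, 'm, 'a) bifun \<Rightarrow> ('r, ('o \<Rightarrow> 'a) set) module" where
  "coend R C T = quotient_module (coend_sum C T) (coend_rel R C T)"

text \<open>The map from the coend of some \<open>T\<close> to that of \<open>T'\<close> induced by a family
  \<open>\<phi>\<^sub>M : T(M, M) \<rightarrow> T'(M, M)\<close>.\<close>

definition coend_map ::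
  "'r ring \<Rightarrow> ('r, 'o, 'm) lincat \<Rightarrow> ('r, 'o, 'm, 'b) bifun \<Rightarrow> ('o \<Rightarrow> 'a \<Rightarrow> 'b) \<Rightarrow>
   ('o \<Rightarrow> 'a) set \<Rightarrow> ('o \<Rightarrow> 'b) set" where
  "coend_map R C T' \<phi> =
    quotient_map (coend_sum C T') (coend_rel R C T') (\<lambda>u. \<lambda>M\<in>Obj C. \<phi> M (u M))"

text \<open>The bifunctor \<open>(N, M) \<mapsto> P(N, Y) \<otimes> E(X, M)\<close>.\<close>

definition tensor_bifun ::
  "'r ring \<Rightarrow> ('r, 'o, 'm) lincat \<Rightarrow> ('r, 'o, 'm, 'p) bifun \<Rightarrow> ('r, 'o, 'm, 'e) bifun \<Rightarrow>
   'o \<Rightarrow> 'o \<Rightarrow> ('r, 'o, 'm, ('p \<times> 'e \<Rightarrow> 'r) set) bifun" where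
  "tensor_bifun R C P E X Y =
    \<lparr>BObj = (\<lambda>N M. tensor_module R (BObj P N Y) (BObj E X M)),
     BMap = (\<lambda>f g. tensor_map R (BObj P (Cod C f) Y) (BObj E X (Dom C g))
                       (BObj P (Dom C f) Y) (BObj E X (Cod C g))
                       (BMap P f (Ident C Y)) (BMap E (Ident C X) g))\<rparr>"

text \<open>The bifunctor sending \<open>(X, Y)\<close> to the coend over \<open>M\<close> of \<open>P(M, Y) \<otimes> E(X, M)\<close>.\<close>

definition coend_bifun ::
  "'r ring \<Rightarrow> ('r, 'o, 'm) lincat \<Rightarrow> ('r, 'o, 'm, 'p) bifun \<Rightarrow> ('r, 'o, 'm, 'e) bifun \<Rightarrow>
   ('r, 'o, 'm, ('o \<Rightarrow> ('p \<times> 'e \<Rightarrow> 'r) set) set) bifun" where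
  "coend_bifun R C P E =
    \<lparr>BObj = (\<lambda>X Y. coend R C (tensor_bifun R C P E X Y)),
     BMap = (\<lambda>x y. coend_map R C (tensor_bifun R C P E (Dom C x) (Cod C y))
       (\<lambda>M. tensor_map R (BObj P M (Dom C y)) (BObj E (Cod C x) M)
                 (BObj P M (Cod C y)) (BObj E (Dom C x) M)
                 (BMap P (Ident C M) y) (BMap E x (Ident C M))))\<rparr>"


section \<open>Positive extensions\<close>

text \<open>
  The type of elements of \<open>coend_bifun R C P E\<close> is larger than that of \<open>P\<close>, so the recursion
  defining the functors \<open>E\<^sup>n\<close> is not typable as it stands. We therefore move every
  \<open>E\<^sup>n(X, Y)\<close>, by transport of structure along an injection, into the following type. An element of
  the coend is represented by a list of triples \<open>(M, u, \<delta>)\<close> such that it is the sum of the classes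
  of \<open>u \<otimes> \<delta> \<in> E\<^sup>n\<^sup>-\<^sup>1(M, Y) \<otimes> E(X, M)\<close>; one such list is chosen for every element.
  Every element of the coend is such a sum, so the encoding is injective.
\<close>

datatype ('o, 'm, 'e) pext =
    PHom 'm
  | PExt 'e
  | PSum "('o \<times> ('o, 'm, 'e) pext \<times> 'e) list"

definition transport_module :: "('a \<Rightarrow> 'b) \<Rightarrow> ('r, 'a) module \<Rightarrow> ('r, 'b) module" where
  "transport_module h M = (let k = inv_into (carrier M) h in
    \<lparr>carrier = h ` carrier M, mult = undefined, one = undefined,
     zero = h \<zero>\<^bsub>M\<^esub>, add = (\<lambda>x y. h (k x \<oplus>\<^bsub>M\<^esub> k y)), smult = (\<lambda>r x. h (r \<odot>\<^bsub>M\<^esub> k x))\<rparr>)"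

definition transport_bifun ::
  "('r, 'o, 'm) lincat \<Rightarrow> ('o \<Rightarrow> 'o \<Rightarrow> 'a \<Rightarrow> 'b) \<Rightarrow> ('r, 'o, 'm, 'a) bifun \<Rightarrow> ('r, 'o, 'm, 'b) bifun" where
  "transport_bifun C h F =
    \<lparr>BObj = (\<lambda>X Y. transport_module (h X Y) (BObj F X Y)),
     BMap = (\<lambda>x y e. h (Dom C x) (Cod C y)
       (BMap F x y (inv_into (carrier (BObj F (Cod C x) (Dom C y))) (h (Cod C x) (Dom C y)) e)))\<rparr>"

definition coend_elem ::
  "'r ring \<Rightarrow> ('r, 'o, 'm) lincat \<Rightarrow> ('r, 'o, 'm, 'p) bifun \<Rightarrow> ('r, 'o, 'm, 'e) bifun \<Rightarrow>
   'o \<Rightarrow> 'o \<Rightarrow> 'o \<times> 'p \<times> 'e \<Rightarrow> ('o \<Rightarrow> ('p \<times> 'e \<Rightarrow> 'r) set) set" where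
  "coend_elem R C P E X Y = (\<lambda>(M, u, \<delta>). let T = tensor_bifun R C P E X Y in
    coend_rel R C T +>\<^bsub>coend_sum C T\<^esub>
      coend_inj C T M (tensor_elem R (BObj P M Y) (BObj E X M) u \<delta>))"

definition coend_list_sum ::
  "'r ring \<Rightarrow> ('r, 'o, 'm) lincat \<Rightarrow> ('r, 'o, 'm, 'p) bifun \<Rightarrow> ('r, 'o, 'm, 'e) bifun \<Rightarrow>
   'o \<Rightarrow> 'o \<Rightarrow> ('o \<times> 'p \<times> 'e) list \<Rightarrow> ('o \<Rightarrow> ('p \<times> 'e \<Rightarrow> 'r) set) set" where
  "coend_list_sum R C P E X Y ts =
    foldr (\<lambda>t c. coend_elem R C P E X Y t \<oplus>\<^bsub>BObj (coend_bifun R C P E) X Y\<^esub> c) ts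
      \<zero>\<^bsub>BObj (coend_bifun R C P E) X Y\<^esub>"

definition coend_code ::
  "'r ring \<Rightarrow> ('r, 'o, 'm) lincat \<Rightarrow> ('r, 'o, 'm, ('o, 'm, 'e) pext) bifun \<Rightarrow>
   ('r, 'o, 'm, 'e) bifun \<Rightarrow> 'o \<Rightarrow> 'o \<Rightarrow>
   ('o \<Rightarrow> (('o, 'm, 'e) pext \<times> 'e \<Rightarrow> 'r) set) set \<Rightarrow> ('o, 'm, 'e) pext" where
  "coend_code R C P E X Y c =
    PSum (SOME ts. (\<forall>(M, u, \<delta>)\<in>set ts. M \<in> Obj C \<and> u \<in> carrier (BObj P M Y) \<and>
                                           \<delta> \<in> carrier (BObj E X M)) \<and>
                   coend_list_sum R C P E X Y ts = c)"

fun pos_ext ::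
  "'r ring \<Rightarrow> ('r, 'o, 'm) lincat \<Rightarrow> ('r, 'o, 'm, 'e) bifun \<Rightarrow> nat \<Rightarrow>
   ('r, 'o, 'm, ('o, 'm, 'e) pext) bifun" where
  "pos_ext R C E 0 = transport_bifun C (\<lambda>_ _. PHom) (Hom_bifun C)"
| "pos_ext R C E (Suc 0) = transport_bifun C (\<lambda>_ _. PExt) E"
| "pos_ext R C E (Suc (Suc n)) = (let P = pos_ext R C E (Suc n) in
     transport_bifun C (coend_code R C P E) (coend_bifun R C P E))"


section \<open>Extriangulated categories\<close>

definition sequences :: "('r, 'o, 'm) lincat \<Rightarrow> 'o \<Rightarrow> 'o \<Rightarrow> ('m \<times> 'm) set" where
  "sequences C A D = {(x, y). \<exists>B\<in>Obj C. x \<in> mor C A B \<and> y \<in> mor C B D}"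

definition seq_equiv :: "('r, 'o, 'm) lincat \<Rightarrow> 'o \<Rightarrow> 'o \<Rightarrow> (('m \<times> 'm) \<times> ('m \<times> 'm)) set" where
  "seq_equiv C A D = {((x, y), (x', y')). \<exists>B\<in>Obj C. \<exists>B'\<in>Obj C.
     x \<in> mor C A B \<and> y \<in> mor C B D \<and> x' \<in> mor C A B' \<and> y' \<in> mor C B' D \<and>
     (\<exists>b. is_iso C B B' b \<and> b \<cdot>\<^bsub>C\<^esub> x = x' \<and> y' \<cdot>\<^bsub>C\<^esub> b = y)}"

text \<open>\<open>\<ss> D A \<delta>\<close> is the equivalence class of sequences assigned to \<open>\<delta> \<in> E(D, A)\<close>.
  \<open>s_triangle C E \<ss> A x B y D \<delta>\<close> means that \<open>\<delta> \<in> E(D, A)\<close> and \<open>\<ss>(\<delta>) = [A \<rightarrow> B \<rightarrow> D]\<close>.\<close>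

definition s_triangle ::
  "('r, 'o, 'm) lincat \<Rightarrow> ('r, 'o, 'm, 'e) bifun \<Rightarrow> ('o \<Rightarrow> 'o \<Rightarrow> 'e \<Rightarrow> ('m \<times> 'm) set) \<Rightarrow>
   'o \<Rightarrow> 'm \<Rightarrow> 'o \<Rightarrow> 'm \<Rightarrow> 'o \<Rightarrow> 'e \<Rightarrow> bool" where
  "s_triangle C E \<ss> A x B y D \<delta> \<longleftrightarrow>
    A \<in> Obj C \<and> B \<in> Obj C \<and> D \<in> Obj C \<and> x \<in> mor C A B \<and> y \<in> mor C B D \<and>
    \<delta> \<in> carrier (BObj E D A) \<and> \<ss> D A \<delta> = seq_equiv C A D `` {(x, y)}"

text \<open>\<open>push C E D a \<delta>\<close> is \<open>a\<^sub>*\<delta>\<close> and \<open>pull C E A c \<delta>\<close> is \<open>c\<^sup>*\<delta>\<close>, for \<open>\<delta> \<in> E(D, A)\<close>.\<close>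

abbreviation push :: "('r, 'o, 'm) lincat \<Rightarrow> ('r, 'o, 'm, 'e) bifun \<Rightarrow> 'o \<Rightarrow> 'm \<Rightarrow> 'e \<Rightarrow> 'e" where
  "push C E D a \<delta> \<equiv> BMap E (Ident C D) a \<delta>"

abbreviation pull :: "('r, 'o, 'm) lincat \<Rightarrow> ('r, 'o, 'm, 'e) bifun \<Rightarrow> 'o \<Rightarrow> 'm \<Rightarrow> 'e \<Rightarrow> 'e" where
  "pull C E A c \<delta> \<equiv> BMap E c (Ident C A) \<delta>"

locale additive_realization =
  additive_linear_category R C + linear_bifunctor R C E
  for R :: "'r ring" and C :: "('r, 'o, 'm) lincat" (structure)
    and E :: "('r, 'o, 'm, 'e) bifun" +
  fixes \<ss> :: "'o \<Rightarrow> 'o \<Rightarrow> 'e \<Rightarrow> ('m \<times> 'm) set"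
  assumes realization_class:
      "\<lbrakk>D \<in> Obj C; A \<in> Obj C; \<delta> \<in> carrier (BObj E D A)\<rbrakk> \<Longrightarrow>
        \<ss> D A \<delta> \<in> sequences C A D // seq_equiv C A D"
    and realization_morphism:
      "\<lbrakk>s_triangle C E \<ss> A x B y D \<delta>; s_triangle C E \<ss> A' x' B' y' D' \<delta>';
        a \<in> mor C A A'; c \<in> mor C D D'; push C E D a \<delta> = pull C E A' c \<delta>'\<rbrakk> \<Longrightarrow>
        \<exists>b\<in>mor C B B'. b \<cdot> x = x' \<cdot> a \<and> y' \<cdot> b = c \<cdot> y"
    and realization_zero:
      "is_biproduct C A D P i j p q \<Longrightarrow> s_triangle C E \<ss> A i P q D \<zero>\<^bsub>BObj E D A\<^esub>"
    \<comment> \<open>\<open>\<epsilon>\<close> is \<open>\<delta> \<oplus> \<delta>'\<close>, and the maps of the resulting triangle are \<open>x \<oplus> x'\<close> and \<open>y \<oplus> y'\<close>\<close>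
    and realization_sum:
      "\<lbrakk>s_triangle C E \<ss> A x B y D \<delta>; s_triangle C E \<ss> A' x' B' y' D' \<delta>';
        is_biproduct C A A' A'' i\<^sub>A j\<^sub>A p\<^sub>A q\<^sub>A;
        is_biproduct C B B' B'' i\<^sub>B j\<^sub>B p\<^sub>B q\<^sub>B;
        is_biproduct C D D' D'' i\<^sub>D j\<^sub>D p\<^sub>D q\<^sub>D;
        \<epsilon> \<in> carrier (BObj E D'' A'');
        BMap E i\<^sub>D p\<^sub>A \<epsilon> = \<delta>; BMap E j\<^sub>D q\<^sub>A \<epsilon> = \<delta>';
        BMap E i\<^sub>D q\<^sub>A \<epsilon> = \<zero>\<^bsub>BObj E D A'\<^esub>; BMap E j\<^sub>D p\<^sub>A \<epsilon> = \<zero>\<^bsub>BObj E D' A\<^esub>\<rbrakk> \<Longrightarrow>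
        s_triangle C E \<ss>
          A'' (i\<^sub>B \<cdot> x \<cdot> p\<^sub>A \<oplus>\<^bsub>Hom C A'' B''\<^esub> j\<^sub>B \<cdot> x' \<cdot> q\<^sub>A)
          B'' (i\<^sub>D \<cdot> y \<cdot> p\<^sub>B \<oplus>\<^bsub>Hom C B'' D''\<^esub> j\<^sub>D \<cdot> y' \<cdot> q\<^sub>B) D'' \<epsilon>"

locale extriangulated_category = additive_realization +
  assumes ET3:
      "\<lbrakk>s_triangle C E \<ss> A x B y D \<delta>; s_triangle C E \<ss> A' x' B' y' D' \<delta>';
        a \<in> mor C A A'; b \<in> mor C B B'; b \<cdot> x = x' \<cdot> a\<rbrakk> \<Longrightarrow>
        \<exists>c\<in>mor C D D'. c \<cdot> y = y' \<cdot> b \<and> push C E D a \<delta> = pull C E A' c \<delta>'"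
    and ET3_op:
      "\<lbrakk>s_triangle C E \<ss> A x B y D \<delta>; s_triangle C E \<ss> A' x' B' y' D' \<delta>';
        b \<in> mor C B B'; c \<in> mor C D D'; c \<cdot> y = y' \<cdot> b\<rbrakk> \<Longrightarrow>
        \<exists>a\<in>mor C A A'. b \<cdot> x = x' \<cdot> a \<and> push C E D a \<delta> = pull C E A' c \<delta>'"
    and ET4:
      "\<lbrakk>s_triangle C E \<ss> A f B f' D \<delta>; s_triangle C E \<ss> B g G g' F \<delta>'\<rbrakk> \<Longrightarrow>
        \<exists>K\<in>Obj C. \<exists>d\<in>mor C D K. \<exists>e\<in>mor C K F. \<exists>h'\<in>mor C G K. \<exists>\<delta>''.
          h' \<cdot> g = d \<cdot> f' \<and> e \<cdot> h' = g' \<and>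
          s_triangle C E \<ss> A (g \<cdot> f) G h' K \<delta>'' \<and>
          s_triangle C E \<ss> D d K e F (push C E F f' \<delta>') \<and>
          pull C E A d \<delta>'' = \<delta> \<and>
          push C E K f \<delta>'' = pull C E B e \<delta>'"
    and ET4_op:
      "\<lbrakk>s_triangle C E \<ss> D f' B f A \<delta>; s_triangle C E \<ss> F g' G g B \<delta>'\<rbrakk> \<Longrightarrow>
        \<exists>K\<in>Obj C. \<exists>d\<in>mor C K D. \<exists>e\<in>mor C F K. \<exists>h'\<in>mor C K G. \<exists>\<delta>''.
          g \<cdot> h' = f' \<cdot> d \<and> h' \<cdot> e = g' \<and>
          s_triangle C E \<ss> K h' G (f \<cdot> g) A \<delta>'' \<and>
          s_triangle C E \<ss> F e K d D (pull C E F f' \<delta>') \<and>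
          push C E A d \<delta>'' = \<delta> \<and>
          pull C E K f \<delta>'' = push C E B e \<delta>'"

definition is_deflation ::
  "('r, 'o, 'm) lincat \<Rightarrow> ('r, 'o, 'm, 'e) bifun \<Rightarrow> ('o \<Rightarrow> 'o \<Rightarrow> 'e \<Rightarrow> ('m \<times> 'm) set) \<Rightarrow>
   'o \<Rightarrow> 'o \<Rightarrow> 'm \<Rightarrow> bool" where
  "is_deflation C E \<ss> B D y \<longleftrightarrow> (\<exists>A x \<delta>. s_triangle C E \<ss> A x B y D \<delta>)"

definition is_projective_morphism ::
  "('r, 'o, 'm) lincat \<Rightarrow> ('r, 'o, 'm, 'e) bifun \<Rightarrow> 'o \<Rightarrow> 'o \<Rightarrow> 'm \<Rightarrow> bool" where
  "is_projective_morphism C E X Y f \<longleftrightarrow> f \<in> mor C X Y \<and>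
    (\<forall>A\<in>Obj C. \<forall>\<delta>\<in>carrier (BObj E Y A). pull C E A f \<delta> = \<zero>\<^bsub>BObj E X A\<^esub>)"

definition enough_projective_morphisms ::
  "('r, 'o, 'm) lincat \<Rightarrow> ('r, 'o, 'm, 'e) bifun \<Rightarrow> ('o \<Rightarrow> 'o \<Rightarrow> 'e \<Rightarrow> ('m \<times> 'm) set) \<Rightarrow> bool" where
  "enough_projective_morphisms C E \<ss> \<longleftrightarrow>
    (\<forall>X\<in>Obj C. \<exists>G\<in>Obj C. \<exists>g. is_deflation C E \<ss> G X g \<and> is_projective_morphism C E G X g)"

end

theory Submission
  imports Defs
begin

text \<open>
  By Yoneda, an epimorphism from \<open>C(A, -)\<close> to \<open>F(X, -)\<close> is an element \<open>m \<in> F(X, A)\<close> such that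
  every element of every \<open>F(X, Z)\<close> is \<open>g\<^sub>* m\<close> for some \<open>g : A \<rightarrow> Z\<close>. A presentation adds a morphism
  \<open>f : A \<rightarrow> G\<close> such that \<open>g\<^sub>* m = 0\<close> precisely if \<open>g\<close> factors through \<open>f\<close>. The whole argument is
  carried out with such generators and presentations (\<open>generates\<close>, \<open>presents\<close>); the natural
  transformations of the theorem only appear when it is translated.

  Let \<open>A \<rightarrow> G \<rightarrow> X\<close> with maps \<open>x\<close> and \<open>g\<close> realize \<open>\<delta> \<in> E(X, A)\<close>. Then \<open>\<delta>\<close> generates
  \<open>E(X, -)\<close> if and only if \<open>g\<close> is projective. Indeed \<open>g\<^sup>*\<delta> = 0\<close> always holds, so if every extension
  of \<open>X\<close> is some \<open>a\<^sub>*\<delta>\<close>, then \<open>g\<^sup>*\<close> kills every extension of \<open>X\<close>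
  (\<open>generator_deflation_projective\<close>). Conversely, if \<open>g\<^sup>*\<epsilon> = 0\<close> then \<open>g\<close> lifts to the middle
  term of the triangle of \<open>\<epsilon>\<close>, and completing this lift to a morphism of triangles exhibits \<open>\<epsilon>\<close> as
  some \<open>a\<^sub>*\<delta>\<close> (\<open>projective_deflation_generates\<close>). This is the equivalence of enough projective
  morphisms with finite generation. Moreover \<open>a\<^sub>*\<delta> = 0\<close> if and only if \<open>a\<close> factors through \<open>x\<close>,
  so a generated \<open>E(X, -)\<close> is presented by \<open>\<delta>\<close> and \<open>x\<close> (\<open>generates_imp_presents\<close>).

  For the higher extensions, put \<open>P = E\<^sup>n\<close> with \<open>n \<ge> 1\<close>. Tensoring and coends are right exact, and
  the coend over \<open>M\<close> of \<open>P(M, Y) \<otimes> C(A, M)\<close> is \<open>P(A, Y)\<close>. The presentation of \<open>E(X, -)\<close> by \<open>\<delta>\<close>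
  and \<open>x\<close> therefore gives an exact sequence
  \<open>P(G, Y) \<rightarrow> P(A, Y) \<rightarrow> E\<^sup>n\<^sup>+\<^sup>1(X, Y) \<rightarrow> 0\<close> whose maps are \<open>x\<^sup>*\<close> and \<open>u \<mapsto> [u \<otimes> \<delta>]\<close>
  (\<open>coend_generator\<close>, \<open>coend_kernel\<close>). So \<open>E\<^sup>n\<^sup>+\<^sup>1(X, -)\<close> is the cokernel of a map between
  functors that are presented by induction, and a cokernel of such a map is presented by the
  generator of the target, its relation, and the image of the generator of the source
  (\<open>presents_coend\<close>). The last two relations are combined into one by a biproduct.
  The converse implication is the case \<open>n = 1\<close>.

  The modules involved are quotients of free modules and of direct sums. They are only accessed
  through their universal properties and through induction on generators.
\<close>

section \<open>Homomorphisms of modules\<close>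

lemma mod_homI:
  assumes "\<And>x. x \<in> carrier M \<Longrightarrow> h x \<in> carrier N"
    and "\<And>x y. \<lbrakk>x \<in> carrier M; y \<in> carrier M\<rbrakk> \<Longrightarrow> h (x \<oplus>\<^bsub>M\<^esub> y) = h x \<oplus>\<^bsub>N\<^esub> h y"
    and "\<And>r x. \<lbrakk>r \<in> carrier R; x \<in> carrier M\<rbrakk> \<Longrightarrow> h (r \<odot>\<^bsub>M\<^esub> x) = r \<odot>\<^bsub>N\<^esub> h x"
  shows "h \<in> mod_hom R M N"
  using assms by (auto simp: mod_hom_def)

lemma mod_homD:
  assumes "h \<in> mod_hom R M N"
  shows mod_hom_closed: "x \<in> carrier M \<Longrightarrow> h x \<in> carrier N"
    and mod_hom_add: "\<lbrakk>x \<in> carrier M; y \<in> carrier M\<rbrakk> \<Longrightarrow> h (x \<oplus>\<^bsub>M\<^esub> y) = h x \<oplus>\<^bsub>N\<^esub> h y"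
    and mod_hom_smult: "\<lbrakk>r \<in> carrier R; x \<in> carrier M\<rbrakk> \<Longrightarrow> h (r \<odot>\<^bsub>M\<^esub> x) = r \<odot>\<^bsub>N\<^esub> h x"
  using assms by (auto simp: mod_hom_def)

lemma mod_hom_zero:
  assumes "module R M" "module R N" "h \<in> mod_hom R M N"
  shows "h \<zero>\<^bsub>M\<^esub> = \<zero>\<^bsub>N\<^esub>"
proof -
  interpret M: module R M by fact
  interpret N: module R N by fact
  have "h \<zero>\<^bsub>M\<^esub> = h (\<zero>\<^bsub>R\<^esub> \<odot>\<^bsub>M\<^esub> \<zero>\<^bsub>M\<^esub>)" by simp
  also have "\<dots> = \<zero>\<^bsub>R\<^esub> \<odot>\<^bsub>N\<^esub> h \<zero>\<^bsub>M\<^esub>" by (rule mod_hom_smult[OF assms(3)]) auto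
  also have "\<dots> = \<zero>\<^bsub>N\<^esub>" using mod_hom_closed[OF assms(3)] by simp
  finally show ?thesis .
qed

lemma (in abelian_group) minus_zero_iff:
  assumes "x \<in> carrier G" "y \<in> carrier G"
  shows "x \<ominus> y = \<zero> \<longleftrightarrow> x = y"
  using assms by (metis a_minus_def add.inv_closed l_zero minus_equality minus_minus r_neg add.inv_comm)

lemma (in abelian_group) minus_eq_iff:
  assumes "x \<in> carrier G" "y \<in> carrier G" "z \<in> carrier G"
  shows "x \<ominus> y = z \<longleftrightarrow> x = z \<oplus> y"
  using assms by (metis a_assoc a_inv_closed a_minus_def l_neg r_neg r_zero)

lemma (in abelian_group) minus_zero_right: "x \<in> carrier G \<Longrightarrow> x \<ominus> \<zero> = x"
  by (simp add: a_minus_def)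

lemma mod_hom_minus:
  assumes "module R M" "module R N" "h \<in> mod_hom R M N" "x \<in> carrier M" "y \<in> carrier M"
  shows "h (x \<ominus>\<^bsub>M\<^esub> y) = h x \<ominus>\<^bsub>N\<^esub> h y"
proof -
  interpret M: module R M by fact
  interpret N: module R N by fact
  note c = mod_hom_closed[OF assms(3)]
  have "h (x \<ominus>\<^bsub>M\<^esub> y) \<oplus>\<^bsub>N\<^esub> h y = h x"
    using assms(4,5) by (simp flip: mod_hom_add[OF assms(3)] add: a_minus_def M.a_assoc M.l_neg)
  moreover have "(h x \<ominus>\<^bsub>N\<^esub> h y) \<oplus>\<^bsub>N\<^esub> h y = h x"
    using assms(4,5) c by (simp add: a_minus_def N.a_assoc N.l_neg)
  ultimately show ?thesis
    using assms(4,5) c by (metis N.add.right_cancel M.minus_closed N.minus_closed)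
qed

lemma mod_hom_comp:
  assumes "h \<in> mod_hom R M N" "k \<in> mod_hom R N L"
  shows "(\<lambda>x. k (h x)) \<in> mod_hom R M L"
  using assms by (auto simp: mod_hom_def Pi_iff)

lemma mod_hom_sum:
  assumes "module R M" "module R N" "h \<in> mod_hom R M N" "k \<in> mod_hom R M N"
  shows "(\<lambda>x. h x \<oplus>\<^bsub>N\<^esub> k x) \<in> mod_hom R M N"
proof -
  interpret M: module R M by fact
  interpret N: module R N by fact
  show ?thesis
    by (rule mod_homI)
      (simp_all add: mod_homD[OF assms(3)] mod_homD[OF assms(4)] N.smult_r_distr N.a_ac)
qed

lemma mod_hom_zero_map:
  assumes "module R M" "module R N"
  shows "(\<lambda>x. \<zero>\<^bsub>N\<^esub>) \<in> mod_hom R M N"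
proof -
  interpret M: module R M by fact
  interpret N: module R N by fact
  show ?thesis by (rule mod_homI) simp_all
qed

lemma mod_hom_cong:
  assumes "module R M" "h \<in> mod_hom R M N" "\<And>x. x \<in> carrier M \<Longrightarrow> k x = h x"
  shows "k \<in> mod_hom R M N"
proof -
  interpret M: module R M by fact
  show ?thesis by (rule mod_homI) (simp_all add: assms(3) mod_homD[OF assms(2)])
qed

text \<open>
  Quotients and transported modules are images of a module under a map that respects the
  operations, so the module axioms need to be checked only here.
\<close>

lemma module_image:
  assumes "module R M" and surj: "p ` carrier M = carrier Q"
    and add: "\<And>x y. \<lbrakk>x \<in> carrier M; y \<in> carrier M\<rbrakk> \<Longrightarrow> p x \<oplus>\<^bsub>Q\<^esub> p y = p (x \<oplus>\<^bsub>M\<^esub> y)"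
    and smult: "\<And>r x. \<lbrakk>r \<in> carrier R; x \<in> carrier M\<rbrakk> \<Longrightarrow> r \<odot>\<^bsub>Q\<^esub> p x = p (r \<odot>\<^bsub>M\<^esub> x)"
    and zero: "\<zero>\<^bsub>Q\<^esub> = p \<zero>\<^bsub>M\<^esub>"
  shows "module R Q"
proof -
  interpret M: module R M by fact
  have c: "\<exists>a\<in>carrier M. z = p a" if "z \<in> carrier Q" for z using that surj by auto
  have p: "p x \<in> carrier Q" if "x \<in> carrier M" for x using that surj by auto
  show ?thesis
  proof (rule moduleI)
    show "cring R" by (rule M.R.is_cring)
    show "abelian_group Q"
    proof (rule abelian_groupI)
      fix x assume x: "x \<in> carrier Q"
      then obtain a where a: "a \<in> carrier M" "x = p a" using c by blast
      have "p (\<ominus>\<^bsub>M\<^esub> a) \<in> carrier Q \<and> p (\<ominus>\<^bsub>M\<^esub> a) \<oplus>\<^bsub>Q\<^esub> x = \<zero>\<^bsub>Q\<^esub>"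
        using a p by (simp add: add zero M.l_neg)
      then show "\<exists>y\<in>carrier Q. y \<oplus>\<^bsub>Q\<^esub> x = \<zero>\<^bsub>Q\<^esub>" by blast
    qed (use p in \<open>auto dest!: c simp: add zero M.a_ac\<close>)
  qed (use p in \<open>auto dest!: c simp: add smult M.smult_l_distr M.smult_r_distr M.smult_assoc1\<close>)
qed

section \<open>Quotient modules\<close>

locale module_quotient = module R M + submodule H R M
  for R :: "'r ring" and M :: "('r, 'a) module" (structure) and H
begin

sublocale Q: abelian_subgroup H M
  by (rule abelian_subgroupI3) (auto intro: additive_subgroupI subgroup_axioms abelian_group_axioms)

lemma submodule_carrier: "x \<in> H \<Longrightarrow> x \<in> carrier M"
  using submoduleE(1)[OF submodule_axioms] by auto

lemma coset_eq_iff: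
  assumes "x \<in> carrier M" "y \<in> carrier M"
  shows "H +> x = H +> y \<longleftrightarrow> x \<ominus> y \<in> H"
proof
  assume "H +> x = H +> y"
  then have "x \<in> H +> y" using assms by (metis Q.a_rcos_self)
  then show "x \<ominus> y \<in> H" using assms by (simp add: Q.a_rcos_module a_minus_def)
next
  assume "x \<ominus> y \<in> H"
  then have "x \<in> H +> y" using assms by (simp add: Q.a_rcos_module a_minus_def)
  then show "H +> x = H +> y" using assms by (metis Q.a_repr_independence')
qed


lemma coset_zero: "H +> \<zero> = H"
  by (meson Q.a_subset a_coset_add_zero)

lemma coset_in: "x \<in> carrier M \<Longrightarrow> H +> x \<in> carrier (quotient_module M H)"
  by (auto simp: quotient_module_def A_RCOSETS_def')

lemma quotient_cases:
  assumes "c \<in> carrier (quotient_module M H)"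
  obtains x where "x \<in> carrier M" "c = H +> x"
  using assms by (auto simp: quotient_module_def A_RCOSETS_def')

text \<open>
  \<open>quotient_map\<close> takes the only element of a set of cosets, which is specified only if the given
  map respects the submodules. It is evaluated by exhibiting a function \<open>K\<close> on the quotient that
  is already known to have the required values; such a \<open>K\<close> usually comes from a universal property.
\<close>

lemma quotient_map_eq:
  assumes "c \<in> carrier (quotient_module M H)"
    and K: "\<And>u. u \<in> carrier M \<Longrightarrow> K (H +> u) = H' +>\<^bsub>M'\<^esub> h u"
  shows "quotient_map M' H' h c = K c"
proof -
  obtain x where x: "x \<in> carrier M" "c = H +> x" using assms(1) by (rule quotient_cases)
  have "H' +>\<^bsub>M'\<^esub> h u = K c" if "u \<in> c" for u
    using that x K by (metis Q.a_elemrcos_carrier Q.a_repr_independence')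
  moreover have "x \<in> c" using x by (simp add: Q.a_rcos_self)
  ultimately have "(\<lambda>u. H' +>\<^bsub>M'\<^esub> h u) ` c = {K c}" by auto
  then show ?thesis by (simp add: quotient_map_def)
qed

lemma quotient_add:
  "\<lbrakk>x \<in> carrier M; y \<in> carrier M\<rbrakk> \<Longrightarrow> (H +> x) \<oplus>\<^bsub>quotient_module M H\<^esub> (H +> y) = H +> (x \<oplus> y)"
  by (simp add: quotient_module_def Q.a_rcos_sum)

lemma quotient_smult:
  assumes "r \<in> carrier R" "x \<in> carrier M"
  shows "r \<odot>\<^bsub>quotient_module M H\<^esub> (H +> x) = H +> (r \<odot> x)"
proof -
  have eq: "H +> (r \<odot> u) = H +> (r \<odot> v)" if "u \<in> carrier M" "v \<in> carrier M" "H +> u = H +> v" for u v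
  proof -
    have "r \<odot> (u \<ominus> v) \<in> H" using that assms coset_eq_iff by auto
    then show ?thesis using that assms
      by (simp add: coset_eq_iff a_minus_def smult_r_distr smult_r_minus)
  qed
  define K where "K c = H +> (r \<odot> (SOME u. u \<in> carrier M \<and> c = H +> u))" for c
  have "K (H +> u) = H +> (r \<odot> u)" if u: "u \<in> carrier M" for u
  proof -
    have "(SOME v. v \<in> carrier M \<and> H +> u = H +> v) \<in> carrier M \<and>
        H +> u = H +> (SOME v. v \<in> carrier M \<and> H +> u = H +> v)"
      by (rule someI[of "\<lambda>v. v \<in> carrier M \<and> H +> u = H +> v" u]) (simp add: u)
    then show ?thesis unfolding K_def using u eq by blast
  qed
  then show ?thesis
    using quotient_map_eq[where c = "H +> x" and K = K and H' = H and M' = M and h = "\<lambda>u. r \<odot> u"]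
      assms coset_in
    by (simp add: quotient_module_def)
qed

lemma quotient_is_module: "module R (quotient_module M H)"
proof (rule module_image)
  show "(\<lambda>x. H +> x) ` carrier M = carrier (quotient_module M H)"
    by (auto intro: coset_in elim: quotient_cases)
  show "\<zero>\<^bsub>quotient_module M H\<^esub> = H +> \<zero>"
    by (simp add: coset_zero quotient_module_def)
qed (auto simp: quotient_add quotient_smult module_axioms)

lemma quotient_proj: "(\<lambda>x. H +> x) \<in> mod_hom R M (quotient_module M H)"
  by (rule mod_homI) (simp_all add: coset_in quotient_add quotient_smult)

lemma quotient_zero_iff:
  assumes "x \<in> carrier M"
  shows "H +> x = \<zero>\<^bsub>quotient_module M H\<^esub> \<longleftrightarrow> x \<in> H"
proof -
  have "H +> x = H +> \<zero> \<longleftrightarrow> x \<in> H" using assms coset_eq_iff[of x \<zero>] by (simp add: minus_zero_right)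
  then show ?thesis by (simp add: coset_zero quotient_module_def)
qed

lemma quotient_universal:
  assumes "module R N" "h \<in> mod_hom R M N" "\<And>x. x \<in> H \<Longrightarrow> h x = \<zero>\<^bsub>N\<^esub>"
  shows "\<exists>K\<in>mod_hom R (quotient_module M H) N. \<forall>x\<in>carrier M. K (H +> x) = h x"
proof -
  interpret N: module R N by fact
  define K where "K c = h (SOME u. u \<in> carrier M \<and> c = H +> u)" for c
  have K: "K (H +> u) = h u" if u: "u \<in> carrier M" for u
  proof -
    define v where "v = (SOME v. v \<in> carrier M \<and> H +> u = H +> v)"
    have v: "v \<in> carrier M \<and> H +> u = H +> v" unfolding v_def
      by (rule someI[of "\<lambda>v. v \<in> carrier M \<and> H +> u = H +> v" u]) (simp add: u)
    then have "h (v \<ominus> u) = \<zero>\<^bsub>N\<^esub>" using u coset_eq_iff assms(3) by metis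
    then have "h v \<ominus>\<^bsub>N\<^esub> h u = \<zero>\<^bsub>N\<^esub>"
      using u v mod_hom_minus[OF module_axioms assms(1,2), of v u] by simp
    then have "h v = h u" using u v mod_hom_closed[OF assms(2)] by (simp add: N.minus_zero_iff)
    then show ?thesis by (simp add: K_def v_def)
  qed
  have "K \<in> mod_hom R (quotient_module M H) N"
    by (rule mod_homI; elim quotient_cases)
      (simp_all add: quotient_add quotient_smult K mod_homD[OF assms(2)])
  with K show ?thesis by blast
qed

end

lemma gen_submodule_is_submodule:
  assumes "module R M" "S \<subseteq> carrier M"
  shows "submodule (gen_submodule R M S) R M"
proof -
  interpret module R M by fact
  let ?F = "{H. submodule H R M \<and> S \<subseteq> H}"
  have "carrier M \<in> ?F" using carrier_is_submodule assms by auto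
  moreover have "\<zero>\<^bsub>M\<^esub> \<in> H" if "submodule H R M" for H
    using subgroup.one_closed[OF submodule.axioms(1)[OF that]] by simp
  ultimately show ?thesis unfolding gen_submodule_def
    by (intro submoduleI Inter_iff[THEN iffD2] ballI)
      (blast intro: submoduleE(3-5))+
qed

lemma gen_submodule_incl: "x \<in> S \<Longrightarrow> x \<in> gen_submodule R M S"
  by (auto simp: gen_submodule_def)

text \<open>
  The kernel of \<open>h\<close> is a submodule; this is how a homomorphism is shown to descend to a quotient
  by relations.
\<close>

lemma mod_hom_gen_submodule:
  assumes "module R M" "module R N" "h \<in> mod_hom R M N" "S \<subseteq> carrier M"
    and "\<And>x. x \<in> S \<Longrightarrow> h x = \<zero>\<^bsub>N\<^esub>" "x \<in> gen_submodule R M S"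
  shows "h x = \<zero>\<^bsub>N\<^esub>"
proof -
  interpret M: module R M by fact
  interpret N: module R N by fact
  have neg: "h (\<ominus>\<^bsub>M\<^esub> a) = \<ominus>\<^bsub>N\<^esub> (h a)" if "a \<in> carrier M" for a
    using mod_hom_minus[OF assms(1-3) M.zero_closed that] that mod_hom_closed[OF assms(3)]
    by (simp add: a_minus_def mod_hom_zero[OF assms(1-3)])
  have "submodule {x \<in> carrier M. h x = \<zero>\<^bsub>N\<^esub>} R M"
    by (rule M.submoduleI)
      (auto simp: mod_homD[OF assms(3)] mod_hom_zero[OF assms(1-3)] neg)
  moreover have "S \<subseteq> {x \<in> carrier M. h x = \<zero>\<^bsub>N\<^esub>}" using assms(4,5) by auto
  ultimately show ?thesis using assms(6) by (auto simp: gen_submodule_def)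
qed

lemma mod_hom_image_submodule:
  assumes "module R M" "module R N" "h \<in> mod_hom R M N"
  shows "submodule (h ` carrier M) R N"
proof -
  interpret M: module R M by fact
  interpret N: module R N by fact
  note h = mod_homD[OF assms(3)]
  show ?thesis
  proof (rule N.submoduleI)
    show "\<zero>\<^bsub>N\<^esub> \<in> h ` carrier M" using mod_hom_zero[OF assms] by (metis M.zero_closed imageI)
    fix a b r assume a: "a \<in> h ` carrier M"
    then obtain x where x: "x \<in> carrier M" "a = h x" by blast
    have "h (\<zero>\<^bsub>M\<^esub> \<ominus>\<^bsub>M\<^esub> x) = \<ominus>\<^bsub>N\<^esub> a"
      using x h(1) mod_hom_minus[OF assms M.zero_closed x(1)] mod_hom_zero[OF assms]
      by (simp add: a_minus_def)
    then show "\<ominus>\<^bsub>N\<^esub> a \<in> h ` carrier M" using x(1) by (metis M.minus_closed M.zero_closed imageI)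
    show "a \<oplus>\<^bsub>N\<^esub> b \<in> h ` carrier M" if "b \<in> h ` carrier M"
      using that x by (auto simp flip: h(2))
    show "r \<odot>\<^bsub>N\<^esub> a \<in> h ` carrier M" if "r \<in> carrier R"
      using that x by (auto simp flip: h(3))
  qed (use h(1) in auto)
qed

lemma quotient_map_coset:
  assumes "module_quotient R M H" "module_quotient R M' H'" and h: "h \<in> mod_hom R M M'"
    and H: "\<And>x. x \<in> H \<Longrightarrow> h x \<in> H'" and x: "x \<in> carrier M"
  shows "quotient_map M' H' h (H +>\<^bsub>M\<^esub> x) = H' +>\<^bsub>M'\<^esub> h x"
proof -
  interpret U: module_quotient R M H by fact
  interpret V: module_quotient R M' H' by fact
  have "H' +>\<^bsub>M'\<^esub> h x = \<zero>\<^bsub>quotient_module M' H'\<^esub>" if "x \<in> H" for x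
    by (simp add: V.quotient_zero_iff mod_hom_closed[OF h] U.submodule_carrier H that)
  from U.quotient_universal[OF V.quotient_is_module mod_hom_comp[OF h V.quotient_proj] this]
  obtain K where K: "\<And>x. x \<in> carrier M \<Longrightarrow> K (H +>\<^bsub>M\<^esub> x) = H' +>\<^bsub>M'\<^esub> h x"
    by auto
  have "quotient_map M' H' h (H +>\<^bsub>M\<^esub> x) = K (H +>\<^bsub>M\<^esub> x)"
    by (rule U.quotient_map_eq[OF U.coset_in[OF x]]) (rule K)
  then show ?thesis using K[OF x] by simp
qed

section \<open>Direct sums\<close>

lemma direct_sum_carrier:
  "x \<in> carrier (direct_sum I M) \<longleftrightarrow> x \<in> (\<Pi>\<^sub>E i\<in>I. carrier (M i)) \<and> finite {i \<in> I. x i \<noteq> \<zero>\<^bsub>M i\<^esub>}"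
  by (simp add: direct_sum_def)

locale module_family =
  fixes R :: "'r ring" and I :: "'i set" and M :: "'i \<Rightarrow> ('r, 'a) module"
  assumes cring: "cring R" and mods: "i \<in> I \<Longrightarrow> module R (M i)"
begin

abbreviation "S \<equiv> direct_sum I M"

lemma component_rules:
  assumes "i \<in> I"
  shows "\<zero>\<^bsub>M i\<^esub> \<in> carrier (M i)"
    and "\<lbrakk>a \<in> carrier (M i); b \<in> carrier (M i)\<rbrakk> \<Longrightarrow> a \<oplus>\<^bsub>M i\<^esub> b \<in> carrier (M i)"
    and "a \<in> carrier (M i) \<Longrightarrow> \<zero>\<^bsub>M i\<^esub> \<oplus>\<^bsub>M i\<^esub> a = a"
    and "a \<in> carrier (M i) \<Longrightarrow> a \<oplus>\<^bsub>M i\<^esub> \<zero>\<^bsub>M i\<^esub> = a"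
    and "\<lbrakk>r \<in> carrier R; a \<in> carrier (M i)\<rbrakk> \<Longrightarrow> r \<odot>\<^bsub>M i\<^esub> a \<in> carrier (M i)"
    and "r \<in> carrier R \<Longrightarrow> r \<odot>\<^bsub>M i\<^esub> \<zero>\<^bsub>M i\<^esub> = \<zero>\<^bsub>M i\<^esub>"
proof -
  interpret module R "M i" using assms by (rule mods)
  show "\<zero>\<^bsub>M i\<^esub> \<in> carrier (M i)"
    "\<lbrakk>a \<in> carrier (M i); b \<in> carrier (M i)\<rbrakk> \<Longrightarrow> a \<oplus>\<^bsub>M i\<^esub> b \<in> carrier (M i)"
    "a \<in> carrier (M i) \<Longrightarrow> \<zero>\<^bsub>M i\<^esub> \<oplus>\<^bsub>M i\<^esub> a = a"
    "a \<in> carrier (M i) \<Longrightarrow> a \<oplus>\<^bsub>M i\<^esub> \<zero>\<^bsub>M i\<^esub> = a"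
    "\<lbrakk>r \<in> carrier R; a \<in> carrier (M i)\<rbrakk> \<Longrightarrow> r \<odot>\<^bsub>M i\<^esub> a \<in> carrier (M i)"
    "r \<in> carrier R \<Longrightarrow> r \<odot>\<^bsub>M i\<^esub> \<zero>\<^bsub>M i\<^esub> = \<zero>\<^bsub>M i\<^esub>"
    by simp_all
qed

lemma add_in:
  assumes "x \<in> carrier S" "y \<in> carrier S"
  shows "(\<lambda>i\<in>I. x i \<oplus>\<^bsub>M i\<^esub> y i) \<in> carrier S"
proof -
  have fin: "finite ({i \<in> I. x i \<noteq> \<zero>\<^bsub>M i\<^esub>} \<union> {i \<in> I. y i \<noteq> \<zero>\<^bsub>M i\<^esub>})"
    using assms by (simp add: direct_sum_carrier)
  have "{i \<in> I. (\<lambda>i\<in>I. x i \<oplus>\<^bsub>M i\<^esub> y i) i \<noteq> \<zero>\<^bsub>M i\<^esub>} \<subseteq>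
    {i \<in> I. x i \<noteq> \<zero>\<^bsub>M i\<^esub>} \<union> {i \<in> I. y i \<noteq> \<zero>\<^bsub>M i\<^esub>}"
    by (auto simp: component_rules)
  from finite_subset[OF this fin] show ?thesis
    using assms by (auto simp: direct_sum_carrier PiE_iff component_rules)
qed

lemma smult_in:
  assumes "r \<in> carrier R" "x \<in> carrier S"
  shows "(\<lambda>i\<in>I. r \<odot>\<^bsub>M i\<^esub> x i) \<in> carrier S"
proof -
  have fin: "finite {i \<in> I. x i \<noteq> \<zero>\<^bsub>M i\<^esub>}"
    using assms by (simp add: direct_sum_carrier)
  have "{i \<in> I. (\<lambda>i\<in>I. r \<odot>\<^bsub>M i\<^esub> x i) i \<noteq> \<zero>\<^bsub>M i\<^esub>} \<subseteq> {i \<in> I. x i \<noteq> \<zero>\<^bsub>M i\<^esub>}"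
    using assms(1) by (auto simp: component_rules)
  from finite_subset[OF this fin] show ?thesis
    using assms by (auto simp: direct_sum_carrier PiE_iff component_rules)
qed

lemma at: "x \<in> carrier S \<Longrightarrow> i \<in> I \<Longrightarrow> x i \<in> carrier (M i)"
  by (auto simp: direct_sum_carrier)

lemma sum_ext: "x \<in> carrier S \<Longrightarrow> y \<in> carrier S \<Longrightarrow> (\<And>i. i \<in> I \<Longrightarrow> x i = y i) \<Longrightarrow> x = y"
  by (auto simp: direct_sum_carrier intro: PiE_ext)

lemma add_at: "i \<in> I \<Longrightarrow> (x \<oplus>\<^bsub>S\<^esub> y) i = x i \<oplus>\<^bsub>M i\<^esub> y i"
  and smult_at: "i \<in> I \<Longrightarrow> (r \<odot>\<^bsub>S\<^esub> x) i = r \<odot>\<^bsub>M i\<^esub> x i"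
  and zero_at: "i \<in> I \<Longrightarrow> \<zero>\<^bsub>S\<^esub> i = \<zero>\<^bsub>M i\<^esub>"
  by (simp_all add: direct_sum_def)

lemma zero_in: "\<zero>\<^bsub>S\<^esub> \<in> carrier S"
  unfolding direct_sum_carrier by (auto simp: direct_sum_def component_rules)

lemma add_closed: "x \<in> carrier S \<Longrightarrow> y \<in> carrier S \<Longrightarrow> x \<oplus>\<^bsub>S\<^esub> y \<in> carrier S"
  and smult_closed: "r \<in> carrier R \<Longrightarrow> x \<in> carrier S \<Longrightarrow> r \<odot>\<^bsub>S\<^esub> x \<in> carrier S"
  using add_in smult_in by (simp_all add: direct_sum_def)

lemma is_module: "module R S"
proof -
  interpret R: cring R by (rule cring)
  note closed = add_closed smult_closed zero_in
  have neg: "\<exists>y\<in>carrier S. y \<oplus>\<^bsub>S\<^esub> x = \<zero>\<^bsub>S\<^esub>" if x: "x \<in> carrier S" for x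
  proof
    \<comment> \<open>Multiplication by \<open>-1\<close> gives the negative and preserves finite support.\<close>
    show c: "(\<ominus>\<^bsub>R\<^esub> \<one>\<^bsub>R\<^esub>) \<odot>\<^bsub>S\<^esub> x \<in> carrier S" using x by (intro smult_closed) auto
    show "((\<ominus>\<^bsub>R\<^esub> \<one>\<^bsub>R\<^esub>) \<odot>\<^bsub>S\<^esub> x) \<oplus>\<^bsub>S\<^esub> x = \<zero>\<^bsub>S\<^esub>"
    proof (rule sum_ext)
      fix i assume i: "i \<in> I"
      interpret Mi: module R "M i" using i by (rule mods)
      show "((\<ominus>\<^bsub>R\<^esub> \<one>\<^bsub>R\<^esub>) \<odot>\<^bsub>S\<^esub> x \<oplus>\<^bsub>S\<^esub> x) i = \<zero>\<^bsub>S\<^esub> i"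
        using i at[OF x i] by (simp add: add_at smult_at zero_at Mi.smult_l_minus Mi.l_neg)
    qed (simp_all add: x c closed)
  qed
  show ?thesis
  proof (rule moduleI)
    show "abelian_group S"
    proof (rule abelian_groupI)
      fix x y z assume x: "x \<in> carrier S" and y: "y \<in> carrier S" and z: "z \<in> carrier S"
      show "x \<oplus>\<^bsub>S\<^esub> y \<oplus>\<^bsub>S\<^esub> z = x \<oplus>\<^bsub>S\<^esub> (y \<oplus>\<^bsub>S\<^esub> z)"
      proof (rule sum_ext)
        fix i assume i: "i \<in> I"
        interpret Mi: module R "M i" using i by (rule mods)
        show "(x \<oplus>\<^bsub>S\<^esub> y \<oplus>\<^bsub>S\<^esub> z) i = (x \<oplus>\<^bsub>S\<^esub> (y \<oplus>\<^bsub>S\<^esub> z)) i"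
          by (simp add: i add_at at x y z Mi.a_assoc)
      qed (simp_all add: x y z closed)
    next
      fix x y assume x: "x \<in> carrier S" and y: "y \<in> carrier S"
      show "x \<oplus>\<^bsub>S\<^esub> y = y \<oplus>\<^bsub>S\<^esub> x"
      proof (rule sum_ext)
        fix i assume i: "i \<in> I"
        interpret Mi: module R "M i" using i by (rule mods)
        show "(x \<oplus>\<^bsub>S\<^esub> y) i = (y \<oplus>\<^bsub>S\<^esub> x) i"
          using at[OF x i] at[OF y i] by (simp add: i add_at Mi.a_comm)
      qed (simp_all add: x y closed)
    next
      fix x assume x: "x \<in> carrier S"
      show "\<zero>\<^bsub>S\<^esub> \<oplus>\<^bsub>S\<^esub> x = x"
        by (rule sum_ext) (simp_all add: x closed add_at zero_at at component_rules)
    qed (auto intro: closed neg)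
  next
    fix a b x assume a: "a \<in> carrier R" and b: "b \<in> carrier R" and x: "x \<in> carrier S"
    show "(a \<oplus>\<^bsub>R\<^esub> b) \<odot>\<^bsub>S\<^esub> x = a \<odot>\<^bsub>S\<^esub> x \<oplus>\<^bsub>S\<^esub> b \<odot>\<^bsub>S\<^esub> x"
      by (rule sum_ext) (simp_all add: a b x closed add_at smult_at at module.smult_l_distr[OF mods])
    show "(a \<otimes>\<^bsub>R\<^esub> b) \<odot>\<^bsub>S\<^esub> x = a \<odot>\<^bsub>S\<^esub> (b \<odot>\<^bsub>S\<^esub> x)"
      by (rule sum_ext) (simp_all add: a b x closed smult_at at module.smult_assoc1[OF mods])
  next
    fix a x y assume a: "a \<in> carrier R" and x: "x \<in> carrier S" and y: "y \<in> carrier S"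
    show "a \<odot>\<^bsub>S\<^esub> (x \<oplus>\<^bsub>S\<^esub> y) = a \<odot>\<^bsub>S\<^esub> x \<oplus>\<^bsub>S\<^esub> a \<odot>\<^bsub>S\<^esub> y"
      by (rule sum_ext) (simp_all add: a x y closed add_at smult_at at module.smult_r_distr[OF mods])
  next
    fix x assume x: "x \<in> carrier S"
    show "\<one>\<^bsub>R\<^esub> \<odot>\<^bsub>S\<^esub> x = x"
      by (rule sum_ext) (simp_all add: x closed smult_at at module.smult_one[OF mods])
  qed (auto intro: closed cring)
qed

lemma inj_at: "j \<in> I \<Longrightarrow> direct_sum_inj I M i a j = (if j = i then a else \<zero>\<^bsub>M j\<^esub>)"
  by (simp add: direct_sum_inj_def)

lemma inj_in:
  assumes i: "i \<in> I" and a: "a \<in> carrier (M i)"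
  shows "direct_sum_inj I M i a \<in> carrier S"
proof -
  have "finite {j \<in> I. direct_sum_inj I M i a j \<noteq> \<zero>\<^bsub>M j\<^esub>}"
    by (rule finite_subset[of _ "{i}"]) (auto simp: inj_at split: if_splits)
  then show ?thesis
    using i a unfolding direct_sum_carrier by (auto simp: direct_sum_inj_def component_rules)
qed

lemma inj_hom:
  assumes i: "i \<in> I"
  shows "direct_sum_inj I M i \<in> mod_hom R (M i) S"
proof (rule mod_homI)
  fix a b assume ab: "a \<in> carrier (M i)" "b \<in> carrier (M i)"
  show "direct_sum_inj I M i (a \<oplus>\<^bsub>M i\<^esub> b) = direct_sum_inj I M i a \<oplus>\<^bsub>S\<^esub> direct_sum_inj I M i b"
    by (rule sum_ext) (simp_all add: i ab inj_in add_closed component_rules add_at inj_at)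
next
  fix r a assume ra: "r \<in> carrier R" "a \<in> carrier (M i)"
  show "direct_sum_inj I M i (r \<odot>\<^bsub>M i\<^esub> a) = r \<odot>\<^bsub>S\<^esub> direct_sum_inj I M i a"
    by (rule sum_ext) (simp_all add: i ra inj_in smult_closed component_rules smult_at inj_at)
qed (rule inj_in[OF i])

text \<open>
  Induction on the size of the support: splitting off one component makes it smaller.
\<close>

lemma sum_induct [consumes 1, case_names zero add inj]:
  assumes "x \<in> carrier S"
    and zero: "P \<zero>\<^bsub>S\<^esub>"
    and add: "\<And>x y. \<lbrakk>x \<in> carrier S; y \<in> carrier S; P x; P y\<rbrakk> \<Longrightarrow> P (x \<oplus>\<^bsub>S\<^esub> y)"
    and inj: "\<And>i a. \<lbrakk>i \<in> I; a \<in> carrier (M i)\<rbrakk> \<Longrightarrow> P (direct_sum_inj I M i a)"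
  shows "P x"
  using assms(1)
proof (induction "card {i \<in> I. x i \<noteq> \<zero>\<^bsub>M i\<^esub>}" arbitrary: x)
  case 0
  then have "{i \<in> I. x i \<noteq> \<zero>\<^bsub>M i\<^esub>} = {}" by (simp add: direct_sum_carrier)
  then have "x = \<zero>\<^bsub>S\<^esub>" by (intro sum_ext 0 zero_in) (auto simp: zero_at)
  with zero show ?case by simp
next
  case (Suc n)
  let ?supp = "\<lambda>x. {i \<in> I. x i \<noteq> \<zero>\<^bsub>M i\<^esub>}"
  have fin: "finite (?supp x)" using Suc by (simp add: direct_sum_carrier)
  have "?supp x \<noteq> {}" using Suc(2) by (metis card.empty nat.distinct(1))
  then obtain i where i: "i \<in> I" "x i \<noteq> \<zero>\<^bsub>M i\<^esub>" by blast
  have z: "\<zero>\<^bsub>M j\<^esub> \<in> carrier (M j)" if "j \<in> I" for j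
    using that by (rule component_rules)
  let ?y = "x(i := \<zero>\<^bsub>M i\<^esub>)"
  have supp: "?supp ?y = ?supp x - {i}" by auto
  have y: "?y \<in> carrier S"
    using Suc(3) i z fin unfolding direct_sum_carrier supp
    by (auto simp: PiE_iff extensional_def)
  have "card (?supp ?y) = n" using fin Suc(2) i unfolding supp by simp
  then have Py: "P ?y" by (intro Suc(1) y) simp
  have xi: "x i \<in> carrier (M i)" using Suc(3) i(1) by (rule at)
  have "x = ?y \<oplus>\<^bsub>S\<^esub> direct_sum_inj I M i (x i)"
  proof (rule sum_ext)
    fix j assume j: "j \<in> I"
    then show "x j = (?y \<oplus>\<^bsub>S\<^esub> direct_sum_inj I M i (x i)) j"
      using at[OF Suc(3) j] by (simp add: add_at inj_at component_rules xi i(1))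
  qed (intro Suc(3) add_closed y inj_in i(1) xi)+
  moreover have "P (?y \<oplus>\<^bsub>S\<^esub> direct_sum_inj I M i (x i))"
    by (intro add inj Py y inj_in i(1) xi)
  ultimately show ?case by metis
qed

definition lift :: "('r, 'b) module \<Rightarrow> ('i \<Rightarrow> 'a \<Rightarrow> 'b) \<Rightarrow> ('i \<Rightarrow> 'a) \<Rightarrow> 'b" where
  "lift N h x = (\<Oplus>\<^bsub>N\<^esub> i \<in> {i \<in> I. x i \<noteq> \<zero>\<^bsub>M i\<^esub>}. h i (x i))"

text \<open>
  The universal property of the direct sum. For additivity the two sums over different supports
  are compared over a common finite index set.
\<close>

lemma lift:
  assumes N: "module R N" and h: "\<And>i. i \<in> I \<Longrightarrow> h i \<in> mod_hom R (M i) N"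
  shows lift_hom: "lift N h \<in> mod_hom R S N"
    and lift_inj: "\<lbrakk>i \<in> I; a \<in> carrier (M i)\<rbrakk> \<Longrightarrow> lift N h (direct_sum_inj I M i a) = h i a"
proof -
  interpret N: module R N by fact
  have hc: "h i (x i) \<in> carrier N" if "x \<in> carrier S" "i \<in> I" for x i
    using that at mod_hom_closed[OF h] by auto
  have h0: "h i \<zero>\<^bsub>M i\<^esub> = \<zero>\<^bsub>N\<^esub>" if "i \<in> I" for i using that mod_hom_zero[OF mods N h] by auto
  have larger: "lift N h x = (\<Oplus>\<^bsub>N\<^esub> i \<in> F. h i (x i))"
    if "x \<in> carrier S" "finite F" "{i \<in> I. x i \<noteq> \<zero>\<^bsub>M i\<^esub>} \<subseteq> F" "F \<subseteq> I" for x F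
    unfolding lift_def
    by (rule N.add.finprod_mono_neutral_cong_left) (use that hc h0 in auto)
  show "lift N h \<in> mod_hom R S N"
  proof (rule mod_homI)
    fix x assume "x \<in> carrier S"
    then show "lift N h x \<in> carrier N" unfolding lift_def by (intro N.finsum_closed) (auto intro: hc)
  next
    fix x y assume x: "x \<in> carrier S" and y: "y \<in> carrier S"
    let ?F = "{i \<in> I. x i \<noteq> \<zero>\<^bsub>M i\<^esub>} \<union> {i \<in> I. y i \<noteq> \<zero>\<^bsub>M i\<^esub>}"
    have F: "finite ?F" using x y by (simp add: direct_sum_carrier)
    have "lift N h (x \<oplus>\<^bsub>S\<^esub> y) = (\<Oplus>\<^bsub>N\<^esub> i \<in> ?F. h i ((x \<oplus>\<^bsub>S\<^esub> y) i))"
      by (intro larger add_closed x y F) (auto simp: add_at component_rules)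
    also have "\<dots> = (\<Oplus>\<^bsub>N\<^esub> i \<in> ?F. h i (x i) \<oplus>\<^bsub>N\<^esub> h i (y i))"
      by (rule N.finsum_cong') (use hc x y at mod_hom_add[OF h] in \<open>auto simp: add_at\<close>)
    also have "\<dots> = (\<Oplus>\<^bsub>N\<^esub> i \<in> ?F. h i (x i)) \<oplus>\<^bsub>N\<^esub> (\<Oplus>\<^bsub>N\<^esub> i \<in> ?F. h i (y i))"
      by (rule N.finsum_addf) (use hc x y in auto)
    also have "\<dots> = lift N h x \<oplus>\<^bsub>N\<^esub> lift N h y"
      using larger[OF x F] larger[OF y F] by auto
    finally show "lift N h (x \<oplus>\<^bsub>S\<^esub> y) = lift N h x \<oplus>\<^bsub>N\<^esub> lift N h y" .
  next
    fix r x assume r: "r \<in> carrier R" and x: "x \<in> carrier S"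
    let ?F = "{i \<in> I. x i \<noteq> \<zero>\<^bsub>M i\<^esub>}"
    have F: "finite ?F" using x by (simp add: direct_sum_carrier)
    have "lift N h (r \<odot>\<^bsub>S\<^esub> x) = (\<Oplus>\<^bsub>N\<^esub> i \<in> ?F. h i ((r \<odot>\<^bsub>S\<^esub> x) i))"
      by (intro larger smult_closed x r F) (auto simp: smult_at component_rules r)
    also have "\<dots> = (\<Oplus>\<^bsub>N\<^esub> i \<in> ?F. r \<odot>\<^bsub>N\<^esub> h i (x i))"
      by (rule N.finsum_cong') (use hc x r at mod_hom_smult[OF h] in \<open>auto simp: smult_at\<close>)
    also have "\<dots> = r \<odot>\<^bsub>N\<^esub> lift N h x"
      unfolding lift_def by (rule N.finsum_smult_ldistr[symmetric]) (use F r hc x in auto)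
    finally show "lift N h (r \<odot>\<^bsub>S\<^esub> x) = r \<odot>\<^bsub>N\<^esub> lift N h x" .
  qed
  show "lift N h (direct_sum_inj I M i a) = h i a" if i: "i \<in> I" and a: "a \<in> carrier (M i)"
  proof -
    have "lift N h (direct_sum_inj I M i a) = (\<Oplus>\<^bsub>N\<^esub> j \<in> {i}. h j (direct_sum_inj I M i a j))"
      by (rule larger) (use i mod_hom_closed[OF inj_hom[OF i] a] in \<open>auto simp: direct_sum_inj_def\<close>)
    also have "\<dots> = h i a"
      using i a mod_hom_closed[OF h[OF i] a] by (simp add: direct_sum_inj_def)
    finally show ?thesis .
  qed
qed

end

lemma direct_sum_hom_eq:
  assumes "module_family R I M" "module R N"
    and h: "h \<in> mod_hom R (direct_sum I M) N" and k: "k \<in> mod_hom R (direct_sum I M) N"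
    and eq: "\<And>i a. \<lbrakk>i \<in> I; a \<in> carrier (M i)\<rbrakk> \<Longrightarrow> h (direct_sum_inj I M i a) = k (direct_sum_inj I M i a)"
    and x: "x \<in> carrier (direct_sum I M)"
  shows "h x = k x"
proof -
  interpret module_family R I M by fact
  from x show ?thesis
  proof (induction rule: sum_induct)
    case zero
    show ?case using mod_hom_zero[OF is_module assms(2)] h k by metis
  qed (simp_all add: mod_hom_add[OF h] mod_hom_add[OF k] eq)
qed

lemma direct_sum_map:
  assumes "module_family R I M" "module_family R I N"
    and h: "\<And>i. i \<in> I \<Longrightarrow> h i \<in> mod_hom R (M i) (N i)"
  shows direct_sum_map_hom:
      "(\<lambda>u. \<lambda>i\<in>I. h i (u i)) \<in> mod_hom R (direct_sum I M) (direct_sum I N)"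
    and direct_sum_map_inj: "\<lbrakk>i \<in> I; a \<in> carrier (M i)\<rbrakk> \<Longrightarrow>
      (\<lambda>j\<in>I. h j (direct_sum_inj I M i a j)) = direct_sum_inj I N i (h i a)"
proof -
  interpret M: module_family R I M by fact
  interpret N: module_family R I N by fact
  have h0: "h i \<zero>\<^bsub>M i\<^esub> = \<zero>\<^bsub>N i\<^esub>" if "i \<in> I" for i
    using mod_hom_zero[OF M.mods N.mods h] that by blast
  have c: "(\<lambda>i\<in>I. h i (u i)) \<in> carrier N.S" if u: "u \<in> carrier M.S" for u
  proof -
    have "finite {i \<in> I. (\<lambda>i\<in>I. h i (u i)) i \<noteq> \<zero>\<^bsub>N i\<^esub>}"
      by (rule finite_subset[of _ "{i \<in> I. u i \<noteq> \<zero>\<^bsub>M i\<^esub>}"])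
        (use u in \<open>auto simp: direct_sum_carrier h0\<close>)
    then show ?thesis using M.at[OF u] mod_hom_closed[OF h] by (simp add: direct_sum_carrier)
  qed
  show "(\<lambda>u. \<lambda>i\<in>I. h i (u i)) \<in> mod_hom R (direct_sum I M) (direct_sum I N)"
  proof (rule mod_homI)
    fix x y assume x: "x \<in> carrier M.S" and y: "y \<in> carrier M.S"
    show "(\<lambda>i\<in>I. h i ((x \<oplus>\<^bsub>M.S\<^esub> y) i)) = (\<lambda>i\<in>I. h i (x i)) \<oplus>\<^bsub>N.S\<^esub> (\<lambda>i\<in>I. h i (y i))"
      by (rule N.sum_ext)
        (simp_all add: x y c M.add_closed N.add_closed M.add_at N.add_at M.at mod_hom_add[OF h])
  next
    fix r x assume r: "r \<in> carrier R" and x: "x \<in> carrier M.S"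
    show "(\<lambda>i\<in>I. h i ((r \<odot>\<^bsub>M.S\<^esub> x) i)) = r \<odot>\<^bsub>N.S\<^esub> (\<lambda>i\<in>I. h i (x i))"
      by (rule N.sum_ext)
        (simp_all add: r x c M.smult_closed N.smult_closed M.smult_at N.smult_at M.at mod_hom_smult[OF h])
  qed (rule c)
  assume ia: "i \<in> I" "a \<in> carrier (M i)"
  show "(\<lambda>j\<in>I. h j (direct_sum_inj I M i a j)) = direct_sum_inj I N i (h i a)"
    using ia by (intro N.sum_ext c M.inj_in N.inj_in mod_hom_closed[OF h]) (simp_all add: M.inj_at N.inj_at h0)
qed

section \<open>Tensor products\<close>

lemma regular_module_simps:
  "carrier (regular_module R) = carrier R" "\<zero>\<^bsub>regular_module R\<^esub> = \<zero>\<^bsub>R\<^esub>"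
  "x \<oplus>\<^bsub>regular_module R\<^esub> y = x \<oplus>\<^bsub>R\<^esub> y" "x \<odot>\<^bsub>regular_module R\<^esub> y = x \<otimes>\<^bsub>R\<^esub> y"
  by (simp_all add: regular_module_def)

lemma regular_module_is_module:
  assumes "cring R"
  shows "module R (regular_module R)"
proof -
  interpret cring R by fact
  show ?thesis
  proof (rule moduleI)
    show "abelian_group (regular_module R)"
    proof (rule abelian_groupI; unfold regular_module_simps)
      fix x assume x: "x \<in> carrier R"
      show "\<exists>y\<in>carrier R. y \<oplus>\<^bsub>R\<^esub> x = \<zero>\<^bsub>R\<^esub>"
        by (rule bexI[of _ "\<ominus>\<^bsub>R\<^esub> x"]) (simp_all add: x l_neg)
    qed (simp_all add: a_ac)
  qed (simp_all add: regular_module_simps assms l_distr r_distr m_assoc)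
qed

definition bilinear ::
  "'r ring \<Rightarrow> ('r, 'a) module \<Rightarrow> ('r, 'b) module \<Rightarrow> ('r, 'c) module \<Rightarrow> ('a \<Rightarrow> 'b \<Rightarrow> 'c) \<Rightarrow> bool" where
  "bilinear R A B N \<phi> \<longleftrightarrow>
    (\<forall>b\<in>carrier B. (\<lambda>a. \<phi> a b) \<in> mod_hom R A N) \<and> (\<forall>a\<in>carrier A. \<phi> a \<in> mod_hom R B N)"

lemma bilinearD:
  assumes "bilinear R A B N \<phi>"
  shows bilinear_left: "b \<in> carrier B \<Longrightarrow> (\<lambda>a. \<phi> a b) \<in> mod_hom R A N"
    and bilinear_right: "a \<in> carrier A \<Longrightarrow> \<phi> a \<in> mod_hom R B N"
    and bilinear_closed: "\<lbrakk>a \<in> carrier A; b \<in> carrier B\<rbrakk> \<Longrightarrow> \<phi> a b \<in> carrier N"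
  using assms by (auto simp: bilinear_def mod_hom_def)

locale tensor_pair =
  fixes R :: "'r ring" and A :: "('r, 'a) module" and B :: "('r, 'b) module"
  assumes A: "module R A" and B: "module R B"
begin

sublocale A: module R A by (rule A)
sublocale B: module R B by (rule B)

abbreviation "T \<equiv> tensor_free R A B"
abbreviation "g \<equiv> tensor_gen R A B"
abbreviation "H \<equiv> tensor_rel R A B"
abbreviation "TT \<equiv> tensor_module R A B"
abbreviation "\<tau> \<equiv> tensor_elem R A B"

sublocale F: module_family R "carrier A \<times> carrier B" "\<lambda>_. regular_module R"
  by (rule module_family.intro) (rule A.R.is_cring regular_module_is_module)+

lemma T_module: "module R T"
  using F.is_module by (simp add: free_module_def)

sublocale T: module R T by (rule T_module)

lemma g_in: "\<lbrakk>a \<in> carrier A; b \<in> carrier B\<rbrakk> \<Longrightarrow> g a b \<in> carrier T"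
  using F.inj_in[of "(a, b)" "\<one>\<^bsub>R\<^esub>"] by (simp add: free_module_def free_gen_def regular_module_simps)

text \<open>
  In the direct sum of copies of \<open>R\<close>, the element with the single entry \<open>r\<close> is a multiple of a basis
  element, so a homomorphism on the free module is determined by the basis.
\<close>

lemma inj_eq:
  assumes "a \<in> carrier A" "b \<in> carrier B" "r \<in> carrier R"
  shows "direct_sum_inj (carrier A \<times> carrier B) (\<lambda>_. regular_module R) (a, b) r = r \<odot>\<^bsub>T\<^esub> g a b"
proof -
  have "r \<otimes>\<^bsub>R\<^esub> \<one>\<^bsub>R\<^esub> = r" using assms by simp
  then show ?thesis
    using mod_hom_smult[OF F.inj_hom[of "(a, b)"], of r "\<one>\<^bsub>R\<^esub>"] assms
    by (simp add: free_module_def free_gen_def regular_module_simps)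
qed

text \<open>The generators of \<^const>\<open>tensor_rel\<close>.\<close>

definition rels :: "('a \<times> 'b \<Rightarrow> 'r) set" where
  "rels =
     {g (a \<oplus>\<^bsub>A\<^esub> a') b \<ominus>\<^bsub>T\<^esub> (g a b \<oplus>\<^bsub>T\<^esub> g a' b) | a a' b.
         a \<in> carrier A \<and> a' \<in> carrier A \<and> b \<in> carrier B} \<union>
      {g a (b \<oplus>\<^bsub>B\<^esub> b') \<ominus>\<^bsub>T\<^esub> (g a b \<oplus>\<^bsub>T\<^esub> g a b') | a b b'.
         a \<in> carrier A \<and> b \<in> carrier B \<and> b' \<in> carrier B} \<union>
      {g (r \<odot>\<^bsub>A\<^esub> a) b \<ominus>\<^bsub>T\<^esub> r \<odot>\<^bsub>T\<^esub> g a b | r a b.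
         r \<in> carrier R \<and> a \<in> carrier A \<and> b \<in> carrier B} \<union>
      {g a (r \<odot>\<^bsub>B\<^esub> b) \<ominus>\<^bsub>T\<^esub> r \<odot>\<^bsub>T\<^esub> g a b | r a b.
         r \<in> carrier R \<and> a \<in> carrier A \<and> b \<in> carrier B}"

lemma H_eq: "H = gen_submodule R T rels"
  by (simp add: tensor_rel_def rels_def Let_def)

lemma rels_sub: "rels \<subseteq> carrier T"
  by (auto simp: rels_def intro!: T.minus_closed T.a_closed T.smult_closed g_in)

sublocale Q: module_quotient R T H
  unfolding module_quotient_def H_eq
  by (intro conjI T_module gen_submodule_is_submodule rels_sub)

lemma TT_module: "module R TT"
  unfolding tensor_module_def by (rule Q.quotient_is_module)

sublocale TT: module R TT by (rule TT_module)

lemma elem_eq: "\<tau> a b = H +>\<^bsub>T\<^esub> g a b"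
  by (simp add: tensor_elem_def)

lemma rel_eq:
  assumes "x \<ominus>\<^bsub>T\<^esub> y \<in> rels" "x \<in> carrier T" "y \<in> carrier T"
  shows "H +>\<^bsub>T\<^esub> x = H +>\<^bsub>T\<^esub> y"
proof -
  have "x \<ominus>\<^bsub>T\<^esub> y \<in> H" unfolding H_eq using assms(1) by (rule gen_submodule_incl)
  then show ?thesis using assms(2,3) by (simp add: Q.coset_eq_iff)
qed

lemma elem_bilinear: "bilinear R A B TT \<tau>"
proof -
  have 1: "\<tau> (a \<oplus>\<^bsub>A\<^esub> a') b = \<tau> a b \<oplus>\<^bsub>TT\<^esub> \<tau> a' b"
    if "a \<in> carrier A" "a' \<in> carrier A" "b \<in> carrier B" for a a' b
  proof -
    have "g (a \<oplus>\<^bsub>A\<^esub> a') b \<ominus>\<^bsub>T\<^esub> (g a b \<oplus>\<^bsub>T\<^esub> g a' b) \<in> rels" using that by (auto simp: rels_def)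
    from rel_eq[OF this] show ?thesis
      using that by (simp add: elem_eq tensor_module_def Q.quotient_add g_in)
  qed
  have 2: "\<tau> a (b \<oplus>\<^bsub>B\<^esub> b') = \<tau> a b \<oplus>\<^bsub>TT\<^esub> \<tau> a b'"
    if "a \<in> carrier A" "b \<in> carrier B" "b' \<in> carrier B" for a b b'
  proof -
    have "g a (b \<oplus>\<^bsub>B\<^esub> b') \<ominus>\<^bsub>T\<^esub> (g a b \<oplus>\<^bsub>T\<^esub> g a b') \<in> rels" using that by (auto simp: rels_def)
    from rel_eq[OF this] show ?thesis
      using that by (simp add: elem_eq tensor_module_def Q.quotient_add g_in)
  qed
  have 3: "\<tau> (r \<odot>\<^bsub>A\<^esub> a) b = r \<odot>\<^bsub>TT\<^esub> \<tau> a b"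
    if "a \<in> carrier A" "r \<in> carrier R" "b \<in> carrier B" for a r b
  proof -
    have "g (r \<odot>\<^bsub>A\<^esub> a) b \<ominus>\<^bsub>T\<^esub> r \<odot>\<^bsub>T\<^esub> g a b \<in> rels" using that by (auto simp: rels_def)
    from rel_eq[OF this] show ?thesis
      using that by (simp add: elem_eq tensor_module_def Q.quotient_smult g_in)
  qed
  have 4: "\<tau> a (r \<odot>\<^bsub>B\<^esub> b) = r \<odot>\<^bsub>TT\<^esub> \<tau> a b"
    if "a \<in> carrier A" "r \<in> carrier R" "b \<in> carrier B" for a r b
  proof -
    have "g a (r \<odot>\<^bsub>B\<^esub> b) \<ominus>\<^bsub>T\<^esub> r \<odot>\<^bsub>T\<^esub> g a b \<in> rels" using that by (auto simp: rels_def)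
    from rel_eq[OF this] show ?thesis
      using that by (simp add: elem_eq tensor_module_def Q.quotient_smult g_in)
  qed
  have c: "\<tau> a b \<in> carrier TT" if "a \<in> carrier A" "b \<in> carrier B" for a b
    using that by (simp add: elem_eq tensor_module_def Q.coset_in g_in)
  show ?thesis unfolding bilinear_def by (intro conjI ballI mod_homI) (simp_all add: 1 2 3 4 c)
qed

lemmas elem_in = bilinear_closed[OF elem_bilinear]

text \<open>
  Every tensor is a sum of pure tensors: scalars are absorbed into the first factor, and the zero
  tensor is the pure tensor of two zeros.
\<close>

lemma tensor_induct [consumes 1, case_names add elem]:
  assumes t: "t \<in> carrier TT"
    and add: "\<And>s t. \<lbrakk>s \<in> carrier TT; t \<in> carrier TT; P s; P t\<rbrakk> \<Longrightarrow> P (s \<oplus>\<^bsub>TT\<^esub> t)"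
    and elem: "\<And>a b. \<lbrakk>a \<in> carrier A; b \<in> carrier B\<rbrakk> \<Longrightarrow> P (\<tau> a b)"
  shows "P t"
proof -
  obtain w where w: "w \<in> carrier T" "t = H +>\<^bsub>T\<^esub> w"
    using t unfolding tensor_module_def by (rule Q.quotient_cases)
  have smul: "H +>\<^bsub>T\<^esub> (r \<odot>\<^bsub>T\<^esub> g a b) = \<tau> (r \<odot>\<^bsub>A\<^esub> a) b"
    if "r \<in> carrier R" "a \<in> carrier A" "b \<in> carrier B" for r a b
    using that mod_hom_smult[OF bilinear_left[OF elem_bilinear]]
    by (simp add: elem_eq tensor_module_def Q.quotient_smult g_in)
  have "P (H +>\<^bsub>T\<^esub> w)"
    using w(1) unfolding free_module_def
  proof (induction rule: F.sum_induct)
    case zero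
    have "H +>\<^bsub>T\<^esub> \<zero>\<^bsub>T\<^esub> = H +>\<^bsub>T\<^esub> (\<zero>\<^bsub>R\<^esub> \<odot>\<^bsub>T\<^esub> g \<zero>\<^bsub>A\<^esub> \<zero>\<^bsub>B\<^esub>)"
      by (simp add: g_in)
    then show ?case by (simp add: smul elem flip: free_module_def)
  next
    case (add x y)
    then show ?case unfolding free_module_def[symmetric]
      using assms(2)[of "H +>\<^bsub>T\<^esub> x" "H +>\<^bsub>T\<^esub> y"]
      by (simp add: Q.quotient_add[symmetric] Q.coset_in tensor_module_def)
  next
    case (inj p r)
    then show ?case
      by (cases p) (simp add: regular_module_simps inj_eq smul elem flip: free_module_def)
  qed
  then show ?thesis by (simp add: w)
qed

lemma tensor_hom_eq:
  assumes "h \<in> mod_hom R TT N" "k \<in> mod_hom R TT N"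
    and "\<And>a b. \<lbrakk>a \<in> carrier A; b \<in> carrier B\<rbrakk> \<Longrightarrow> h (\<tau> a b) = k (\<tau> a b)"
    and "t \<in> carrier TT"
  shows "h t = k t"
  using assms(4)
  by (induction rule: tensor_induct)
    (simp_all add: mod_hom_add[OF assms(1)] mod_hom_add[OF assms(2)] assms(3))

lemma free_hom_eq:
  assumes N: "module R N" and h: "h \<in> mod_hom R T N" and k: "k \<in> mod_hom R T N"
    and eq: "\<And>a b. \<lbrakk>a \<in> carrier A; b \<in> carrier B\<rbrakk> \<Longrightarrow> h (g a b) = k (g a b)"
    and u: "u \<in> carrier T"
  shows "h u = k u"
proof (rule direct_sum_hom_eq[OF F.module_family_axioms N])
  show "h \<in> mod_hom R F.S N" "k \<in> mod_hom R F.S N" "u \<in> carrier F.S"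
    using h k u by (simp_all add: free_module_def)
  fix p r assume "p \<in> carrier A \<times> carrier B" "r \<in> carrier (regular_module R)"
  then show "h (direct_sum_inj (carrier A \<times> carrier B) (\<lambda>_. regular_module R) p r) =
      k (direct_sum_inj (carrier A \<times> carrier B) (\<lambda>_. regular_module R) p r)"
    by (cases p) (simp add: regular_module_simps inj_eq g_in eq mod_hom_smult[OF h] mod_hom_smult[OF k])
qed

text \<open>
  The universal property of the free module, stated for the expression that occurs in the
  definition of \<^const>\<open>tensor_map\<close>.
\<close>

lemma free_lift:
  assumes N: "module R N" and n: "\<And>p. p \<in> carrier A \<times> carrier B \<Longrightarrow> n p \<in> carrier N"
  defines "L \<equiv> \<lambda>u. \<Oplus>\<^bsub>N\<^esub> p \<in> {p \<in> carrier A \<times> carrier B. u p \<noteq> \<zero>\<^bsub>R\<^esub>}. u p \<odot>\<^bsub>N\<^esub> n p"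
  shows "L \<in> mod_hom R T N" "\<And>a b. \<lbrakk>a \<in> carrier A; b \<in> carrier B\<rbrakk> \<Longrightarrow> L (g a b) = n (a, b)"
proof -
  interpret N: module R N by fact
  have h: "(\<lambda>r. r \<odot>\<^bsub>N\<^esub> n p) \<in> mod_hom R (regular_module R) N" if "p \<in> carrier A \<times> carrier B" for p
    by (rule mod_homI) (use n[OF that] in \<open>simp_all add: regular_module_simps N.smult_l_distr N.smult_assoc1\<close>)
  have L: "L = F.lift N (\<lambda>p r. r \<odot>\<^bsub>N\<^esub> n p)"
    by (rule ext) (simp add: L_def F.lift_def regular_module_simps)
  show "L \<in> mod_hom R T N" unfolding L free_module_def by (rule F.lift_hom[OF N h])
  show "L (g a b) = n (a, b)" if "a \<in> carrier A" "b \<in> carrier B" for a b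
    using F.lift_inj[OF N h, where i = "(a, b)" and a = "\<one>\<^bsub>R\<^esub>"] that n
    by (simp add: L free_gen_def regular_module_simps)
qed

lemma tensor_universal:
  assumes N: "module R N" and \<phi>: "bilinear R A B N \<phi>"
  shows "\<exists>K\<in>mod_hom R TT N. \<forall>a\<in>carrier A. \<forall>b\<in>carrier B. K (\<tau> a b) = \<phi> a b"
proof -
  interpret N: module R N by fact
  let ?n = "\<lambda>p. \<phi> (fst p) (snd p)"
  define L where "L u = (\<Oplus>\<^bsub>N\<^esub> p \<in> {p \<in> carrier A \<times> carrier B. u p \<noteq> \<zero>\<^bsub>R\<^esub>}. u p \<odot>\<^bsub>N\<^esub> ?n p)" for u
  have n: "?n p \<in> carrier N" if "p \<in> carrier A \<times> carrier B" for p
    using that bilinear_closed[OF \<phi>] by auto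
  have Lh: "L \<in> mod_hom R T N" using free_lift(1)[OF N n] by (simp add: L_def[abs_def])
  have Lg: "L (g a b) = \<phi> a b" if "a \<in> carrier A" "b \<in> carrier B" for a b
    using free_lift(2)[OF N n that] by (simp add: L_def)
  note simps = Lg g_in mod_hom_minus[OF T_module N Lh] mod_hom_add[OF Lh] mod_hom_smult[OF Lh]
    bilinear_closed[OF \<phi>] N.minus_zero_iff
    mod_homD(2,3)[OF bilinear_left[OF \<phi>]] mod_homD(2,3)[OF bilinear_right[OF \<phi>]]
  have "L x = \<zero>\<^bsub>N\<^esub>" if "x \<in> rels" for x
    using that unfolding rels_def by (elim UnE) (clarsimp simp: simps)+
  then have "L x = \<zero>\<^bsub>N\<^esub>" if "x \<in> H" for x
    using mod_hom_gen_submodule[OF T_module N Lh rels_sub] that by (simp add: H_eq)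
  from Q.quotient_universal[OF N Lh this] obtain K
    where K: "K \<in> mod_hom R TT N" "\<And>x. x \<in> carrier T \<Longrightarrow> K (H +>\<^bsub>T\<^esub> x) = L x"
    unfolding tensor_module_def by blast
  show ?thesis by (rule bexI[OF _ K(1)]) (simp add: K(2) elem_eq g_in Lg)
qed

end

text \<open>
  The universal property yields a homomorphism \<open>K\<close> with the right values on pure tensors. The
  formula defining \<^const>\<open>tensor_map\<close> agrees with \<open>K\<close> on the basis of the free module, hence on all
  cosets.
\<close>

lemma tensor_map:
  assumes "module R A" "module R B" "module R A'" "module R B'"
    and f: "f \<in> mod_hom R A A'" and k: "k \<in> mod_hom R B B'"
  shows tensor_map_hom:
      "tensor_map R A B A' B' f k \<in> mod_hom R (tensor_module R A B) (tensor_module R A' B')"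
    and tensor_map_elem: "\<lbrakk>a \<in> carrier A; b \<in> carrier B\<rbrakk> \<Longrightarrow>
      tensor_map R A B A' B' f k (tensor_elem R A B a b) = tensor_elem R A' B' (f a) (k b)"
proof -
  interpret U: tensor_pair R A B by (rule tensor_pair.intro) fact+
  interpret V: tensor_pair R A' B' by (rule tensor_pair.intro) fact+
  have "bilinear R A B V.TT (\<lambda>a b. V.\<tau> (f a) (k b))"
    unfolding bilinear_def
    using mod_hom_comp[OF f bilinear_left[OF V.elem_bilinear]] mod_hom_closed[OF k]
      mod_hom_comp[OF k bilinear_right[OF V.elem_bilinear]] mod_hom_closed[OF f] by simp
  from U.tensor_universal[OF V.TT_module this] obtain K where
    K: "K \<in> mod_hom R U.TT V.TT"
      "\<And>a b. \<lbrakk>a \<in> carrier A; b \<in> carrier B\<rbrakk> \<Longrightarrow> K (U.\<tau> a b) = V.\<tau> (f a) (k b)" by blast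
  let ?n = "\<lambda>p. V.g (f (fst p)) (k (snd p))"
  define L where "L u = (\<Oplus>\<^bsub>V.T\<^esub> p \<in> {p \<in> carrier A \<times> carrier B. u p \<noteq> \<zero>\<^bsub>R\<^esub>}. u p \<odot>\<^bsub>V.T\<^esub> ?n p)" for u
  have n: "?n p \<in> carrier V.T" if "p \<in> carrier A \<times> carrier B" for p
    using that mod_hom_closed[OF f] mod_hom_closed[OF k] V.g_in by auto
  have Lh: "L \<in> mod_hom R U.T V.T" using U.free_lift(1)[OF V.T_module n] by (simp add: L_def[abs_def])
  have Lg: "L (U.g a b) = V.g (f a) (k b)" if "a \<in> carrier A" "b \<in> carrier B" for a b
    using U.free_lift(2)[OF V.T_module n that] by (simp add: L_def)
  have h1: "(\<lambda>u. K (U.H +>\<^bsub>U.T\<^esub> u)) \<in> mod_hom R U.T V.TT"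
    using mod_hom_comp[OF U.Q.quotient_proj] K(1) by (simp add: tensor_module_def)
  have h2: "(\<lambda>u. V.H +>\<^bsub>V.T\<^esub> L u) \<in> mod_hom R U.T V.TT"
    using mod_hom_comp[OF Lh V.Q.quotient_proj] by (simp add: tensor_module_def)
  have KL: "K (U.H +>\<^bsub>U.T\<^esub> u) = V.H +>\<^bsub>V.T\<^esub> L u" if u: "u \<in> carrier U.T" for u
    by (rule U.free_hom_eq[OF V.TT_module h1 h2 _ u])
      (simp add: Lg K(2) flip: U.elem_eq V.elem_eq)
  have eq: "tensor_map R A B A' B' f k t = K t" if "t \<in> carrier U.TT" for t
    unfolding tensor_map_def
    by (rule U.Q.quotient_map_eq)
      (use that in \<open>simp_all add: tensor_module_def KL L_def\<close>)
  show "tensor_map R A B A' B' f k \<in> mod_hom R U.TT V.TT"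
    by (rule mod_hom_cong[OF U.TT_module K(1) eq])
  show "tensor_map R A B A' B' f k (U.\<tau> a b) = V.\<tau> (f a) (k b)"
    if "a \<in> carrier A" "b \<in> carrier B"
    using that by (simp add: eq U.elem_in K(2))
qed

section \<open>Linear categories and bifunctors\<close>

context linear_category
begin

lemma Comp_mor:
  assumes "X \<in> Obj C" "Y \<in> Obj C" "Z \<in> Obj C" "f \<in> mor C X Y" "g \<in> mor C Y Z"
  shows "g \<cdot> f \<in> mor C X Z"
  using mod_hom_closed[OF Comp_linear_left[OF assms(1-4)] assms(5)] .

lemma DomI: "\<lbrakk>f \<in> mor C X Y; X \<in> Obj C; Y \<in> Obj C\<rbrakk> \<Longrightarrow> Dom C f = X"
  and CodI: "\<lbrakk>f \<in> mor C X Y; X \<in> Obj C; Y \<in> Obj C\<rbrakk> \<Longrightarrow> Cod C f = Y"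
  using Dom_Cod by auto

lemma Dom_Ident: "X \<in> Obj C \<Longrightarrow> Dom C (Ident C X) = X"
  and Cod_Ident: "X \<in> Obj C \<Longrightarrow> Cod C (Ident C X) = X"
  using Dom_Cod Ident_mor by auto

lemma Ident_Ident: "X \<in> Obj C \<Longrightarrow> Ident C X \<cdot> Ident C X = Ident C X"
  by (meson Ident_left Ident_mor)

lemma Comp_zero_right:
  assumes "X \<in> Obj C" "Y \<in> Obj C" "Z \<in> Obj C"
  shows "g \<in> mor C Y Z \<Longrightarrow> g \<cdot> \<zero>\<^bsub>Hom C X Y\<^esub> = \<zero>\<^bsub>Hom C X Z\<^esub>"
  using mod_hom_zero[OF Hom_module Hom_module Comp_linear_right] assms by blast

lemma Hom_zero: "\<lbrakk>X \<in> Obj C; Y \<in> Obj C\<rbrakk> \<Longrightarrow> \<zero>\<^bsub>Hom C X Y\<^esub> \<in> mor C X Y"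
  using Hom_module by (meson abelian_group.axioms(1) abelian_monoid.zero_closed module.axioms(2))

lemma Hom_add: "\<lbrakk>X \<in> Obj C; Y \<in> Obj C; f \<in> mor C X Y; g \<in> mor C X Y\<rbrakk> \<Longrightarrow> f \<oplus>\<^bsub>Hom C X Y\<^esub> g \<in> mor C X Y"
  using Hom_module by (meson abelian_group.axioms(1) abelian_monoid.a_closed module.axioms(2))

lemma Hom_bifun_linear: "linear_bifunctor R C (Hom_bifun C)"
proof (intro linear_bifunctor.intro linear_category_axioms linear_bifunctor_axioms.intro)
  fix X X' Y Y' x y
  assume a: "X \<in> Obj C" "X' \<in> Obj C" "Y \<in> Obj C" "Y' \<in> Obj C" "x \<in> mor C X' X" "y \<in> mor C Y Y'"
  show "BMap (Hom_bifun C) x y \<in> mod_hom R (BObj (Hom_bifun C) X Y) (BObj (Hom_bifun C) X' Y')"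
    using mod_hom_comp[OF Comp_linear_right[OF a(1,3,4,6)] Comp_linear_left[OF a(2,1,4,5)]]
    by (simp add: Hom_bifun_def)
next
  fix X X' X'' Y Y' Y'' x x' y y' e
  assume X: "X \<in> Obj C" "X' \<in> Obj C" "X'' \<in> Obj C" and Y: "Y \<in> Obj C" "Y' \<in> Obj C" "Y'' \<in> Obj C"
    and x: "x \<in> mor C X' X" "x' \<in> mor C X'' X'" and y: "y \<in> mor C Y Y'" "y' \<in> mor C Y' Y''"
    and e: "e \<in> carrier (BObj (Hom_bifun C) X Y)"
  have e: "e \<in> mor C X Y" using e by (simp add: Hom_bifun_def)
  note c = Comp_mor[OF X(1) Y(1,2) e y(1)]
  have "y' \<cdot> y \<cdot> e \<cdot> (x \<cdot> x') = y' \<cdot> (y \<cdot> e) \<cdot> (x \<cdot> x')"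
    by (simp add: Comp_assoc[OF X(1) Y e y])
  also have "\<dots> = y' \<cdot> ((y \<cdot> e) \<cdot> (x \<cdot> x'))"
    by (rule Comp_assoc[OF X(3,1) Y(2,3) Comp_mor[OF X(3,2,1) x(2,1)] c y(2)])
  also have "\<dots> = y' \<cdot> ((y \<cdot> e) \<cdot> x \<cdot> x')"
    by (simp add: Comp_assoc[OF X(3,2,1) Y(2) x(2,1) c])
  also have "\<dots> = y' \<cdot> (y \<cdot> e \<cdot> x) \<cdot> x'"
    by (rule Comp_assoc[OF X(3,2) Y(2,3) x(2) Comp_mor[OF X(2,1) Y(2) x(1) c] y(2), symmetric])
  finally show "BMap (Hom_bifun C) (x \<cdot> x') (y' \<cdot> y) e = BMap (Hom_bifun C) x' y' (BMap (Hom_bifun C) x y e)"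
    by (simp add: Hom_bifun_def)
next
  fix X X' Y Y' y e
  assume X: "X \<in> Obj C" "X' \<in> Obj C" and Y: "Y \<in> Obj C" "Y' \<in> Obj C" and y: "y \<in> mor C Y Y'"
    and e: "e \<in> carrier (BObj (Hom_bifun C) X Y)"
  then show "(\<lambda>x. BMap (Hom_bifun C) x y e) \<in> mod_hom R (Hom C X' X) (BObj (Hom_bifun C) X' Y')"
    using Comp_linear_right[OF X(2,1) Y(2) Comp_mor[OF X(1) Y]] by (simp add: Hom_bifun_def)
next
  fix X X' Y Y' x e
  assume X: "X \<in> Obj C" "X' \<in> Obj C" and Y: "Y \<in> Obj C" "Y' \<in> Obj C" and x: "x \<in> mor C X' X"
    and e: "e \<in> carrier (BObj (Hom_bifun C) X Y)"
  then show "(\<lambda>y. BMap (Hom_bifun C) x y e) \<in> mod_hom R (Hom C Y Y') (BObj (Hom_bifun C) X' Y')"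
    using mod_hom_comp[OF Comp_linear_left[OF X(1) Y] Comp_linear_left[OF X(2,1) Y(2) x]]
    by (simp add: Hom_bifun_def)
qed (simp_all add: Hom_bifun_def Hom_module Ident_left Ident_right)

text \<open>
  Factoring through the map into a biproduct with components \<open>f\<close> and \<open>t\<close> means being a combination
  of \<open>f\<close> and \<open>t\<close>. This merges two relations of a presentation into one.
\<close>

lemma biproduct_factor:
  assumes b: "is_biproduct C D B' Q i j p q" and B: "B \<in> Obj C" and Z: "Z \<in> Obj C"
    and f: "f \<in> mor C B D" and t: "t \<in> mor C B B'"
  shows "i \<cdot> f \<oplus>\<^bsub>Hom C B Q\<^esub> j \<cdot> t \<in> mor C B Q"
    and "(\<exists>w\<in>mor C Q Z. g = w \<cdot> (i \<cdot> f \<oplus>\<^bsub>Hom C B Q\<^esub> j \<cdot> t)) \<longleftrightarrow>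
      (\<exists>h\<in>mor C D Z. \<exists>k\<in>mor C B' Z. g = h \<cdot> f \<oplus>\<^bsub>Hom C B Z\<^esub> k \<cdot> t)"
proof -
  have o: "D \<in> Obj C" "B' \<in> Obj C" "Q \<in> Obj C"
    and i: "i \<in> mor C D Q" and j: "j \<in> mor C B' Q" and p: "p \<in> mor C Q D" and q: "q \<in> mor C Q B'"
    and pi: "p \<cdot> i = Ident C D" and qj: "q \<cdot> j = Ident C B'"
    and qi: "q \<cdot> i = \<zero>\<^bsub>Hom C D B'\<^esub>" and pj: "p \<cdot> j = \<zero>\<^bsub>Hom C B' D\<^esub>"
    using b by (simp_all add: is_biproduct_def)
  note fi = Comp_mor[OF B o(1,3) f i] and tj = Comp_mor[OF B o(2,3) t j]
  show "i \<cdot> f \<oplus>\<^bsub>Hom C B Q\<^esub> j \<cdot> t \<in> mor C B Q" by (rule Hom_add[OF B o(3) fi tj])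
  have comp: "w \<cdot> (i \<cdot> f \<oplus>\<^bsub>Hom C B Q\<^esub> j \<cdot> t) = w \<cdot> i \<cdot> f \<oplus>\<^bsub>Hom C B Z\<^esub> w \<cdot> j \<cdot> t"
    if w: "w \<in> mor C Q Z" for w
    using mod_hom_add[OF Comp_linear_right[OF B o(3) Z w] fi tj]
      Comp_assoc[OF B o(1,3) Z f i w] Comp_assoc[OF B o(2,3) Z t j w] by simp
  show "(\<exists>w\<in>mor C Q Z. g = w \<cdot> (i \<cdot> f \<oplus>\<^bsub>Hom C B Q\<^esub> j \<cdot> t)) \<longleftrightarrow>
      (\<exists>h\<in>mor C D Z. \<exists>k\<in>mor C B' Z. g = h \<cdot> f \<oplus>\<^bsub>Hom C B Z\<^esub> k \<cdot> t)" (is "?l \<longleftrightarrow> ?r")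
  proof
    assume ?l
    then obtain w where w: "w \<in> mor C Q Z" "g = w \<cdot> (i \<cdot> f \<oplus>\<^bsub>Hom C B Q\<^esub> j \<cdot> t)" by blast
    then show ?r
      using comp[OF w(1)] Comp_mor[OF o(1,3) Z i w(1)] Comp_mor[OF o(2,3) Z j w(1)] by blast
  next
    assume ?r
    then obtain h k where h: "h \<in> mor C D Z" and k: "k \<in> mor C B' Z"
      and g: "g = h \<cdot> f \<oplus>\<^bsub>Hom C B Z\<^esub> k \<cdot> t" by blast
    note hp = Comp_mor[OF o(3,1) Z p h] and kq = Comp_mor[OF o(3,2) Z q k]
    let ?w = "h \<cdot> p \<oplus>\<^bsub>Hom C Q Z\<^esub> k \<cdot> q"
    have w: "?w \<in> mor C Q Z" by (rule Hom_add[OF o(3) Z hp kq])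
    interpret DZ: module R "Hom C D Z" by (rule Hom_module[OF o(1) Z])
    interpret BZ: module R "Hom C B' Z" by (rule Hom_module[OF o(2) Z])
    have "?w \<cdot> i = h \<cdot> p \<cdot> i \<oplus>\<^bsub>Hom C D Z\<^esub> k \<cdot> q \<cdot> i"
      by (rule mod_hom_add[OF Comp_linear_left[OF o(1,3) Z i] hp kq])
    also have "\<dots> = h"
      using h k by (simp add: Comp_assoc[OF o(1,3,1) Z i p h] Comp_assoc[OF o(1,3,2) Z i q k] pi qi
        Ident_right[OF o(1) Z] Comp_zero_right[OF o(1,2) Z])
    finally have wi: "?w \<cdot> i = h" .
    have "?w \<cdot> j = h \<cdot> p \<cdot> j \<oplus>\<^bsub>Hom C B' Z\<^esub> k \<cdot> q \<cdot> j"
      by (rule mod_hom_add[OF Comp_linear_left[OF o(2,3) Z j] hp kq])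
    also have "\<dots> = k"
      using h k by (simp add: Comp_assoc[OF o(2,3,1) Z j p h] Comp_assoc[OF o(2,3,2) Z j q k] pj qj
        Ident_right[OF o(2) Z] Comp_zero_right[OF o(2,1) Z])
    finally have wj: "?w \<cdot> j = k" .
    show ?l by (rule bexI[OF _ w]) (simp add: g comp[OF w] wi wj)
  qed
qed

end

context linear_bifunctor
begin

lemma BMap_closed:
  "\<lbrakk>X \<in> Obj C; X' \<in> Obj C; Y \<in> Obj C; Y' \<in> Obj C; x \<in> mor C X' X; y \<in> mor C Y Y';
    e \<in> carrier (BObj F X Y)\<rbrakk> \<Longrightarrow> BMap F x y e \<in> carrier (BObj F X' Y')"
  by (rule mod_hom_closed[OF BMap_hom])

lemma push_hom:
  "\<lbrakk>X \<in> Obj C; Y \<in> Obj C; Y' \<in> Obj C; y \<in> mor C Y Y'\<rbrakk> \<Longrightarrow>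
    push C F X y \<in> mod_hom R (BObj F X Y) (BObj F X Y')"
  by (rule BMap_hom) (auto intro: Ident_mor)

lemma pull_hom:
  "\<lbrakk>X \<in> Obj C; X' \<in> Obj C; Y \<in> Obj C; x \<in> mor C X' X\<rbrakk> \<Longrightarrow>
    pull C F Y x \<in> mod_hom R (BObj F X Y) (BObj F X' Y)"
  by (rule BMap_hom) (auto intro: Ident_mor)

lemma push_comp:
  assumes "X \<in> Obj C" "Y \<in> Obj C" "Y' \<in> Obj C" "Y'' \<in> Obj C"
    "y \<in> mor C Y Y'" "y' \<in> mor C Y' Y''" "e \<in> carrier (BObj F X Y)"
  shows "push C F X (y' \<cdot> y) e = push C F X y' (push C F X y e)"
  using BMap_Comp[OF assms(1,1,1-4) Ident_mor Ident_mor, of y y' e] assms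
  by (simp add: Ident_Ident)

lemma pull_comp:
  assumes "X \<in> Obj C" "X' \<in> Obj C" "X'' \<in> Obj C" "Y \<in> Obj C"
    "x \<in> mor C X' X" "x' \<in> mor C X'' X'" "e \<in> carrier (BObj F X Y)"
  shows "pull C F Y (x \<cdot> x') e = pull C F Y x' (pull C F Y x e)"
  using BMap_Comp[OF assms(1-4,4,4,5,6) Ident_mor Ident_mor, of e] assms
  by (simp add: Ident_Ident)

lemma push_pull:
  assumes "X \<in> Obj C" "X' \<in> Obj C" "Y \<in> Obj C" "Y' \<in> Obj C"
    "x \<in> mor C X' X" "y \<in> mor C Y Y'" "e \<in> carrier (BObj F X Y)"
  shows "push C F X' y (pull C F Y x e) = BMap F x y e"
    and "pull C F Y' x (push C F X y e) = BMap F x y e"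
  using BMap_Comp[OF assms(1,2,2,3,3,4,5) Ident_mor Ident_mor assms(6,7)]
    BMap_Comp[OF assms(1,1,2,3,4,4) Ident_mor assms(5,6) Ident_mor assms(7)] assms
  by (simp_all add: Ident_left[of Y' Y'] Ident_left[of X X'] Ident_right[of Y Y'] Ident_right[of X' X]
      Ident_left[of X' X] Ident_left[of Y Y'])

end

section \<open>Coends\<close>

locale bifunctor_pair =
  linear_category R C + P: linear_bifunctor R C P + E: linear_bifunctor R C E
  for R :: "'r ring" and C :: "('r, 'o, 'm) lincat" (structure)
    and P :: "('r, 'o, 'm, 'p) bifun" and E :: "('r, 'o, 'm, 'e) bifun"

text \<open>
  The coend over \<open>M\<close> of \<open>P(M, Y) \<otimes> E(X, M)\<close> for fixed \<open>X\<close> and \<open>Y\<close>. The class of \<open>u \<otimes> e\<close>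
  with \<open>u \<in> P(M, Y)\<close> and \<open>e \<in> E(X, M)\<close> is \<open>\<kappa> M u e\<close>.
\<close>

locale coend_at = bifunctor_pair +
  fixes X Y
  assumes X: "X \<in> Obj C" and Y: "Y \<in> Obj C"
begin

abbreviation "T \<equiv> tensor_bifun R C P E X Y"
abbreviation "CC \<equiv> BObj (coend_bifun R C P E) X Y"
abbreviation "\<kappa> M u e \<equiv> coend_elem R C P E X Y (M, u, e)"
abbreviation "S \<equiv> coend_sum C T"
abbreviation "rel \<equiv> coend_rel R C T"

lemma T_obj: "BObj T N M = tensor_module R (BObj P N Y) (BObj E X M)"
  by (simp add: tensor_bifun_def)

lemma tensor_pair:
  "\<lbrakk>N \<in> Obj C; M \<in> Obj C\<rbrakk> \<Longrightarrow> tensor_pair R (BObj P N Y) (BObj E X M)"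
  by (rule tensor_pair.intro) (auto intro: P.BObj_module E.BObj_module X Y)

lemma T_obj_module: "\<lbrakk>N \<in> Obj C; M \<in> Obj C\<rbrakk> \<Longrightarrow> module R (BObj T N M)"
  unfolding T_obj by (rule tensor_pair.TT_module[OF tensor_pair])

lemma T_map:
  assumes M: "M \<in> Obj C" and N: "N \<in> Obj C" and f: "f \<in> mor C M N"
  shows T_left_hom: "BMap T f (Ident C M) \<in> mod_hom R (BObj T N M) (BObj T M M)"
    and T_right_hom: "BMap T (Ident C N) f \<in> mod_hom R (BObj T N M) (BObj T N N)"
    and T_left: "\<lbrakk>u \<in> carrier (BObj P N Y); e \<in> carrier (BObj E X M)\<rbrakk> \<Longrightarrow>
      BMap T f (Ident C M) (tensor_elem R (BObj P N Y) (BObj E X M) u e) =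
      tensor_elem R (BObj P M Y) (BObj E X M) (pull C P Y f u) e"
    and T_right: "\<lbrakk>u \<in> carrier (BObj P N Y); e \<in> carrier (BObj E X M)\<rbrakk> \<Longrightarrow>
      BMap T (Ident C N) f (tensor_elem R (BObj P N Y) (BObj E X M) u e) =
      tensor_elem R (BObj P N Y) (BObj E X N) u (push C E X f e)"
proof -
  note mods = P.BObj_module[OF N Y] P.BObj_module[OF M Y] E.BObj_module[OF X M] E.BObj_module[OF X N]
  note d = DomI[OF f M N] CodI[OF f M N] Dom_Ident[OF M] Cod_Ident[OF M] Dom_Ident[OF N] Cod_Ident[OF N]
  have 1: "BMap T f (Ident C M) = tensor_map R (BObj P N Y) (BObj E X M) (BObj P M Y) (BObj E X M)
      (pull C P Y f) (push C E X (Ident C M))"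
    by (simp add: tensor_bifun_def d)
  have 2: "BMap T (Ident C N) f = tensor_map R (BObj P N Y) (BObj E X M) (BObj P N Y) (BObj E X N)
      (pull C P Y (Ident C N)) (push C E X f)"
    by (simp add: tensor_bifun_def d)
  note t1 = tensor_map[OF mods(1,3,2,3) P.pull_hom[OF N M Y f] E.push_hom[OF X M M Ident_mor[OF M]]]
  note t2 = tensor_map[OF mods(1,3,1,4) P.pull_hom[OF N N Y Ident_mor[OF N]] E.push_hom[OF X M N f]]
  show "BMap T f (Ident C M) \<in> mod_hom R (BObj T N M) (BObj T M M)"
    unfolding 1 T_obj by (rule t1)
  show "BMap T (Ident C N) f \<in> mod_hom R (BObj T N M) (BObj T N N)"
    unfolding 2 T_obj by (rule t2)
  assume ue: "u \<in> carrier (BObj P N Y)" "e \<in> carrier (BObj E X M)"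
  show "BMap T f (Ident C M) (tensor_elem R (BObj P N Y) (BObj E X M) u e) =
      tensor_elem R (BObj P M Y) (BObj E X M) (pull C P Y f u) e"
    unfolding 1 using t1(2)[OF ue] E.BMap_Ident[OF X M ue(2)] by simp
  show "BMap T (Ident C N) f (tensor_elem R (BObj P N Y) (BObj E X M) u e) =
      tensor_elem R (BObj P N Y) (BObj E X N) u (push C E X f e)"
    unfolding 2 using t2(2)[OF ue] P.BMap_Ident[OF N Y ue(1)] by simp
qed

sublocale D: module_family R "Obj C" "\<lambda>M. BObj T M M"
  by (rule module_family.intro) (auto intro: T_obj_module cring)

lemma S_eq: "S = D.S"
  by (simp add: coend_sum_def)

lemma inj_hom: "M \<in> Obj C \<Longrightarrow> coend_inj C T M \<in> mod_hom R (BObj T M M) S"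
  unfolding S_eq coend_inj_def by (rule D.inj_hom)

lemma S_module: "module R S"
  unfolding S_eq by (rule D.is_module)

sublocale S: module R S by (rule S_module)

text \<open>The generators of \<^const>\<open>coend_rel\<close>.\<close>

definition rels where
  "rels = {coend_inj C T M (BMap T f (Ident C M) t) \<ominus>\<^bsub>S\<^esub> coend_inj C T N (BMap T (Ident C N) f t) | M N f t.
       M \<in> Obj C \<and> N \<in> Obj C \<and> f \<in> mor C M N \<and> t \<in> carrier (BObj T N M)}"

lemma rel_eq: "rel = gen_submodule R S rels"
  by (simp add: coend_rel_def rels_def)

lemma rels_sub: "rels \<subseteq> carrier S"
proof
  fix z assume "z \<in> rels"
  then obtain M N f t where z: "z = coend_inj C T M (BMap T f (Ident C M) t) \<ominus>\<^bsub>S\<^esub> coend_inj C T N (BMap T (Ident C N) f t)"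
    and MN: "M \<in> Obj C" "N \<in> Obj C" "f \<in> mor C M N" and t: "t \<in> carrier (BObj T N M)"
    unfolding rels_def by blast
  show "z \<in> carrier S" unfolding z
    by (intro S.minus_closed mod_hom_closed[OF inj_hom] MN(1,2)
        mod_hom_closed[OF T_left_hom[OF MN]] mod_hom_closed[OF T_right_hom[OF MN]] t)
qed

sublocale Q: module_quotient R S rel
  unfolding module_quotient_def rel_eq
  by (intro conjI S_module gen_submodule_is_submodule rels_sub)

lemma CC_eq: "CC = quotient_module S rel"
  by (simp add: coend_bifun_def coend_def)

lemma CC_module: "module R CC"
  unfolding CC_eq by (rule Q.quotient_is_module)

sublocale CC: module R CC by (rule CC_module)

lemma proj_hom: "(\<lambda>w. rel +>\<^bsub>S\<^esub> w) \<in> mod_hom R S CC"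
  unfolding CC_eq by (rule Q.quotient_proj)

lemma elem_eq:
  "\<kappa> M u e = rel +>\<^bsub>S\<^esub> coend_inj C T M (tensor_elem R (BObj P M Y) (BObj E X M) u e)"
  by (simp add: coend_elem_def Let_def)

lemma elem_bilinear:
  assumes M: "M \<in> Obj C"
  shows "bilinear R (BObj P M Y) (BObj E X M) CC (\<kappa> M)"
proof -
  interpret U: tensor_pair R "BObj P M Y" "BObj E X M" by (rule tensor_pair[OF M M])
  have h: "(\<lambda>t. rel +>\<^bsub>S\<^esub> coend_inj C T M t) \<in> mod_hom R U.TT CC"
    using mod_hom_comp[OF inj_hom[OF M] proj_hom] by (simp add: T_obj)
  show ?thesis unfolding bilinear_def elem_eq
    using mod_hom_comp[OF bilinear_left[OF U.elem_bilinear] h]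
      mod_hom_comp[OF bilinear_right[OF U.elem_bilinear] h] by simp
qed

lemmas elem_in = bilinear_closed[OF elem_bilinear]

text \<open>
  This is the defining relation of the coend, applied to the pure tensor of \<open>u\<close> and \<open>e\<close>.
\<close>

lemma elem_dinatural:
  assumes M: "M \<in> Obj C" and N: "N \<in> Obj C" and f: "f \<in> mor C M N"
    and u: "u \<in> carrier (BObj P N Y)" and e: "e \<in> carrier (BObj E X M)"
  shows "\<kappa> M (pull C P Y f u) e = \<kappa> N u (push C E X f e)"
proof -
  interpret U: tensor_pair R "BObj P N Y" "BObj E X M" by (rule tensor_pair[OF N M])
  have t: "U.\<tau> u e \<in> carrier (BObj T N M)" unfolding T_obj using u e by (rule U.elem_in)
  let ?l = "coend_inj C T M (BMap T f (Ident C M) (U.\<tau> u e))"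
  let ?r = "coend_inj C T N (BMap T (Ident C N) f (U.\<tau> u e))"
  have "?l \<ominus>\<^bsub>S\<^esub> ?r \<in> rels" unfolding rels_def using M N f t by blast
  then have "?l \<ominus>\<^bsub>S\<^esub> ?r \<in> rel" unfolding rel_eq by (rule gen_submodule_incl)
  moreover have "?l \<in> carrier S" "?r \<in> carrier S"
    by (intro mod_hom_closed[OF inj_hom] M N mod_hom_closed[OF T_left_hom[OF M N f]]
        mod_hom_closed[OF T_right_hom[OF M N f]] t)+
  ultimately have "rel +>\<^bsub>S\<^esub> ?l = rel +>\<^bsub>S\<^esub> ?r" by (simp add: Q.coset_eq_iff)
  then show ?thesis
    unfolding elem_eq T_left[OF M N f u e] T_right[OF M N f u e] .
qed

text \<open>
  Induction over the direct sum, then over the tensor product at each object.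
\<close>

lemma coend_induct [consumes 1, case_names zero add elem]:
  assumes c: "c \<in> carrier CC"
    and zero: "Pr \<zero>\<^bsub>CC\<^esub>"
    and add: "\<And>c d. \<lbrakk>c \<in> carrier CC; d \<in> carrier CC; Pr c; Pr d\<rbrakk> \<Longrightarrow> Pr (c \<oplus>\<^bsub>CC\<^esub> d)"
    and elem: "\<And>M u e. \<lbrakk>M \<in> Obj C; u \<in> carrier (BObj P M Y); e \<in> carrier (BObj E X M)\<rbrakk> \<Longrightarrow> Pr (\<kappa> M u e)"
  shows "Pr c"
proof -
  obtain w where w: "w \<in> carrier S" "c = rel +>\<^bsub>S\<^esub> w"
    using c unfolding CC_eq by (rule Q.quotient_cases)
  have "Pr (rel +>\<^bsub>S\<^esub> w)"
    using w(1) unfolding S_eq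
  proof (induction rule: D.sum_induct)
    case zero
    have "rel +>\<^bsub>S\<^esub> \<zero>\<^bsub>S\<^esub> = \<zero>\<^bsub>CC\<^esub>" by (rule mod_hom_zero[OF S_module CC_module proj_hom])
    with assms(2) show ?case unfolding S_eq by simp
  next
    case (add x y)
    note a = add[folded S_eq]
    have "Pr ((rel +>\<^bsub>S\<^esub> x) \<oplus>\<^bsub>CC\<^esub> (rel +>\<^bsub>S\<^esub> y))"
      by (rule assms(3)) (auto intro: a mod_hom_closed[OF proj_hom])
    then have "Pr (rel +>\<^bsub>S\<^esub> (x \<oplus>\<^bsub>S\<^esub> y))" by (simp add: mod_hom_add[OF proj_hom] a)
    then show ?case unfolding S_eq .
  next
    case (inj M t)
    interpret U: tensor_pair R "BObj P M Y" "BObj E X M" by (rule tensor_pair[OF inj(1,1)])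
    have h: "(\<lambda>t. rel +>\<^bsub>S\<^esub> coend_inj C T M t) \<in> mod_hom R U.TT CC"
      using mod_hom_comp[OF inj_hom[OF inj(1)] proj_hom] by (simp add: T_obj)
    have "t \<in> carrier U.TT" using inj by (simp add: T_obj)
    then have "Pr (rel +>\<^bsub>S\<^esub> coend_inj C T M t)"
    proof (induction rule: U.tensor_induct)
      case (add s t)
      then show ?case using mod_hom_add[OF h add(1,2)] assms(3) mod_hom_closed[OF h] by simp
    next
      case (elem a b)
      then show ?case using assms(4)[OF inj(1)] by (simp add: elem_eq)
    qed
    then show ?case unfolding S_eq coend_inj_def .
  qed
  then show ?thesis by (simp add: w)
qed

lemma sum_hom_eq:
  assumes N: "module R N" and h: "h \<in> mod_hom R S N" and k: "k \<in> mod_hom R S N"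
    and eq: "\<And>M u e. \<lbrakk>M \<in> Obj C; u \<in> carrier (BObj P M Y); e \<in> carrier (BObj E X M)\<rbrakk> \<Longrightarrow>
      h (coend_inj C T M (tensor_elem R (BObj P M Y) (BObj E X M) u e)) =
      k (coend_inj C T M (tensor_elem R (BObj P M Y) (BObj E X M) u e))"
    and w: "w \<in> carrier S"
  shows "h w = k w"
proof (rule direct_sum_hom_eq[OF D.module_family_axioms N])
  show "h \<in> mod_hom R D.S N" "k \<in> mod_hom R D.S N" "w \<in> carrier D.S"
    using h k w by (simp_all add: S_eq)
  fix M t assume M: "M \<in> Obj C" and t: "t \<in> carrier (BObj T M M)"
  interpret U: tensor_pair R "BObj P M Y" "BObj E X M" by (rule tensor_pair[OF M M])
  have "h (coend_inj C T M t) = k (coend_inj C T M t)"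
    by (rule U.tensor_hom_eq[where h = "\<lambda>t. h (coend_inj C T M t)" and k = "\<lambda>t. k (coend_inj C T M t)"])
      (use mod_hom_comp[OF inj_hom[OF M] h] mod_hom_comp[OF inj_hom[OF M] k] t eq M in \<open>simp_all add: T_obj\<close>)
  then show "h (direct_sum_inj (Obj C) (\<lambda>M. BObj T M M) M t) = k (direct_sum_inj (Obj C) (\<lambda>M. BObj T M M) M t)"
    by (simp add: coend_inj_def)
qed

lemma coend_hom_eq:
  assumes N: "module R N" and h: "h \<in> mod_hom R CC N" and k: "k \<in> mod_hom R CC N"
    and eq: "\<And>M u e. \<lbrakk>M \<in> Obj C; u \<in> carrier (BObj P M Y); e \<in> carrier (BObj E X M)\<rbrakk> \<Longrightarrow>
      h (\<kappa> M u e) = k (\<kappa> M u e)"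
    and c: "c \<in> carrier CC"
  shows "h c = k c"
  using c
proof (induction rule: coend_induct)
  case zero
  show ?case using mod_hom_zero[OF CC_module N h] mod_hom_zero[OF CC_module N k] by simp
qed (simp_all add: mod_hom_add[OF h] mod_hom_add[OF k] eq)

text \<open>
  The bilinear maps \<open>\<phi> M\<close> extend to the tensor products, and these extensions to the direct
  sum. Dinaturality is assumed for pure tensors only, and it spreads to all tensors because both sides are
  homomorphisms.
\<close>

lemma coend_universal:
  assumes N: "module R N"
    and bil: "\<And>M. M \<in> Obj C \<Longrightarrow> bilinear R (BObj P M Y) (BObj E X M) N (\<phi> M)"
    and din: "\<And>M M' f u e. \<lbrakk>M \<in> Obj C; M' \<in> Obj C; f \<in> mor C M M'; u \<in> carrier (BObj P M' Y);
      e \<in> carrier (BObj E X M)\<rbrakk> \<Longrightarrow> \<phi> M (pull C P Y f u) e = \<phi> M' u (push C E X f e)"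
  shows "\<exists>K\<in>mod_hom R CC N. \<forall>M\<in>Obj C. \<forall>u\<in>carrier (BObj P M Y). \<forall>e\<in>carrier (BObj E X M).
    K (\<kappa> M u e) = \<phi> M u e"
proof -
  interpret N: module R N by fact
  let ?G = "\<lambda>M k. k \<in> mod_hom R (BObj T M M) N \<and> (\<forall>u\<in>carrier (BObj P M Y). \<forall>e\<in>carrier (BObj E X M).
      k (tensor_elem R (BObj P M Y) (BObj E X M) u e) = \<phi> M u e)"
  have "\<forall>M\<in>Obj C. \<exists>k. ?G M k"
    using tensor_pair.tensor_universal[OF tensor_pair N bil] unfolding T_obj by blast
  from bchoice[OF this] obtain h where
    h: "\<And>M. M \<in> Obj C \<Longrightarrow> h M \<in> mod_hom R (BObj T M M) N"
    and he: "\<And>M u e. \<lbrakk>M \<in> Obj C; u \<in> carrier (BObj P M Y); e \<in> carrier (BObj E X M)\<rbrakk> \<Longrightarrow>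
      h M (tensor_elem R (BObj P M Y) (BObj E X M) u e) = \<phi> M u e"
    by blast
  let ?L = "D.lift N h"
  have L: "?L \<in> mod_hom R S N" unfolding S_eq by (rule D.lift_hom[OF N h])
  have Li: "?L (coend_inj C T M t) = h M t" if "M \<in> Obj C" "t \<in> carrier (BObj T M M)" for M t
    unfolding coend_inj_def by (rule D.lift_inj[OF N h that])
  have "?L x = \<zero>\<^bsub>N\<^esub>" if x_rel: "x \<in> rels" for x
  proof -
    obtain M M' f t where x: "x = coend_inj C T M (BMap T f (Ident C M) t) \<ominus>\<^bsub>S\<^esub> coend_inj C T M' (BMap T (Ident C M') f t)"
      and M: "M \<in> Obj C" "M' \<in> Obj C" "f \<in> mor C M M'" and t: "t \<in> carrier (BObj T M' M)"
      using x_rel unfolding rels_def by blast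
    interpret U: tensor_pair R "BObj P M' Y" "BObj E X M" by (rule tensor_pair[OF M(2,1)])
    note hl = T_left_hom[OF M] and hr = T_right_hom[OF M]
    have "h M (BMap T f (Ident C M) t) = h M' (BMap T (Ident C M') f t)"
    proof (rule U.tensor_hom_eq[where h = "\<lambda>t. h M (BMap T f (Ident C M) t)" and k = "\<lambda>t. h M' (BMap T (Ident C M') f t)"])
      show "(\<lambda>t. h M (BMap T f (Ident C M) t)) \<in> mod_hom R U.TT N"
        using mod_hom_comp[OF hl h[OF M(1)]] by (simp add: T_obj)
      show "(\<lambda>t. h M' (BMap T (Ident C M') f t)) \<in> mod_hom R U.TT N"
        using mod_hom_comp[OF hr h[OF M(2)]] by (simp add: T_obj)
      show "t \<in> carrier U.TT" using t by (simp add: T_obj)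
      fix u e assume ue: "u \<in> carrier (BObj P M' Y)" "e \<in> carrier (BObj E X M)"
      show "h M (BMap T f (Ident C M) (U.\<tau> u e)) = h M' (BMap T (Ident C M') f (U.\<tau> u e))"
        unfolding T_left[OF M ue] T_right[OF M ue]
        using he[OF M(1) mod_hom_closed[OF P.pull_hom[OF M(2,1) Y M(3)] ue(1)] ue(2)]
          he[OF M(2) ue(1) mod_hom_closed[OF E.push_hom[OF X M] ue(2)]] din[OF M ue] by simp
    qed
    then show ?thesis unfolding x
      using M(1,2) t mod_hom_closed[OF hl t] mod_hom_closed[OF hr t] mod_hom_closed[OF inj_hom] mod_hom_closed[OF h]
      by (simp add: mod_hom_minus[OF S_module N L] Li N.minus_zero_iff)
  qed
  then have "?L x = \<zero>\<^bsub>N\<^esub>" if "x \<in> rel" for x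
    using mod_hom_gen_submodule[OF S_module N L rels_sub] that by (simp add: rel_eq)
  from Q.quotient_universal[OF N L this] obtain K
    where K: "K \<in> mod_hom R CC N" "\<And>x. x \<in> carrier S \<Longrightarrow> K (rel +>\<^bsub>S\<^esub> x) = ?L x"
    unfolding CC_eq by blast
  have "K (\<kappa> M u e) = \<phi> M u e" if M: "M \<in> Obj C" and ue: "u \<in> carrier (BObj P M Y)" "e \<in> carrier (BObj E X M)" for M u e
  proof -
    have t: "tensor_elem R (BObj P M Y) (BObj E X M) u e \<in> carrier (BObj T M M)"
      unfolding T_obj by (rule tensor_pair.elem_in[OF tensor_pair[OF M M] ue])
    show ?thesis unfolding elem_eq
      using K(2)[OF mod_hom_closed[OF inj_hom[OF M] t]] Li[OF M t] he[OF M ue] by simp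
  qed
  then show ?thesis using K(1) by blast
qed

end


context bifunctor_pair
begin

abbreviation "coend_obj X Y \<equiv> BObj (coend_bifun R C P E) X Y"
abbreviation "coend_act \<equiv> BMap (coend_bifun R C P E)"
abbreviation "pure X Y M u e \<equiv> coend_elem R C P E X Y (M, u, e)"

lemma coend_atI: "\<lbrakk>X \<in> Obj C; Y \<in> Obj C\<rbrakk> \<Longrightarrow> coend_at R C P E X Y"
  by (intro coend_at.intro coend_at_axioms.intro bifunctor_pair_axioms)

text \<open>
  As for \<^const>\<open>tensor_map\<close>, the universal property provides a homomorphism with the right values on
  the classes of pure tensors, and the given formula is identified with it on the direct sum.
\<close>

lemma coend_BMap:
  assumes X: "X \<in> Obj C" and X': "X' \<in> Obj C" and Y: "Y \<in> Obj C" and Y': "Y' \<in> Obj C"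
    and x: "x \<in> mor C X' X" and y: "y \<in> mor C Y Y'"
  shows coend_BMap_hom: "coend_act x y \<in> mod_hom R (coend_obj X Y) (coend_obj X' Y')"
    and coend_BMap_elem: "\<lbrakk>M \<in> Obj C; u \<in> carrier (BObj P M Y); e \<in> carrier (BObj E X M)\<rbrakk> \<Longrightarrow>
      coend_act x y (pure X Y M u e) = pure X' Y' M (push C P M y u) (pull C E M x e)"
proof -
  interpret U: coend_at R C P E X Y by (rule coend_atI[OF X Y])
  interpret V: coend_at R C P E X' Y' by (rule coend_atI[OF X' Y'])
  note pu = P.push_hom[OF _ Y Y' y] and pe = E.pull_hom[OF X X' _ x]
  define \<phi> where "\<phi> M = tensor_map R (BObj P M Y) (BObj E X M) (BObj P M Y') (BObj E X' M)
     (push C P M y) (pull C E M x)" for M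
  have \<phi>: "\<phi> M \<in> mod_hom R (BObj U.T M M) (BObj V.T M M)"
    "\<And>u e. \<lbrakk>u \<in> carrier (BObj P M Y); e \<in> carrier (BObj E X M)\<rbrakk> \<Longrightarrow>
      \<phi> M (tensor_elem R (BObj P M Y) (BObj E X M) u e) =
      tensor_elem R (BObj P M Y') (BObj E X' M) (push C P M y u) (pull C E M x e)"
    if M: "M \<in> Obj C" for M
    using tensor_map[OF P.BObj_module[OF M Y] E.BObj_module[OF X M] P.BObj_module[OF M Y']
        E.BObj_module[OF X' M] pu[OF M] pe[OF M]]
    unfolding \<phi>_def U.T_obj V.T_obj by auto
  have map: "coend_act x y = coend_map R C V.T \<phi>"
    by (simp add: coend_bifun_def \<phi>_def[abs_def] DomI[OF x X' X] CodI[OF x X' X] DomI[OF y Y Y'] CodI[OF y Y Y'])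
  let ?\<psi> = "\<lambda>M u e. pure X' Y' M (push C P M y u) (pull C E M x e)"
  have "\<exists>K\<in>mod_hom R U.CC V.CC. \<forall>M\<in>Obj C. \<forall>u\<in>carrier (BObj P M Y). \<forall>e\<in>carrier (BObj E X M).
    K (U.\<kappa> M u e) = ?\<psi> M u e"
  proof (rule U.coend_universal[OF V.CC_module])
    fix M assume M: "M \<in> Obj C"
    show "bilinear R (BObj P M Y) (BObj E X M) V.CC (?\<psi> M)"
      unfolding bilinear_def
      using mod_hom_comp[OF pu[OF M] bilinear_left[OF V.elem_bilinear[OF M]]] mod_hom_closed[OF pe[OF M]]
        mod_hom_comp[OF pe[OF M] bilinear_right[OF V.elem_bilinear[OF M]]] mod_hom_closed[OF pu[OF M]]
      by blast
  next
    fix M M' f u e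
    assume M: "M \<in> Obj C" "M' \<in> Obj C" "f \<in> mor C M M'" and u: "u \<in> carrier (BObj P M' Y)"
      and e: "e \<in> carrier (BObj E X M)"
    have "push C P M y (pull C P Y f u) = pull C P Y' f (push C P M' y u)"
      using P.push_pull[OF M(2,1) Y Y' M(3) y u] by simp
    moreover have "pull C E M' x (push C E X f e) = push C E X' f (pull C E M x e)"
      using E.push_pull[OF X X' M(1,2) x M(3) e] by simp
    ultimately show "?\<psi> M (pull C P Y f u) e = ?\<psi> M' u (push C E X f e)"
      using V.elem_dinatural[OF M mod_hom_closed[OF pu[OF M(2)] u] mod_hom_closed[OF pe[OF M(1)] e]]
      by simp
  qed
  then obtain K where K: "K \<in> mod_hom R U.CC V.CC"
    "\<And>M u e. \<lbrakk>M \<in> Obj C; u \<in> carrier (BObj P M Y); e \<in> carrier (BObj E X M)\<rbrakk> \<Longrightarrow>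
      K (U.\<kappa> M u e) = ?\<psi> M u e" by blast
  let ?L = "\<lambda>w. \<lambda>M\<in>Obj C. \<phi> M (w M)"
  have L: "?L \<in> mod_hom R U.S V.S"
    using direct_sum_map_hom[OF U.D.module_family_axioms V.D.module_family_axioms \<phi>(1)]
    by (simp add: U.S_eq V.S_eq)
  have Li: "?L (coend_inj C U.T M t) = coend_inj C V.T M (\<phi> M t)"
    if "M \<in> Obj C" "t \<in> carrier (BObj U.T M M)" for M t
    using direct_sum_map_inj[OF U.D.module_family_axioms V.D.module_family_axioms \<phi>(1) that]
    by (simp add: coend_inj_def)
  have KL: "K (U.rel +>\<^bsub>U.S\<^esub> w) = V.rel +>\<^bsub>V.S\<^esub> ?L w" if w: "w \<in> carrier U.S" for w
  proof (rule U.sum_hom_eq[OF V.CC_module mod_hom_comp[OF U.proj_hom K(1)] mod_hom_comp[OF L V.proj_hom] _ w])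
    fix M u e assume M: "M \<in> Obj C" and u: "u \<in> carrier (BObj P M Y)" and e: "e \<in> carrier (BObj E X M)"
    have t: "tensor_elem R (BObj P M Y) (BObj E X M) u e \<in> carrier (BObj U.T M M)"
      unfolding U.T_obj by (rule tensor_pair.elem_in[OF U.tensor_pair[OF M M] u e])
    show "K (U.rel +>\<^bsub>U.S\<^esub> coend_inj C U.T M (tensor_elem R (BObj P M Y) (BObj E X M) u e)) =
       V.rel +>\<^bsub>V.S\<^esub> ?L (coend_inj C U.T M (tensor_elem R (BObj P M Y) (BObj E X M) u e))"
      unfolding Li[OF M t] \<phi>(2)[OF M u e] using K(2)[OF M u e] unfolding U.elem_eq V.elem_eq .
  qed
  have eq: "coend_act x y c = K c" if "c \<in> carrier U.CC" for c
    unfolding map coend_map_def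
  proof (rule U.Q.quotient_map_eq)
    show "c \<in> carrier (quotient_module U.S U.rel)" using that by (simp add: U.CC_eq)
  qed (rule KL)
  show "coend_act x y \<in> mod_hom R U.CC V.CC"
    by (rule mod_hom_cong[OF U.CC_module K(1) eq])
  show "coend_act x y (U.\<kappa> M u e) = ?\<psi> M u e"
    if "M \<in> Obj C" "u \<in> carrier (BObj P M Y)" "e \<in> carrier (BObj E X M)"
    using that by (simp add: eq U.elem_in K(2))
qed

text \<open>
  Every functor law is an identity between homomorphisms and is checked on pure tensors.
  Linearity in a morphism is closed under sums of elements, so induction reduces it to
  pure tensors too, where it follows from the linearity of \<open>P\<close> and \<open>E\<close>.
\<close>

lemma coend_bifun_linear: "linear_bifunctor R C (coend_bifun R C P E)"
proof (intro linear_bifunctor.intro linear_category_axioms linear_bifunctor_axioms.intro)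
  fix X Y assume "X \<in> Obj C" "Y \<in> Obj C"
  then show "module R (coend_obj X Y)" by (rule coend_at.CC_module[OF coend_atI])
next
  fix X X' Y Y' x y
  assume a: "X \<in> Obj C" "X' \<in> Obj C" "Y \<in> Obj C" "Y' \<in> Obj C" "x \<in> mor C X' X" "y \<in> mor C Y Y'"
  show "coend_act x y \<in> mod_hom R (coend_obj X Y) (coend_obj X' Y')"
    by (rule coend_BMap_hom[OF a])
next
  fix X Y c
  assume X: "X \<in> Obj C" and Y: "Y \<in> Obj C" and c: "c \<in> carrier (coend_obj X Y)"
  note m = coend_at.CC_module[OF coend_atI[OF X Y]]
  note h = coend_BMap[OF X X Y Y Ident_mor[OF X] Ident_mor[OF Y]]
  show "coend_act (Ident C X) (Ident C Y) c = c"
    using coend_at.coend_hom_eq[OF coend_atI[OF X Y] m h(1) _ _ c, of "\<lambda>c. c"]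
    by (simp add: h(2) mod_homI P.BMap_Ident Y E.BMap_Ident X)
next
  fix X X' X'' Y Y' Y'' x x' y y' c
  assume X: "X \<in> Obj C" "X' \<in> Obj C" "X'' \<in> Obj C" and Y: "Y \<in> Obj C" "Y' \<in> Obj C" "Y'' \<in> Obj C"
    and x: "x \<in> mor C X' X" "x' \<in> mor C X'' X'" and y: "y \<in> mor C Y Y'" "y' \<in> mor C Y' Y''"
    and c: "c \<in> carrier (coend_obj X Y)"
  note h = coend_BMap[OF X(1,3) Y(1,3) Comp_mor[OF X(3,2,1) x(2,1)] Comp_mor[OF Y y]]
  note k = coend_BMap[OF X(1,2) Y(1,2) x(1) y(1)]
  note l = coend_BMap[OF X(2,3) Y(2,3) x(2) y(2)]
  note m = coend_at.CC_module[OF coend_atI[OF X(3) Y(3)]]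
  show "coend_act (x \<cdot> x') (y' \<cdot> y) c = coend_act x' y' (coend_act x y c)"
  proof (rule coend_at.coend_hom_eq[OF coend_atI[OF X(1) Y(1)] m h(1) mod_hom_comp[OF k(1) l(1)] _ c])
    fix M u e assume M: "M \<in> Obj C" and u: "u \<in> carrier (BObj P M Y)" and e: "e \<in> carrier (BObj E X M)"
    show "coend_act (x \<cdot> x') (y' \<cdot> y) (pure X Y M u e) = coend_act x' y' (coend_act x y (pure X Y M u e))"
      using M by (simp add: h(2)[OF M u e] k(2)[OF M u e]
        l(2)[OF M mod_hom_closed[OF P.push_hom[OF M Y(1,2) y(1)] u] mod_hom_closed[OF E.pull_hom[OF X(1,2) M x(1)] e]]
        P.push_comp[OF M Y y u] E.pull_comp[OF X M x e])
  qed
next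
  fix X X' Y Y' y c
  assume X: "X \<in> Obj C" "X' \<in> Obj C" and Y: "Y \<in> Obj C" "Y' \<in> Obj C" and y: "y \<in> mor C Y Y'"
    and c: "c \<in> carrier (coend_obj X Y)"
  interpret U: coend_at R C P E X Y by (rule coend_atI[OF X(1) Y(1)])
  interpret V: coend_at R C P E X' Y' by (rule coend_atI[OF X(2) Y(2)])
  note h = coend_BMap[OF X Y _ y]
  note mH = Hom_module[OF X(2,1)]
  show "(\<lambda>x. coend_act x y c) \<in> mod_hom R (Hom C X' X) V.CC"
    using c
  proof (induction rule: U.coend_induct)
    case zero
    show ?case
      by (rule mod_hom_cong[OF mH mod_hom_zero_map[OF mH V.CC_module]])
        (rule mod_hom_zero[OF U.CC_module V.CC_module h(1)])
  next
    case (add c d)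
    show ?case
      by (rule mod_hom_cong[OF mH mod_hom_sum[OF mH V.CC_module add(3,4)]])
        (rule mod_hom_add[OF h(1) add(1,2)])
  next
    case (elem M u e)
    note u' = mod_hom_closed[OF P.push_hom[OF elem(1) Y y] elem(2)]
    show ?case
      by (rule mod_hom_cong[OF mH mod_hom_comp[OF E.BMap_linear_left[OF X elem(1,1) Ident_mor[OF elem(1)] elem(3)]
              bilinear_right[OF V.elem_bilinear[OF elem(1)] u']]])
        (rule h(2)[OF _ elem])
  qed
next
  fix X X' Y Y' x c
  assume X: "X \<in> Obj C" "X' \<in> Obj C" and Y: "Y \<in> Obj C" "Y' \<in> Obj C" and x: "x \<in> mor C X' X"
    and c: "c \<in> carrier (coend_obj X Y)"
  interpret U: coend_at R C P E X Y by (rule coend_atI[OF X(1) Y(1)])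
  interpret V: coend_at R C P E X' Y' by (rule coend_atI[OF X(2) Y(2)])
  note h = coend_BMap[OF X Y x]
  note mH = Hom_module[OF Y]
  show "(\<lambda>y. coend_act x y c) \<in> mod_hom R (Hom C Y Y') V.CC"
    using c
  proof (induction rule: U.coend_induct)
    case zero
    show ?case
      by (rule mod_hom_cong[OF mH mod_hom_zero_map[OF mH V.CC_module]])
        (rule mod_hom_zero[OF U.CC_module V.CC_module h(1)])
  next
    case (add c d)
    show ?case
      by (rule mod_hom_cong[OF mH mod_hom_sum[OF mH V.CC_module add(3,4)]])
        (rule mod_hom_add[OF h(1) add(1,2)])
  next
    case (elem M u e)
    note e' = mod_hom_closed[OF E.pull_hom[OF X elem(1) x] elem(3)]
    show ?case
      by (rule mod_hom_cong[OF mH mod_hom_comp[OF P.BMap_linear_right[OF elem(1,1) Y Ident_mor[OF elem(1)] elem(2)]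
              bilinear_left[OF V.elem_bilinear[OF elem(1)] e']]])
        (rule h(2)[OF _ elem])
  qed
qed

end

section \<open>Transport of structure\<close>

lemma transport_module:
  assumes M: "module R M" and inj: "inj_on h (carrier M)"
  shows transport_module_is_module: "module R (transport_module h M)"
    and transport_module_hom: "h \<in> mod_hom R M (transport_module h M)"
proof -
  interpret M: module R M by fact
  have k: "inv_into (carrier M) h (h x) = x" if "x \<in> carrier M" for x
    using that inj by simp
  show "module R (transport_module h M)"
    by (rule module_image[OF M, of h]) (auto simp: transport_module_def Let_def k)
  show "h \<in> mod_hom R M (transport_module h M)"
    by (rule mod_homI) (auto simp: transport_module_def Let_def k)
qed

lemma transport_carrier: "carrier (transport_module h M) = h ` carrier M"
  by (simp add: transport_module_def Let_def)

locale transported_bifunctor = linear_bifunctor +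
  fixes h
  assumes h_inj: "\<lbrakk>X \<in> Obj C; Y \<in> Obj C\<rbrakk> \<Longrightarrow> inj_on (h X Y) (carrier (BObj F X Y))"
begin

abbreviation "F' \<equiv> transport_bifun C h F"

lemma F'_obj: "BObj F' X Y = transport_module (h X Y) (BObj F X Y)"
  by (simp add: transport_bifun_def)

lemma F'_module: "\<lbrakk>X \<in> Obj C; Y \<in> Obj C\<rbrakk> \<Longrightarrow> module R (BObj F' X Y)"
  unfolding F'_obj by (intro transport_module_is_module BObj_module h_inj)

lemma h_hom: "\<lbrakk>X \<in> Obj C; Y \<in> Obj C\<rbrakk> \<Longrightarrow> h X Y \<in> mod_hom R (BObj F X Y) (BObj F' X Y)"
  unfolding F'_obj by (intro transport_module_hom BObj_module h_inj)

lemma F'_cases: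
  assumes "e \<in> carrier (BObj F' X Y)"
  obtains e' where "e' \<in> carrier (BObj F X Y)" "e = h X Y e'"
  using assms unfolding F'_obj transport_carrier by auto

lemma F'_map:
  assumes "X \<in> Obj C" "X' \<in> Obj C" "Y \<in> Obj C" "Y' \<in> Obj C" "x \<in> mor C X' X" "y \<in> mor C Y Y'"
    "e \<in> carrier (BObj F X Y)"
  shows "BMap F' x y (h X Y e) = h X' Y' (BMap F x y e)"
  using assms h_inj
  by (simp add: transport_bifun_def DomI[of x X' X] CodI[of x X' X] DomI[of y Y Y'] CodI[of y Y Y'])

lemma h_zero_iff:
  assumes "X \<in> Obj C" "Y \<in> Obj C" "e \<in> carrier (BObj F X Y)"
  shows "h X Y e = \<zero>\<^bsub>BObj F' X Y\<^esub> \<longleftrightarrow> e = \<zero>\<^bsub>BObj F X Y\<^esub>"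
proof -
  interpret module R "BObj F X Y" using assms by (intro BObj_module)
  have "h X Y \<zero>\<^bsub>BObj F X Y\<^esub> = \<zero>\<^bsub>BObj F' X Y\<^esub>"
    using assms by (intro mod_hom_zero[OF BObj_module F'_module h_hom])
  then show ?thesis using h_inj[OF assms(1,2)] assms(3) by (metis inj_on_def zero_closed)
qed

lemma F'_linear: "linear_bifunctor R C F'"
proof (intro linear_bifunctor.intro linear_category_axioms linear_bifunctor_axioms.intro)
  fix X Y assume "X \<in> Obj C" "Y \<in> Obj C"
  then show "module R (BObj F' X Y)" by (rule F'_module)
next
  fix X X' Y Y' x y
  assume a: "X \<in> Obj C" "X' \<in> Obj C" "Y \<in> Obj C" "Y' \<in> Obj C" "x \<in> mor C X' X" "y \<in> mor C Y Y'"
  note h = h_hom[OF a(1,3)] and h' = h_hom[OF a(2,4)] and b = BMap_hom[OF a]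
  interpret M: module R "BObj F X Y" using a by (intro BObj_module)
  show "BMap F' x y \<in> mod_hom R (BObj F' X Y) (BObj F' X' Y')"
    by (rule mod_homI; elim F'_cases)
      (simp_all add: F'_map[OF a] mod_hom_closed[OF b] mod_hom_closed[OF h']
        mod_hom_add[OF b] mod_hom_add[OF h'] mod_hom_smult[OF b] mod_hom_smult[OF h']
        mod_hom_add[OF h, symmetric] mod_hom_smult[OF h, symmetric])
next
  fix X Y e
  assume "X \<in> Obj C" "Y \<in> Obj C" "e \<in> carrier (BObj F' X Y)"
  then show "BMap F' (Ident C X) (Ident C Y) e = e"
    by (elim F'_cases) (simp add: F'_map[of X X Y Y] Ident_mor BMap_Ident)
next
  fix X X' X'' Y Y' Y'' x x' y y' e
  assume X: "X \<in> Obj C" "X' \<in> Obj C" "X'' \<in> Obj C" and Y: "Y \<in> Obj C" "Y' \<in> Obj C" "Y'' \<in> Obj C"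
    and x: "x \<in> mor C X' X" "x' \<in> mor C X'' X'" and y: "y \<in> mor C Y Y'" "y' \<in> mor C Y' Y''"
    and e: "e \<in> carrier (BObj F' X Y)"
  from e show "BMap F' (x \<cdot> x') (y' \<cdot> y) e = BMap F' x' y' (BMap F' x y e)"
    by (elim F'_cases)
      (simp add: F'_map[OF X(1,3) Y(1,3) Comp_mor[OF X(3,2,1) x(2,1)] Comp_mor[OF Y y]]
        F'_map[OF X(1,2) Y(1,2) x(1) y(1)] F'_map[OF X(2,3) Y(2,3) x(2) y(2)]
        BMap_closed[OF X(1,2) Y(1,2) x(1) y(1)] BMap_Comp[OF X Y x y])
next
  fix X X' Y Y' y e
  assume X: "X \<in> Obj C" "X' \<in> Obj C" and Y: "Y \<in> Obj C" "Y' \<in> Obj C" and y: "y \<in> mor C Y Y'"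
    and e: "e \<in> carrier (BObj F' X Y)"
  obtain d where d: "d \<in> carrier (BObj F X Y)" "e = h X Y d" using e by (rule F'_cases)
  show "(\<lambda>x. BMap F' x y e) \<in> mod_hom R (Hom C X' X) (BObj F' X' Y')"
    by (rule mod_hom_cong[OF Hom_module[OF X(2,1)] mod_hom_comp[OF BMap_linear_left[OF X Y y d(1)] h_hom[OF X(2) Y(2)]]])
      (use d X Y y in \<open>simp add: F'_map\<close>)
next
  fix X X' Y Y' x e
  assume X: "X \<in> Obj C" "X' \<in> Obj C" and Y: "Y \<in> Obj C" "Y' \<in> Obj C" and x: "x \<in> mor C X' X"
    and e: "e \<in> carrier (BObj F' X Y)"
  obtain d where d: "d \<in> carrier (BObj F X Y)" "e = h X Y d" using e by (rule F'_cases)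
  show "(\<lambda>y. BMap F' x y e) \<in> mod_hom R (Hom C Y Y') (BObj F' X' Y')"
    by (rule mod_hom_cong[OF Hom_module[OF Y] mod_hom_comp[OF BMap_linear_right[OF X Y x d(1)] h_hom[OF X(2) Y(2)]]])
      (use d X Y x in \<open>simp add: F'_map\<close>)
qed

end

section \<open>The positive extensions are linear bifunctors\<close>

context coend_at
begin

abbreviation "valid ts \<equiv> \<forall>(M, u, \<delta>)\<in>set ts. M \<in> Obj C \<and> u \<in> carrier (BObj P M Y) \<and> \<delta> \<in> carrier (BObj E X M)"

text \<open>
  Concatenation of lists corresponds to addition in the coend. Thus the classes that are given by
  lists are closed under addition.
\<close>

lemma list_sum_simps:
  assumes "valid ts" "valid us"
  shows "coend_list_sum R C P E X Y us \<in> carrier CC"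
    and "coend_list_sum R C P E X Y (ts @ us) =
      coend_list_sum R C P E X Y ts \<oplus>\<^bsub>CC\<^esub> coend_list_sum R C P E X Y us"
proof -
  have closed: "coend_list_sum R C P E X Y us \<in> carrier CC" if "valid us" for us
    using that by (induction us) (auto simp: coend_list_sum_def intro: elem_in)
  show "coend_list_sum R C P E X Y us \<in> carrier CC" using assms(2) by (rule closed)
  show "coend_list_sum R C P E X Y (ts @ us) =
      coend_list_sum R C P E X Y ts \<oplus>\<^bsub>CC\<^esub> coend_list_sum R C P E X Y us"
    using assms(1)
  proof (induction ts)
    case Nil
    then show ?case using closed[OF assms(2)] by (simp add: coend_list_sum_def)
  next
    case (Cons t ts)
    obtain M u e where t: "t = (M, u, e)" by (cases t)
    have "\<kappa> M u e \<in> carrier CC" using Cons(2) t by (intro elem_in) auto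
    moreover have "coend_list_sum R C P E X Y ts \<in> carrier CC" using Cons(2) by (intro closed) simp
    moreover have "coend_list_sum R C P E X Y (t # vs) = \<kappa> M u e \<oplus>\<^bsub>CC\<^esub> coend_list_sum R C P E X Y vs" for vs
      by (simp add: coend_list_sum_def t)
    ultimately show ?case using Cons closed[OF assms(2)] by (simp add: CC.a_assoc)
  qed
qed

lemma is_list_sum:
  assumes "c \<in> carrier CC"
  shows "\<exists>ts. valid ts \<and> coend_list_sum R C P E X Y ts = c"
  using assms
proof (induction rule: coend_induct)
  case zero
  show ?case by (rule exI[of _ "[]"]) (simp add: coend_list_sum_def)
next
  case (add c d)
  then obtain ts us where "valid ts" "coend_list_sum R C P E X Y ts = c"
    "valid us" "coend_list_sum R C P E X Y us = d" by blast
  then show ?case using list_sum_simps(2)[of ts us] by (intro exI[of _ "ts @ us"]) auto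
next
  case (elem M u e)
  then show ?case using elem_in[OF elem]
    by (intro exI[of _ "[(M, u, e)]"]) (simp add: coend_list_sum_def)
qed

end

text \<open>
  The list chosen for an element sums up to that element, so it can be recovered from its code.
\<close>

lemma coend_code_inj:
  assumes "coend_at R C P E X Y"
  shows "inj_on (coend_code R C P E X Y) (carrier (BObj (coend_bifun R C P E) X Y))"
proof (rule inj_onI)
  interpret coend_at R C P E X Y by fact
  fix c d assume c: "c \<in> carrier CC" and d: "d \<in> carrier CC"
    and eq: "coend_code R C P E X Y c = coend_code R C P E X Y d"
  let ?Q = "\<lambda>c ts. valid ts \<and> coend_list_sum R C P E X Y ts = c"
  have "(SOME ts. ?Q c ts) = (SOME ts. ?Q d ts)" using eq by (simp add: coend_code_def)
  moreover note someI_ex[OF is_list_sum[OF c]] someI_ex[OF is_list_sum[OF d]]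
  ultimately show "c = d" by metis
qed

context linear_bifunctor
begin

lemma transported_PHom: "transported_bifunctor R C (Hom_bifun C) (\<lambda>_ _. PHom)"
  by (intro transported_bifunctor.intro Hom_bifun_linear transported_bifunctor_axioms.intro)
    (simp add: inj_on_def)

lemma transported_PExt: "transported_bifunctor R C F (\<lambda>_ _. PExt)"
  by (intro transported_bifunctor.intro linear_bifunctor_axioms transported_bifunctor_axioms.intro)
    (simp add: inj_on_def)

lemma bifunctor_pairI: "linear_bifunctor R C P \<Longrightarrow> bifunctor_pair R C P F"
  by (intro bifunctor_pair.intro linear_category_axioms linear_bifunctor_axioms)

lemma transported_coend:
  assumes "linear_bifunctor R C P"
  shows "transported_bifunctor R C (coend_bifun R C P F) (coend_code R C P F)"
proof -
  interpret bifunctor_pair R C P F using assms by (rule bifunctor_pairI)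
  show ?thesis
    by (intro transported_bifunctor.intro coend_bifun_linear transported_bifunctor_axioms.intro
        coend_code_inj coend_atI)
qed

lemma pos_ext_linear: "linear_bifunctor R C (pos_ext R C F n)"
proof (induction n)
  case 0
  show ?case unfolding pos_ext.simps by (rule transported_bifunctor.F'_linear[OF transported_PHom])
next
  case (Suc n)
  show ?case
  proof (cases n)
    case 0
    show ?thesis unfolding 0 pos_ext.simps by (rule transported_bifunctor.F'_linear[OF transported_PExt])
  next
    case (Suc k)
    show ?thesis unfolding Suc pos_ext.simps Let_def
      by (rule transported_bifunctor.F'_linear[OF transported_coend[OF Suc.IH[unfolded Suc]]])
  qed
qed

end

section \<open>Generators and presentations\<close>

text \<open>By Yoneda, \<open>m\<close> is the image of the identity under an epimorphism from \<open>C(A, -)\<close> to \<open>F(X, -)\<close>.\<close>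

definition generates ::
  "('r, 'o, 'm) lincat \<Rightarrow> ('r, 'o, 'm, 'a) bifun \<Rightarrow> 'o \<Rightarrow> 'o \<Rightarrow> 'a \<Rightarrow> bool" where
  "generates C F X A m \<longleftrightarrow> A \<in> Obj C \<and> m \<in> carrier (BObj F X A) \<and>
    (\<forall>Z\<in>Obj C. \<forall>e\<in>carrier (BObj F X Z). \<exists>g\<in>mor C A Z. push C F X g m = e)"

text \<open>
  The sequence \<open>C(G, -) \<rightarrow> C(A, -) \<rightarrow> F(X, -) \<rightarrow> 0\<close> given by \<open>h \<mapsto> h \<cdot> f\<close> and \<open>g \<mapsto> g\<^sub>* m\<close>
  is exact.
\<close>

definition presents ::
  "('r, 'o, 'm) lincat \<Rightarrow> ('r, 'o, 'm, 'a) bifun \<Rightarrow> 'o \<Rightarrow> 'o \<Rightarrow> 'a \<Rightarrow> 'o \<Rightarrow> 'm \<Rightarrow> bool" where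
  "presents C F X A m G f \<longleftrightarrow> generates C F X A m \<and> G \<in> Obj C \<and> f \<in> mor C A G \<and>
    (\<forall>Z\<in>Obj C. \<forall>g\<in>mor C A Z.
      push C F X g m = \<zero>\<^bsub>BObj F X Z\<^esub> \<longleftrightarrow> (\<exists>h\<in>mor C G Z. g = h \<cdot>\<^bsub>C\<^esub> f))"

context linear_category
begin

text \<open>
  \<^const>\<open>cokernel_functor\<close> unfolded for representable functors: the objects are quotients of Hom modules, and
  naturality of \<open>\<eta>\<close> makes composition well defined on cosets.
\<close>

lemma representable_cokernel:
  assumes \<eta>: "nat_trans R C (representable C Y) (representable C A) \<eta>"
    and Y: "Y \<in> Obj C" and A: "A \<in> Obj C"
  shows cokernel_quotient: "Z \<in> Obj C \<Longrightarrow> module_quotient R (Hom C A Z) (\<eta> Z ` mor C Y Z)"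
    and cokernel_obj: "FObj (cokernel_functor C (representable C Y) (representable C A) \<eta>) Z =
      quotient_module (Hom C A Z) (\<eta> Z ` mor C Y Z)"
    and cokernel_map: "\<lbrakk>Z \<in> Obj C; W \<in> Obj C; k \<in> mor C Z W; g \<in> mor C A Z\<rbrakk> \<Longrightarrow>
      FMap (cokernel_functor C (representable C Y) (representable C A) \<eta>) k
        ((\<eta> Z ` mor C Y Z) +>\<^bsub>Hom C A Z\<^esub> g) = (\<eta> W ` mor C Y W) +>\<^bsub>Hom C A W\<^esub> (k \<cdot> g)"
proof -
  have h: "\<eta> Z \<in> mod_hom R (Hom C Y Z) (Hom C A Z)" if "Z \<in> Obj C" for Z
    using \<eta> that by (simp add: nat_trans_def representable_def)
  have nat: "\<eta> W (k \<cdot> g) = k \<cdot> \<eta> Z g" if "Z \<in> Obj C" "W \<in> Obj C" "k \<in> mor C Z W" "g \<in> mor C Y Z" for Z W k g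
    using \<eta> that by (simp add: nat_trans_def representable_def)
  show q: "module_quotient R (Hom C A Z) (\<eta> Z ` mor C Y Z)" if "Z \<in> Obj C" for Z
    unfolding module_quotient_def
    using mod_hom_image_submodule[OF Hom_module[OF Y that] Hom_module[OF A that] h[OF that]]
      Hom_module[OF A that] by simp
  show "FObj (cokernel_functor C (representable C Y) (representable C A) \<eta>) Z =
      quotient_module (Hom C A Z) (\<eta> Z ` mor C Y Z)"
    by (simp add: cokernel_functor_def representable_def)
  assume Z: "Z \<in> Obj C" and W: "W \<in> Obj C" and k: "k \<in> mor C Z W" and g: "g \<in> mor C A Z"
  have "k \<cdot> x \<in> \<eta> W ` mor C Y W" if "x \<in> \<eta> Z ` mor C Y Z" for x
    using that Comp_mor[OF Y Z W _ k] nat[OF Z W k, symmetric] by blast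
  from quotient_map_coset[OF q[OF Z] q[OF W] Comp_linear_right[OF A Z W k] this g]
  show "FMap (cokernel_functor C (representable C Y) (representable C A) \<eta>) k
        ((\<eta> Z ` mor C Y Z) +>\<^bsub>Hom C A Z\<^esub> g) = (\<eta> W ` mor C Y W) +>\<^bsub>Hom C A W\<^esub> (k \<cdot> g)"
    by (simp add: cokernel_functor_def representable_def CodI[OF k Z W])
qed

lemma finitely_presented_imp_generated:
  assumes "finitely_presented R C M"
  shows "finitely_generated R C M"
proof -
  obtain A Y \<eta> \<theta> where A: "A \<in> Obj C" and Y: "Y \<in> Obj C"
    and \<eta>: "nat_trans R C (representable C Y) (representable C A) \<eta>"
    and \<theta>: "nat_iso R C (cokernel_functor C (representable C Y) (representable C A) \<eta>) M \<theta>"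
    using assms unfolding finitely_presented_def by blast
  note coker = representable_cokernel[OF \<eta> Y A]
  let ?K = "cokernel_functor C (representable C Y) (representable C A) \<eta>"
  let ?p = "\<lambda>Z g. (\<eta> Z ` mor C Y Z) +>\<^bsub>Hom C A Z\<^esub> g"
  have \<theta>_hom: "\<theta> Z \<in> mod_hom R (quotient_module (Hom C A Z) (\<eta> Z ` mor C Y Z)) (FObj M Z)" if "Z \<in> Obj C" for Z
    using \<theta> that by (simp add: nat_iso_def nat_trans_def coker(2))
  have "nat_epi R C (representable C A) M (\<lambda>Z g. \<theta> Z (?p Z g))"
    unfolding nat_epi_def nat_trans_def
  proof (intro conjI ballI)
    fix Z assume Z: "Z \<in> Obj C"
    interpret Q: module_quotient R "Hom C A Z" "\<eta> Z ` mor C Y Z" using Z by (rule coker(1))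
    show "(\<lambda>g. \<theta> Z (?p Z g)) \<in> mod_hom R (FObj (representable C A) Z) (FObj M Z)"
      using mod_hom_comp[OF Q.quotient_proj \<theta>_hom[OF Z]] by (simp add: representable_def)
    have "?p Z ` mor C A Z = carrier (FObj ?K Z)"
      unfolding coker(2) by (auto intro: Q.coset_in elim: Q.quotient_cases)
    moreover have "\<theta> Z ` carrier (FObj ?K Z) = carrier (FObj M Z)"
      using \<theta> Z by (simp add: nat_iso_def bij_betw_def)
    ultimately show "(\<lambda>g. \<theta> Z (?p Z g)) ` carrier (FObj (representable C A) Z) = carrier (FObj M Z)"
      by (simp add: representable_def flip: image_image)
  next
    fix Z W k g assume Z: "Z \<in> Obj C" and W: "W \<in> Obj C" and k: "k \<in> mor C Z W"
      and "g \<in> carrier (FObj (representable C A) Z)"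
    then have g: "g \<in> mor C A Z" by (simp add: representable_def)
    interpret Q: module_quotient R "Hom C A Z" "\<eta> Z ` mor C Y Z" using Z by (rule coker(1))
    have "\<theta> W (FMap ?K k (?p Z g)) = FMap M k (\<theta> Z (?p Z g))"
      using \<theta> Z W k Q.coset_in[OF g] by (simp add: nat_iso_def nat_trans_def coker(2))
    then have "\<theta> W (?p W (k \<cdot> g)) = FMap M k (\<theta> Z (?p Z g))"
      unfolding coker(3)[OF Z W k g] .
    then show "\<theta> W (?p W (FMap (representable C A) k g)) = FMap M k (\<theta> Z (?p Z g))"
      by (simp add: representable_def)
  qed
  with A show ?thesis unfolding finitely_generated_def by blast
qed

end

context linear_bifunctor
begin

text \<open>
  The Yoneda lemma: take \<open>m\<close> to be the image of the identity of \<open>A\<close>, and conversely send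
  \<open>g\<close> to \<open>g\<^sub>* m\<close>.
\<close>

lemma finitely_generated_iff:
  assumes X: "X \<in> Obj C"
  shows "finitely_generated R C (covariant_part C F X) \<longleftrightarrow> (\<exists>A m. generates C F X A m)"
proof
  assume "finitely_generated R C (covariant_part C F X)"
  then obtain A \<eta> where A: "A \<in> Obj C" and \<eta>: "nat_epi R C (representable C A) (covariant_part C F X) \<eta>"
    unfolding finitely_generated_def by blast
  have nat: "\<eta> Z (g \<cdot> e) = push C F X g (\<eta> Y e)"
    if "Y \<in> Obj C" "Z \<in> Obj C" "g \<in> mor C Y Z" "e \<in> mor C A Y" for Y Z g e
    using \<eta> that by (simp add: nat_epi_def nat_trans_def representable_def covariant_part_def)
  have hom: "\<eta> A \<in> mod_hom R (Hom C A A) (BObj F X A)"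
    using \<eta> A by (simp add: nat_epi_def nat_trans_def representable_def covariant_part_def)
  have surj: "\<eta> Z ` mor C A Z = carrier (BObj F X Z)" if "Z \<in> Obj C" for Z
    using \<eta> that by (simp add: nat_epi_def representable_def covariant_part_def)
  have "\<exists>g\<in>mor C A Z. push C F X g (\<eta> A (Ident C A)) = e"
    if Z: "Z \<in> Obj C" and e: "e \<in> carrier (BObj F X Z)" for Z e
  proof -
    obtain g where g: "g \<in> mor C A Z" "e = \<eta> Z g" using surj[OF Z] e by auto
    then have "push C F X g (\<eta> A (Ident C A)) = e"
      using nat[OF A Z g(1) Ident_mor[OF A]] Ident_right[OF A Z g(1)] by simp
    with g(1) show ?thesis by blast
  qed
  then have "generates C F X A (\<eta> A (Ident C A))"
    unfolding generates_def using A mod_hom_closed[OF hom Ident_mor[OF A]] by blast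
  then show "\<exists>A m. generates C F X A m" by blast
next
  assume "\<exists>A m. generates C F X A m"
  then obtain A m where A: "A \<in> Obj C" and m: "m \<in> carrier (BObj F X A)"
    and gen: "\<And>Z e. \<lbrakk>Z \<in> Obj C; e \<in> carrier (BObj F X Z)\<rbrakk> \<Longrightarrow> \<exists>g\<in>mor C A Z. push C F X g m = e"
    unfolding generates_def by blast
  have "nat_epi R C (representable C A) (covariant_part C F X) (\<lambda>Z g. push C F X g m)"
    unfolding nat_epi_def nat_trans_def
  proof (intro conjI ballI)
    fix Z assume Z: "Z \<in> Obj C"
    show hom: "(\<lambda>g. push C F X g m) \<in> mod_hom R (FObj (representable C A) Z) (FObj (covariant_part C F X) Z)"
      using BMap_linear_right[OF X X A Z Ident_mor[OF X] m] by (simp add: representable_def covariant_part_def)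
    show "(\<lambda>g. push C F X g m) ` carrier (FObj (representable C A) Z) = carrier (FObj (covariant_part C F X) Z)"
    proof
      show "(\<lambda>g. push C F X g m) ` carrier (FObj (representable C A) Z) \<subseteq> carrier (FObj (covariant_part C F X) Z)"
        using mod_hom_closed[OF hom] by blast
      show "carrier (FObj (covariant_part C F X) Z) \<subseteq> (\<lambda>g. push C F X g m) ` carrier (FObj (representable C A) Z)"
        using gen[OF Z] by (auto simp: representable_def covariant_part_def)
    qed
  next
    fix Z W k g assume "Z \<in> Obj C" "W \<in> Obj C" "k \<in> mor C Z W" "g \<in> carrier (FObj (representable C A) Z)"
    then show "push C F X (FMap (representable C A) k g) m = FMap (covariant_part C F X) k (push C F X g m)"
      using push_comp[OF X A _ _ _ _ m] by (simp add: representable_def covariant_part_def)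
  qed
  with A show "finitely_generated R C (covariant_part C F X)" unfolding finitely_generated_def by blast
qed

text \<open>
  The map \<open>g \<mapsto> g\<^sub>* m\<close> has the kernel \<open>{h \<cdot> f}\<close>, so it induces a bijection from the cokernel of
  \<open>h \<mapsto> h \<cdot> f\<close>.
\<close>

lemma presents_imp_finitely_presented:
  assumes X: "X \<in> Obj C" and pres: "presents C F X A m G f"
  shows "finitely_presented R C (covariant_part C F X)"
proof -
  have A: "A \<in> Obj C" and m: "m \<in> carrier (BObj F X A)" and G: "G \<in> Obj C" and f: "f \<in> mor C A G"
    and gen: "\<And>Z e. \<lbrakk>Z \<in> Obj C; e \<in> carrier (BObj F X Z)\<rbrakk> \<Longrightarrow> \<exists>g\<in>mor C A Z. push C F X g m = e"
    and ker: "\<And>Z g. \<lbrakk>Z \<in> Obj C; g \<in> mor C A Z\<rbrakk> \<Longrightarrow>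
      push C F X g m = \<zero>\<^bsub>BObj F X Z\<^esub> \<longleftrightarrow> g \<in> (\<lambda>h. h \<cdot> f) ` mor C G Z"
    using pres unfolding presents_def generates_def by blast+
  let ?\<eta> = "\<lambda>Z h. h \<cdot> f"
  have \<eta>: "nat_trans R C (representable C G) (representable C A) ?\<eta>"
    unfolding nat_trans_def representable_def
    using Comp_linear_left[OF A G _ f] Comp_assoc[OF A G _ _ f] by simp
  note coker = representable_cokernel[OF \<eta> G A]
  let ?H = "\<lambda>Z. ?\<eta> Z ` mor C G Z"
  have p: "(\<lambda>g. push C F X g m) \<in> mod_hom R (Hom C A Z) (BObj F X Z)" if "Z \<in> Obj C" for Z
    using BMap_linear_right[OF X X A that Ident_mor[OF X] m] .
  have "\<exists>K\<in>mod_hom R (quotient_module (Hom C A Z) (?H Z)) (BObj F X Z).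
      \<forall>g\<in>mor C A Z. K (?H Z +>\<^bsub>Hom C A Z\<^esub> g) = push C F X g m" if Z: "Z \<in> Obj C" for Z
  proof -
    interpret Q: module_quotient R "Hom C A Z" "?H Z" using Z by (rule coker(1))
    show ?thesis using ker[OF Z Q.submodule_carrier]
      by (intro Q.quotient_universal[OF BObj_module[OF X Z] p[OF Z]]) simp
  qed
  then obtain \<theta> where \<theta>: "\<And>Z. Z \<in> Obj C \<Longrightarrow> \<theta> Z \<in> mod_hom R (quotient_module (Hom C A Z) (?H Z)) (BObj F X Z)"
    and \<theta>p: "\<And>Z g. \<lbrakk>Z \<in> Obj C; g \<in> mor C A Z\<rbrakk> \<Longrightarrow> \<theta> Z (?H Z +>\<^bsub>Hom C A Z\<^esub> g) = push C F X g m"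
    by (metis (no_types, lifting))
  have "nat_iso R C (cokernel_functor C (representable C G) (representable C A) ?\<eta>) (covariant_part C F X) \<theta>"
    unfolding nat_iso_def nat_trans_def coker(2)
  proof (intro conjI ballI)
    fix Z assume Z: "Z \<in> Obj C"
    show "\<theta> Z \<in> mod_hom R (quotient_module (Hom C A Z) (?H Z)) (FObj (covariant_part C F X) Z)"
      using \<theta>[OF Z] by (simp add: covariant_part_def)
    interpret Q: module_quotient R "Hom C A Z" "?H Z" using Z by (rule coker(1))
    interpret N: module R "BObj F X Z" using X Z by (rule BObj_module)
    show "bij_betw (\<theta> Z) (carrier (quotient_module (Hom C A Z) (?H Z))) (carrier (FObj (covariant_part C F X) Z))"
      unfolding bij_betw_def
    proof
      show "inj_on (\<theta> Z) (carrier (quotient_module (Hom C A Z) (?H Z)))"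
      proof (rule inj_onI, elim Q.quotient_cases)
        fix c d g h assume cd: "\<theta> Z c = \<theta> Z d" "c = ?H Z +>\<^bsub>Hom C A Z\<^esub> g" "d = ?H Z +>\<^bsub>Hom C A Z\<^esub> h"
          and g: "g \<in> mor C A Z" and h: "h \<in> mor C A Z"
        have "push C F X (g \<ominus>\<^bsub>Hom C A Z\<^esub> h) m = \<zero>\<^bsub>BObj F X Z\<^esub>"
          using cd \<theta>p[OF Z] g h mod_hom_closed[OF p[OF Z]]
          by (simp add: mod_hom_minus[OF Hom_module[OF A Z] BObj_module[OF X Z] p[OF Z] g h] N.minus_zero_iff)
        then have "g \<ominus>\<^bsub>Hom C A Z\<^esub> h \<in> ?H Z" using ker[OF Z] g h by blast
        then show "c = d" using cd g h Q.coset_eq_iff by simp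
      qed
      show "\<theta> Z ` carrier (quotient_module (Hom C A Z) (?H Z)) = carrier (FObj (covariant_part C F X) Z)"
      proof
        show "\<theta> Z ` carrier (quotient_module (Hom C A Z) (?H Z)) \<subseteq> carrier (FObj (covariant_part C F X) Z)"
          using mod_hom_closed[OF \<theta>[OF Z]] by (auto simp: covariant_part_def)
        show "carrier (FObj (covariant_part C F X) Z) \<subseteq> \<theta> Z ` carrier (quotient_module (Hom C A Z) (?H Z))"
        proof
          fix e assume "e \<in> carrier (FObj (covariant_part C F X) Z)"
          then obtain g where g: "g \<in> mor C A Z" "push C F X g m = e"
            using gen[OF Z] by (auto simp: covariant_part_def)
          then have "e = \<theta> Z (?H Z +>\<^bsub>Hom C A Z\<^esub> g)" by (simp add: \<theta>p[OF Z])
          then show "e \<in> \<theta> Z ` carrier (quotient_module (Hom C A Z) (?H Z))"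
            using Q.coset_in[OF g(1)] by (rule image_eqI)
        qed
      qed
    qed
  next
    fix Z W k c assume Z: "Z \<in> Obj C" and W: "W \<in> Obj C" and k: "k \<in> mor C Z W"
      and c: "c \<in> carrier (quotient_module (Hom C A Z) (?H Z))"
    interpret Q: module_quotient R "Hom C A Z" "?H Z" using Z by (rule coker(1))
    obtain g where g: "g \<in> mor C A Z" "c = ?H Z +>\<^bsub>Hom C A Z\<^esub> g" using c by (rule Q.quotient_cases)
    show "\<theta> W (FMap (cokernel_functor C (representable C G) (representable C A) ?\<eta>) k c) =
        FMap (covariant_part C F X) k (\<theta> Z c)"
      unfolding g(2) coker(3)[OF Z W k g(1)] \<theta>p[OF Z g(1)] \<theta>p[OF W Comp_mor[OF A Z W g(1) k]]
      using push_comp[OF X A Z W g(1) k m] by (simp add: covariant_part_def)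
  qed
  with A G \<eta> show ?thesis unfolding finitely_presented_def by blast
qed

end

context transported_bifunctor
begin

lemma push_F':
  "\<lbrakk>X \<in> Obj C; A \<in> Obj C; Z \<in> Obj C; g \<in> mor C A Z; m \<in> carrier (BObj F X A)\<rbrakk> \<Longrightarrow>
    push C F' X g (h X A m) = h X Z (push C F X g m)"
  by (simp add: F'_map Ident_mor)

lemma generates_transport:
  assumes X: "X \<in> Obj C" and m: "m \<in> carrier (BObj F X A)"
  shows "generates C F' X A (h X A m) \<longleftrightarrow> generates C F X A m"
proof -
  have iff: "push C F' X g (h X A m) = h X Z e \<longleftrightarrow> push C F X g m = e"
    if "A \<in> Obj C" "Z \<in> Obj C" "g \<in> mor C A Z" "e \<in> carrier (BObj F X Z)" for Z g e
    using push_F'[OF X that(1-3) m] h_inj[OF X that(2)]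
      mod_hom_closed[OF push_hom[OF X that(1-3)] m] that(4) by (auto simp: inj_on_def)
  have "(\<forall>e\<in>carrier (BObj F' X Z). \<exists>g\<in>mor C A Z. push C F' X g (h X A m) = e) \<longleftrightarrow>
      (\<forall>e\<in>carrier (BObj F X Z). \<exists>g\<in>mor C A Z. push C F X g m = e)"
    if "A \<in> Obj C" "Z \<in> Obj C" for Z
    using iff[OF that] unfolding F'_obj transport_carrier by simp
  moreover have "h X A m \<in> carrier (BObj F' X A)"
    using m unfolding F'_obj transport_carrier by (rule imageI)
  ultimately show ?thesis using m unfolding generates_def by blast
qed

lemma presents_transport:
  assumes X: "X \<in> Obj C" and pres: "presents C F X A m G f"
  shows "presents C F' X A (h X A m) G f"
proof -
  have A: "A \<in> Obj C" and m: "m \<in> carrier (BObj F X A)"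
    using pres unfolding presents_def generates_def by blast+
  have "push C F' X g (h X A m) = \<zero>\<^bsub>BObj F' X Z\<^esub> \<longleftrightarrow> push C F X g m = \<zero>\<^bsub>BObj F X Z\<^esub>"
    if "Z \<in> Obj C" "g \<in> mor C A Z" for Z g
    using that A X m by (simp add: push_F' h_zero_iff mod_hom_closed[OF push_hom])
  then show ?thesis using pres generates_transport[OF X m] by (simp add: presents_def)
qed

end

context linear_category
begin

text \<open>
  The functor \<open>C(X, -)\<close> is free on the identity; the zero endomorphism serves as trivial relation.
\<close>

lemma presents_Hom:
  assumes X: "X \<in> Obj C"
  shows "presents C (Hom_bifun C) X X (Ident C X) X \<zero>\<^bsub>Hom C X X\<^esub>"
proof -
  have push: "push C (Hom_bifun C) X g (Ident C X) = g" if "Z \<in> Obj C" "g \<in> mor C X Z" for Z g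
    using X that by (simp add: Hom_bifun_def Ident_right[OF X])
  have "g = \<zero>\<^bsub>Hom C X Z\<^esub> \<longleftrightarrow> (\<exists>h\<in>mor C X Z. g = h \<cdot> \<zero>\<^bsub>Hom C X X\<^esub>)" if Z: "Z \<in> Obj C" for Z g
    using Comp_zero_right[OF X X Z] Hom_zero[OF X Z] by metis
  moreover have "BObj (Hom_bifun C) = Hom C" by (simp add: Hom_bifun_def)
  ultimately show ?thesis
    unfolding presents_def generates_def using X push by (simp add: Ident_mor Hom_zero)
qed

end

section \<open>Right exactness of the coend\<close>

context bifunctor_pair
begin

text \<open>
  If \<open>e = a\<^sub>*\<delta>\<close> then \<open>[u \<otimes> e] = [a\<^sup>*u \<otimes> \<delta>]\<close>, so all classes can be moved to the object \<open>A\<close> and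
  the second factor \<open>\<delta>\<close>.
\<close>

lemma coend_generator:
  assumes X: "X \<in> Obj C" and gen: "generates C E X A \<delta>" and Z: "Z \<in> Obj C"
    and c: "c \<in> carrier (coend_obj X Z)"
  shows "\<exists>u\<in>carrier (BObj P A Z). c = pure X Z A u \<delta>"
proof -
  interpret coend_at R C P E X Z by (rule coend_atI[OF X Z])
  have A: "A \<in> Obj C" and \<delta>: "\<delta> \<in> carrier (BObj E X A)"
    and g: "\<And>M e. \<lbrakk>M \<in> Obj C; e \<in> carrier (BObj E X M)\<rbrakk> \<Longrightarrow> \<exists>a\<in>mor C A M. push C E X a \<delta> = e"
    using gen unfolding generates_def by blast+
  interpret PA: module R "BObj P A Z" by (rule P.BObj_module[OF A Z])
  note h = bilinear_left[OF elem_bilinear[OF A] \<delta>]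
  from c show ?thesis
  proof (induction rule: coend_induct)
    case zero
    show ?case by (rule bexI[of _ "\<zero>\<^bsub>BObj P A Z\<^esub>"])
        (simp_all add: mod_hom_zero[OF PA.module_axioms CC_module h])
  next
    case (add c d)
    then show ?case using mod_hom_add[OF h] PA.add.m_closed by metis
  next
    case (elem M u e)
    obtain a where a: "a \<in> mor C A M" "push C E X a \<delta> = e" using g elem by blast
    have "\<kappa> M u e = \<kappa> A (pull C P Z a u) \<delta>"
      using elem_dinatural[OF A elem(1) a(1) elem(2) \<delta>] a(2) by simp
    then show ?case using mod_hom_closed[OF P.pull_hom[OF elem(1) A Z a(1)] elem(2)] by blast
  qed
qed

text \<open>
  If \<open>u = x\<^sup>*v\<close> then \<open>[u \<otimes> \<delta>] = [v \<otimes> x\<^sub>*\<delta>] = 0\<close>. For the converse, a homomorphism from the coend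
  to \<open>P(A, Z) / x\<^sup>*P(G, Z)\<close> is constructed that sends \<open>[u \<otimes> a\<^sub>*\<delta>]\<close> to the coset of \<open>a\<^sup>*u\<close>. It detects
  whether \<open>u\<close> lies in the image of \<open>x\<^sup>*\<close>.
\<close>

lemma coend_kernel:
  assumes X: "X \<in> Obj C" and pres: "presents C E X A \<delta> G x" and Z: "Z \<in> Obj C"
    and u: "u \<in> carrier (BObj P A Z)"
  shows "pure X Z A u \<delta> = \<zero>\<^bsub>coend_obj X Z\<^esub> \<longleftrightarrow> (\<exists>v\<in>carrier (BObj P G Z). u = pull C P Z x v)"
proof
  interpret coend_at R C P E X Z by (rule coend_atI[OF X Z])
  have A: "A \<in> Obj C" and \<delta>: "\<delta> \<in> carrier (BObj E X A)" and G: "G \<in> Obj C" and x: "x \<in> mor C A G"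
    and gen: "\<And>M e. \<lbrakk>M \<in> Obj C; e \<in> carrier (BObj E X M)\<rbrakk> \<Longrightarrow> \<exists>a\<in>mor C A M. push C E X a \<delta> = e"
    and ker: "\<And>M a. \<lbrakk>M \<in> Obj C; a \<in> mor C A M\<rbrakk> \<Longrightarrow>
      push C E X a \<delta> = \<zero>\<^bsub>BObj E X M\<^esub> \<longleftrightarrow> (\<exists>h\<in>mor C G M. a = h \<cdot> x)"
    using pres unfolding presents_def generates_def by blast+
  note PA = P.BObj_module[OF A Z] and PG = P.BObj_module[OF G Z]
  note xh = P.pull_hom[OF G A Z x]
  {
    assume "\<exists>v\<in>carrier (BObj P G Z). u = pull C P Z x v"
    then obtain v where v: "v \<in> carrier (BObj P G Z)" "u = pull C P Z x v" by blast
    have "x = Ident C G \<cdot> x" using Ident_left[OF A G x] by simp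
    then have x0: "push C E X x \<delta> = \<zero>\<^bsub>BObj E X G\<^esub>" using ker[OF G x] Ident_mor[OF G] by blast
    have "\<kappa> A u \<delta> = \<kappa> G v \<zero>\<^bsub>BObj E X G\<^esub>"
      using elem_dinatural[OF A G x v(1) \<delta>] v(2) x0 by simp
    also have "\<dots> = \<zero>\<^bsub>CC\<^esub>"
      by (rule mod_hom_zero[OF E.BObj_module[OF X G] CC_module bilinear_right[OF elem_bilinear[OF G] v(1)]])
    finally show "\<kappa> A u \<delta> = \<zero>\<^bsub>CC\<^esub>" .
  }
  let ?I = "pull C P Z x ` carrier (BObj P G Z)"
  interpret V: module_quotient R "BObj P A Z" ?I
    unfolding module_quotient_def using mod_hom_image_submodule[OF PG PA xh] PA by blast
  let ?N = "quotient_module (BObj P A Z) ?I"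
  let ?\<pi> = "\<lambda>u. ?I +>\<^bsub>BObj P A Z\<^esub> u"
  note N = V.quotient_is_module and \<pi> = V.quotient_proj
  interpret N: module R ?N by (rule N)
  \<comment> \<open>The choice of \<open>a\<close> does not matter: two choices differ by a morphism that factors through \<open>x\<close>.\<close>
  define \<phi> where "\<phi> M u e = ?\<pi> (pull C P Z (SOME a. a \<in> mor C A M \<and> push C E X a \<delta> = e) u)" for M u e
  have \<phi>: "\<phi> M u (push C E X a \<delta>) = ?\<pi> (pull C P Z a u)"
    if M: "M \<in> Obj C" and u: "u \<in> carrier (BObj P M Z)" and a: "a \<in> mor C A M" for M u a
  proof -
    define b where "b = (SOME b. b \<in> mor C A M \<and> push C E X b \<delta> = push C E X a \<delta>)"
    have "b \<in> mor C A M \<and> push C E X b \<delta> = push C E X a \<delta>"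
      unfolding b_def by (rule someI[of _ a]) (simp add: a)
    then have b: "b \<in> mor C A M" "push C E X b \<delta> = push C E X a \<delta>" by auto
    interpret H: module R "Hom C A M" by (rule Hom_module[OF A M])
    interpret EM: module R "BObj E X M" by (rule E.BObj_module[OF X M])
    note r = E.BMap_linear_right[OF X X A M Ident_mor[OF X] \<delta>]
    have "push C E X (b \<ominus>\<^bsub>Hom C A M\<^esub> a) \<delta> = \<zero>\<^bsub>BObj E X M\<^esub>"
      using mod_hom_minus[OF H.module_axioms EM.module_axioms r b(1) a] b(2) mod_hom_closed[OF r a]
      by (simp add: EM.minus_zero_iff)
    then obtain k where k: "k \<in> mor C G M" "b \<ominus>\<^bsub>Hom C A M\<^esub> a = k \<cdot> x"
      using ker[OF M H.minus_closed[OF b(1) a]] by blast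
    note l = P.BMap_linear_left[OF M A Z Z Ident_mor[OF Z] u]
    have "pull C P Z b u \<ominus>\<^bsub>BObj P A Z\<^esub> pull C P Z a u = pull C P Z (k \<cdot> x) u"
      using mod_hom_minus[OF H.module_axioms PA l b(1) a] k(2) by simp
    also have "\<dots> = pull C P Z x (pull C P Z k u)" by (rule P.pull_comp[OF M G A Z k(1) x u])
    also have "\<dots> \<in> ?I" by (rule imageI) (rule mod_hom_closed[OF P.pull_hom[OF M G Z k(1)] u])
    finally show ?thesis
      unfolding \<phi>_def b_def[symmetric]
      using V.coset_eq_iff[OF mod_hom_closed[OF l b(1)] mod_hom_closed[OF l a]] by simp
  qed
  have "\<exists>K\<in>mod_hom R CC ?N. \<forall>M\<in>Obj C. \<forall>u\<in>carrier (BObj P M Z). \<forall>e\<in>carrier (BObj E X M).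
    K (\<kappa> M u e) = \<phi> M u e"
  proof (rule coend_universal[OF N])
    fix M assume M: "M \<in> Obj C"
    interpret H: module R "Hom C A M" by (rule Hom_module[OF A M])
    note r = E.BMap_linear_right[OF X X A M Ident_mor[OF X] \<delta>]
    show "bilinear R (BObj P M Z) (BObj E X M) ?N (\<phi> M)"
      unfolding bilinear_def
    proof (intro conjI ballI)
      fix e assume "e \<in> carrier (BObj E X M)"
      then obtain a where a: "a \<in> mor C A M" "push C E X a \<delta> = e" using gen[OF M] by blast
      show "(\<lambda>u. \<phi> M u e) \<in> mod_hom R (BObj P M Z) ?N"
        by (rule mod_hom_cong[OF P.BObj_module[OF M Z] mod_hom_comp[OF P.pull_hom[OF M A Z a(1)] \<pi>]])
          (use \<phi>[OF M _ a(1)] a(2) in simp)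
    next
      fix u assume u: "u \<in> carrier (BObj P M Z)"
      note l = mod_hom_comp[OF P.BMap_linear_left[OF M A Z Z Ident_mor[OF Z] u] \<pi>]
      note \<phi>u = \<phi>[OF M u]
      show "\<phi> M u \<in> mod_hom R (BObj E X M) ?N"
      proof (rule mod_homI)
        fix e assume "e \<in> carrier (BObj E X M)"
        then obtain a where a: "a \<in> mor C A M" "e = push C E X a \<delta>" using gen[OF M] by blast
        show "\<phi> M u e \<in> carrier ?N" unfolding a(2) \<phi>u[OF a(1)] by (rule mod_hom_closed[OF l a(1)])
      next
        fix e e' assume "e \<in> carrier (BObj E X M)" "e' \<in> carrier (BObj E X M)"
        then obtain a b where a: "a \<in> mor C A M" "e = push C E X a \<delta>" and b: "b \<in> mor C A M" "e' = push C E X b \<delta>"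
          using gen[OF M] by metis
        have "e \<oplus>\<^bsub>BObj E X M\<^esub> e' = push C E X (a \<oplus>\<^bsub>Hom C A M\<^esub> b) \<delta>"
          using mod_hom_add[OF r a(1) b(1)] a(2) b(2) by simp
        then show "\<phi> M u (e \<oplus>\<^bsub>BObj E X M\<^esub> e') = \<phi> M u e \<oplus>\<^bsub>?N\<^esub> \<phi> M u e'"
          using mod_hom_add[OF l a(1) b(1)] by (simp add: a b \<phi>u H.add.m_closed)
      next
        fix s e assume s: "s \<in> carrier R" and "e \<in> carrier (BObj E X M)"
        then obtain a where a: "a \<in> mor C A M" "e = push C E X a \<delta>" using gen[OF M] by blast
        have "s \<odot>\<^bsub>BObj E X M\<^esub> e = push C E X (s \<odot>\<^bsub>Hom C A M\<^esub> a) \<delta>"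
          using mod_hom_smult[OF r s a(1)] a(2) by simp
        then show "\<phi> M u (s \<odot>\<^bsub>BObj E X M\<^esub> e) = s \<odot>\<^bsub>?N\<^esub> \<phi> M u e"
          using mod_hom_smult[OF l s a(1)] by (simp add: a \<phi>u s)
      qed
    qed
  next
    fix M M' f u e
    assume M: "M \<in> Obj C" "M' \<in> Obj C" "f \<in> mor C M M'" and u: "u \<in> carrier (BObj P M' Z)"
      and "e \<in> carrier (BObj E X M)"
    then obtain a where a: "a \<in> mor C A M" "e = push C E X a \<delta>" using gen[OF M(1)] by blast
    have "\<phi> M (pull C P Z f u) e = ?\<pi> (pull C P Z a (pull C P Z f u))"
      unfolding a(2) by (rule \<phi>[OF M(1) mod_hom_closed[OF P.pull_hom[OF M(2,1) Z M(3)] u] a(1)])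
    also have "\<dots> = ?\<pi> (pull C P Z (f \<cdot> a) u)"
      by (simp add: P.pull_comp[OF M(2,1) A Z M(3) a(1) u])
    also have "\<dots> = \<phi> M' u (push C E X (f \<cdot> a) \<delta>)"
      by (rule \<phi>[OF M(2) u Comp_mor[OF A M(1,2) a(1) M(3)], symmetric])
    also have "\<dots> = \<phi> M' u (push C E X f e)"
      by (simp add: a(2) E.push_comp[OF X A M(1,2) a(1) M(3) \<delta>])
    finally show "\<phi> M (pull C P Z f u) e = \<phi> M' u (push C E X f e)" .
  qed
  then obtain K where K: "K \<in> mod_hom R CC ?N" and Kp: "K (\<kappa> A u \<delta>) = \<phi> A u \<delta>"
    using A u \<delta> by blast
  have "push C E X (Ident C A) \<delta> = \<delta>" by (rule E.BMap_Ident[OF X A \<delta>])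
  then have "\<phi> A u \<delta> = ?\<pi> u"
    using \<phi>[OF A u Ident_mor[OF A]] P.BMap_Ident[OF A Z u] by simp
  moreover assume "\<kappa> A u \<delta> = \<zero>\<^bsub>CC\<^esub>"
  ultimately have "?\<pi> u = \<zero>\<^bsub>?N\<^esub>" using Kp mod_hom_zero[OF CC_module N K] by simp
  then show "\<exists>v\<in>carrier (BObj P G Z). u = pull C P Z x v" using V.quotient_zero_iff[OF u] by blast
qed

text \<open>
  Write \<open>x\<^sup>*m' = t\<^sub>*m\<close> with \<open>t : B \<rightarrow> B'\<close>. Then \<open>g\<^sub>*[m \<otimes> \<delta>] = 0\<close> means that \<open>g\<^sub>*m = x\<^sup>*k\<^sub>*m' = (k \<cdot> t)\<^sub>*m\<close>
  for some \<open>k\<close>, that is, \<open>g - k \<cdot> t\<close> factors through \<open>f\<close>. So the relation is the map from \<open>B\<close> to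
  the biproduct of \<open>D\<close> and \<open>B'\<close> with components \<open>f\<close> and \<open>t\<close>.
\<close>

lemma presents_coend:
  assumes X: "X \<in> Obj C" and E: "presents C E X A \<delta> G x"
    and PA: "presents C P A B m D f" and PG: "generates C P G B' m'"
    and bip: "is_biproduct C D B' Q i j p q"
  shows "\<exists>r. presents C (coend_bifun R C P E) X B (pure X B A m \<delta>) Q r"
proof -
  have A: "A \<in> Obj C" and \<delta>: "\<delta> \<in> carrier (BObj E X A)" and G: "G \<in> Obj C" and x: "x \<in> mor C A G"
    and genE: "generates C E X A \<delta>"
    using E unfolding presents_def generates_def by blast+
  have B: "B \<in> Obj C" and m: "m \<in> carrier (BObj P A B)" and D: "D \<in> Obj C" and f: "f \<in> mor C B D"
    and genA: "\<And>Z e. \<lbrakk>Z \<in> Obj C; e \<in> carrier (BObj P A Z)\<rbrakk> \<Longrightarrow> \<exists>g\<in>mor C B Z. push C P A g m = e"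
    and kerA: "\<And>Z g. \<lbrakk>Z \<in> Obj C; g \<in> mor C B Z\<rbrakk> \<Longrightarrow>
      push C P A g m = \<zero>\<^bsub>BObj P A Z\<^esub> \<longleftrightarrow> (\<exists>h\<in>mor C D Z. g = h \<cdot> f)"
    using PA unfolding presents_def generates_def by blast+
  have B': "B' \<in> Obj C" and m': "m' \<in> carrier (BObj P G B')"
    and genG: "\<And>Z e. \<lbrakk>Z \<in> Obj C; e \<in> carrier (BObj P G Z)\<rbrakk> \<Longrightarrow> \<exists>g\<in>mor C B' Z. push C P G g m' = e"
    using PG unfolding generates_def by blast+
  have Q: "Q \<in> Obj C" using bip by (simp add: is_biproduct_def)
  obtain t where t: "t \<in> mor C B B'" "push C P A t m = pull C P B' x m'"
    using genA[OF B' mod_hom_closed[OF P.pull_hom[OF G A B' x] m']] by blast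
  let ?r = "i \<cdot> f \<oplus>\<^bsub>Hom C B Q\<^esub> j \<cdot> t"
  have push: "push C (coend_bifun R C P E) X g (pure X B A m \<delta>) = pure X Z A (push C P A g m) \<delta>"
    if "Z \<in> Obj C" "g \<in> mor C B Z" for Z g
    using coend_BMap_elem[OF X X B that(1) Ident_mor[OF X] that(2) A m \<delta>] E.BMap_Ident[OF X A \<delta>] by simp
  have gen: "generates C (coend_bifun R C P E) X B (pure X B A m \<delta>)"
    unfolding generates_def
  proof (intro conjI ballI B)
    show "pure X B A m \<delta> \<in> carrier (coend_obj X B)"
      by (rule coend_at.elem_in[OF coend_atI[OF X B] A m \<delta>])
    fix Z c assume Z: "Z \<in> Obj C" and c: "c \<in> carrier (coend_obj X Z)"
    obtain u where u: "u \<in> carrier (BObj P A Z)" "c = pure X Z A u \<delta>"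
      using coend_generator[OF X genE Z c] by blast
    obtain g where "g \<in> mor C B Z" "push C P A g m = u" using genA[OF Z u(1)] by blast
    then show "\<exists>g\<in>mor C B Z. push C (coend_bifun R C P E) X g (pure X B A m \<delta>) = c"
      using push[OF Z] u(2) by blast
  qed
  have "push C (coend_bifun R C P E) X g (pure X B A m \<delta>) = \<zero>\<^bsub>coend_obj X Z\<^esub> \<longleftrightarrow>
      (\<exists>w\<in>mor C Q Z. g = w \<cdot> ?r)" if Z: "Z \<in> Obj C" and g: "g \<in> mor C B Z" for Z g
  proof -
    interpret H: module R "Hom C B Z" by (rule Hom_module[OF B Z])
    interpret PAZ: module R "BObj P A Z" by (rule P.BObj_module[OF A Z])
    note l = P.BMap_linear_right[OF A A B Z Ident_mor[OF A] m]
    have xm: "pull C P Z x (push C P G k m') = push C P A (k \<cdot> t) m" if k: "k \<in> mor C B' Z" for k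
      using P.push_pull[OF G A B' Z x k m'] t(2) P.push_comp[OF A B B' Z t(1) k m] by simp
    have "push C (coend_bifun R C P E) X g (pure X B A m \<delta>) = \<zero>\<^bsub>coend_obj X Z\<^esub> \<longleftrightarrow>
        (\<exists>v\<in>carrier (BObj P G Z). push C P A g m = pull C P Z x v)"
      unfolding push[OF Z g] by (rule coend_kernel[OF X E Z mod_hom_closed[OF l g]])
    also have "\<dots> \<longleftrightarrow> (\<exists>k\<in>mor C B' Z. push C P A g m = pull C P Z x (push C P G k m'))"
      using genG[OF Z] mod_hom_closed[OF P.push_hom[OF G B' Z] m'] by metis
    also have "\<dots> \<longleftrightarrow> (\<exists>k\<in>mor C B' Z. push C P A g m = push C P A (k \<cdot> t) m)"
      by (simp add: xm cong: bex_cong)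
    also have "\<dots> \<longleftrightarrow> (\<exists>k\<in>mor C B' Z. \<exists>h\<in>mor C D Z. g = h \<cdot> f \<oplus>\<^bsub>Hom C B Z\<^esub> k \<cdot> t)"
    proof (rule bex_cong[OF refl])
      fix k assume k: "k \<in> mor C B' Z"
      note kt = Comp_mor[OF B B' Z t(1) k]
      have "push C P A g m = push C P A (k \<cdot> t) m \<longleftrightarrow>
          push C P A (g \<ominus>\<^bsub>Hom C B Z\<^esub> k \<cdot> t) m = \<zero>\<^bsub>BObj P A Z\<^esub>"
        using mod_hom_minus[OF H.module_axioms PAZ.module_axioms l g kt]
          mod_hom_closed[OF l g] mod_hom_closed[OF l kt] by (simp add: PAZ.minus_zero_iff)
      also have "\<dots> \<longleftrightarrow> (\<exists>h\<in>mor C D Z. g \<ominus>\<^bsub>Hom C B Z\<^esub> k \<cdot> t = h \<cdot> f)"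
        by (rule kerA[OF Z H.minus_closed[OF g kt]])
      also have "\<dots> \<longleftrightarrow> (\<exists>h\<in>mor C D Z. g = h \<cdot> f \<oplus>\<^bsub>Hom C B Z\<^esub> k \<cdot> t)"
        using Comp_mor[OF B D Z f] g kt by (simp add: H.minus_eq_iff cong: bex_cong)
      finally show "push C P A g m = push C P A (k \<cdot> t) m \<longleftrightarrow>
          (\<exists>h\<in>mor C D Z. g = h \<cdot> f \<oplus>\<^bsub>Hom C B Z\<^esub> k \<cdot> t)" .
    qed
    also have "\<dots> \<longleftrightarrow> (\<exists>w\<in>mor C Q Z. g = w \<cdot> ?r)"
      using biproduct_factor(2)[OF bip B Z f t(1)] by blast
    finally show ?thesis .
  qed
  then have "presents C (coend_bifun R C P E) X B (pure X B A m \<delta>) Q ?r"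
    unfolding presents_def using gen Q biproduct_factor(1)[OF bip B Q f t(1)] by blast
  then show ?thesis by blast
qed

end

section \<open>Extriangulated categories\<close>

context extriangulated_category
begin

lemma s_triangleD:
  assumes "s_triangle C E \<ss> A x B y D \<delta>"
  shows "A \<in> Obj C" "B \<in> Obj C" "D \<in> Obj C" "x \<in> mor C A B" "y \<in> mor C B D" "\<delta> \<in> carrier (BObj E D A)"
  using assms by (auto simp: s_triangle_def)

lemma realization_exists:
  assumes D: "D \<in> Obj C" and A: "A \<in> Obj C" and \<delta>: "\<delta> \<in> carrier (BObj E D A)"
  shows "\<exists>x B y. s_triangle C E \<ss> A x B y D \<delta>"
proof -
  obtain s where s: "s \<in> sequences C A D" "\<ss> D A \<delta> = seq_equiv C A D `` {s}"
    using realization_class[OF assms] by (rule quotientE)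
  then show ?thesis using assms by (cases s) (auto simp: s_triangle_def sequences_def)
qed

lemma push_zero:
  "\<lbrakk>D \<in> Obj C; A \<in> Obj C; A' \<in> Obj C; a \<in> mor C A A'\<rbrakk> \<Longrightarrow> push C E D a \<zero>\<^bsub>BObj E D A\<^esub> = \<zero>\<^bsub>BObj E D A'\<^esub>"
  by (rule mod_hom_zero[OF BObj_module BObj_module push_hom])

lemma pull_zero:
  "\<lbrakk>D \<in> Obj C; D' \<in> Obj C; A \<in> Obj C; c \<in> mor C D' D\<rbrakk> \<Longrightarrow> pull C E A c \<zero>\<^bsub>BObj E D A\<^esub> = \<zero>\<^bsub>BObj E D' A\<^esub>"
  by (rule mod_hom_zero[OF BObj_module BObj_module pull_hom])

lemma split_triangle:
  assumes "A \<in> Obj C" "D \<in> Obj C"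
  obtains B i j p q where "is_biproduct C A D B i j p q" "s_triangle C E \<ss> A i B q D \<zero>\<^bsub>BObj E D A\<^esub>"
  using biproducts[OF assms] realization_zero by blast

text \<open>
  The projection onto \<open>B\<close> of the split triangle on \<open>A\<close> and \<open>B\<close>, in the middle, and \<open>y\<close>, on the
  right, are compatible with the deflations. Completing them on the left to a morphism of triangles
  shows that \<open>y\<^sup>*\<delta>\<close> is the image of the zero extension.
\<close>

lemma pull_along_own_deflation:
  assumes t: "s_triangle C E \<ss> A x B y D \<delta>"
  shows "pull C E A y \<delta> = \<zero>\<^bsub>BObj E B A\<^esub>"
proof -
  note o = s_triangleD[OF t]
  obtain B' i j p q where b: "is_biproduct C A B B' i j p q" and t0: "s_triangle C E \<ss> A i B' q B \<zero>\<^bsub>BObj E B A\<^esub>"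
    using split_triangle[OF o(1,2)] .
  note o0 = s_triangleD[OF t0]
  obtain a where a: "a \<in> mor C A A" and eq: "push C E B a \<zero>\<^bsub>BObj E B A\<^esub> = pull C E A y \<delta>"
    using ET3_op[OF t0 t o0(5) o(5)] by blast
  then show ?thesis using push_zero[OF o(2,1,1) a] by simp
qed

lemma push_along_own_inflation:
  assumes t: "s_triangle C E \<ss> A x B y D \<delta>"
  shows "push C E D x \<delta> = \<zero>\<^bsub>BObj E D B\<^esub>"
proof -
  note o = s_triangleD[OF t]
  obtain B' i j p q where b: "is_biproduct C B D B' i j p q" and t0: "s_triangle C E \<ss> B i B' q D \<zero>\<^bsub>BObj E D B\<^esub>"
    using split_triangle[OF o(2,3)] .
  note o0 = s_triangleD[OF t0]
  obtain c where c: "c \<in> mor C D D" and eq: "push C E D x \<delta> = pull C E B c \<zero>\<^bsub>BObj E D B\<^esub>"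
    using ET3[OF t t0 o(4) o0(4)] by blast
  then show ?thesis using pull_zero[OF o(3,3,2) c] by simp
qed

text \<open>
  If \<open>a\<^sub>*\<delta> = 0\<close>, then \<open>a\<close> and the identity form a morphism from \<open>\<delta>\<close> to a split extension. The
  induced map of middle terms, followed by the retraction onto \<open>A'\<close>, extends \<open>a\<close> along \<open>x\<close>.
\<close>

lemma push_zero_iff_factors:
  assumes t: "s_triangle C E \<ss> A x B y D \<delta>" and A': "A' \<in> Obj C" and a: "a \<in> mor C A A'"
  shows "push C E D a \<delta> = \<zero>\<^bsub>BObj E D A'\<^esub> \<longleftrightarrow> (\<exists>h\<in>mor C B A'. a = h \<cdot> x)"
proof
  note o = s_triangleD[OF t]
  {
    assume "\<exists>h\<in>mor C B A'. a = h \<cdot> x"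
    then obtain h where h: "h \<in> mor C B A'" "a = h \<cdot> x" by blast
    then show "push C E D a \<delta> = \<zero>\<^bsub>BObj E D A'\<^esub>"
      using push_comp[OF o(3,1,2) A' o(4) h(1) o(6)] push_along_own_inflation[OF t] push_zero[OF o(3,2) A' h(1)]
      by simp
  }
  assume z: "push C E D a \<delta> = \<zero>\<^bsub>BObj E D A'\<^esub>"
  obtain B' i j p q where b: "is_biproduct C A' D B' i j p q" and t0: "s_triangle C E \<ss> A' i B' q D \<zero>\<^bsub>BObj E D A'\<^esub>"
    using split_triangle[OF A' o(3)] .
  have B': "B' \<in> Obj C" and i: "i \<in> mor C A' B'" and p: "p \<in> mor C B' A'" and pi: "p \<cdot> i = Ident C A'"
    using b by (simp_all add: is_biproduct_def)
  have "push C E D a \<delta> = pull C E A' (Ident C D) \<zero>\<^bsub>BObj E D A'\<^esub>"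
    using z pull_zero[OF o(3,3) A' Ident_mor[OF o(3)]] by simp
  then obtain k where k: "k \<in> mor C B B'" "k \<cdot> x = i \<cdot> a"
    using realization_morphism[OF t t0 a Ident_mor[OF o(3)]] by blast
  have "p \<cdot> k \<cdot> x = p \<cdot> (i \<cdot> a)" using Comp_assoc[OF o(1,2) B' A' o(4) k(1) p] k(2) by simp
  also have "\<dots> = a" using Comp_assoc[OF o(1) A' B' A' a i p] pi Ident_left[OF o(1) A' a] by simp
  finally show "\<exists>h\<in>mor C B A'. a = h \<cdot> x" using Comp_mor[OF o(2) B' A' k(1) p] by metis
qed

text \<open>
  Realize \<open>e\<close> by \<open>Z \<rightarrow> B \<rightarrow> X\<close>. As \<open>g\<^sup>*e = 0\<close>, the identity of \<open>Z\<close> and \<open>g\<close> form a morphism from the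
  split extension to \<open>e\<close>, whose middle component restricts to a lift of \<open>g\<close> to \<open>B\<close>. This lift and the identity
  of \<open>X\<close> complete to a morphism of triangles, the left component of which is the required \<open>a\<close>.
\<close>

lemma projective_deflation_generates:
  assumes t: "s_triangle C E \<ss> A x G g X \<delta>" and proj: "is_projective_morphism C E G X g"
  shows "generates C E X A \<delta>"
  unfolding generates_def
proof (intro conjI ballI s_triangleD[OF t])
  note o = s_triangleD[OF t]
  fix Z e assume Z: "Z \<in> Obj C" and e: "e \<in> carrier (BObj E X Z)"
  obtain z B w where tz: "s_triangle C E \<ss> Z z B w X e" using realization_exists[OF o(3) Z e] by blast
  note oz = s_triangleD[OF tz]
  obtain S i j p q where b: "is_biproduct C Z G S i j p q" and t0: "s_triangle C E \<ss> Z i S q G \<zero>\<^bsub>BObj E G Z\<^esub>"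
    using split_triangle[OF Z o(2)] .
  have S: "S \<in> Obj C" and j: "j \<in> mor C G S" and q: "q \<in> mor C S G" and qj: "q \<cdot> j = Ident C G"
    using b by (simp_all add: is_biproduct_def)
  have "push C E G (Ident C Z) \<zero>\<^bsub>BObj E G Z\<^esub> = pull C E Z g e"
    using proj Z e push_zero[OF o(2) Z Z Ident_mor[OF Z]] by (simp add: is_projective_morphism_def)
  then obtain k where k: "k \<in> mor C S B" "w \<cdot> k = g \<cdot> q"
    using realization_morphism[OF t0 tz Ident_mor[OF Z] o(5)] by blast
  note kj = Comp_mor[OF o(2) S oz(2) j k(1)]
  have "w \<cdot> (k \<cdot> j) = g \<cdot> (q \<cdot> j)"
    using Comp_assoc[OF o(2) S oz(2) o(3) j k(1) oz(5)] Comp_assoc[OF o(2) S o(2,3) j q o(5)] k(2) by simp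
  then have "Ident C X \<cdot> g = w \<cdot> (k \<cdot> j)"
    using qj Ident_right[OF o(2,3,5)] Ident_left[OF o(2,3,5)] by simp
  then obtain a where a: "a \<in> mor C A Z" "push C E X a \<delta> = pull C E Z (Ident C X) e"
    using ET3_op[OF t tz kj Ident_mor[OF o(3)]] by blast
  then show "\<exists>a\<in>mor C A Z. push C E X a \<delta> = e" using BMap_Ident[OF o(3) Z e] by auto
qed

text \<open>
  Every extension \<open>e\<close> of \<open>X\<close> is some \<open>a\<^sub>*\<delta>\<close>, and \<open>g\<^sup>*a\<^sub>*\<delta> = a\<^sub>*g\<^sup>*\<delta> = 0\<close>.
\<close>

lemma generator_deflation_projective:
  assumes gen: "generates C E X A \<delta>" and t: "s_triangle C E \<ss> A x G g X \<delta>"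
  shows "is_projective_morphism C E G X g"
  unfolding is_projective_morphism_def
proof (intro conjI ballI s_triangleD[OF t])
  note o = s_triangleD[OF t]
  fix Z e assume Z: "Z \<in> Obj C" and e: "e \<in> carrier (BObj E X Z)"
  obtain a where a: "a \<in> mor C A Z" "push C E X a \<delta> = e" using gen Z e unfolding generates_def by blast
  have "pull C E Z g e = push C E G a (pull C E A g \<delta>)"
    using push_pull[OF o(3,2,1) Z o(5) a(1) o(6)] a(2) by simp
  then show "pull C E Z g e = \<zero>\<^bsub>BObj E G Z\<^esub>"
    using pull_along_own_deflation[OF t] push_zero[OF o(2,1) Z a(1)] by simp
qed

lemma generates_imp_presents:
  assumes gen: "generates C E X A \<delta>" and X: "X \<in> Obj C"
  obtains x G where "presents C E X A \<delta> G x"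
proof -
  have A: "A \<in> Obj C" "\<delta> \<in> carrier (BObj E X A)" using gen by (auto simp: generates_def)
  obtain x G g where t: "s_triangle C E \<ss> A x G g X \<delta>" using realization_exists[OF X A] by blast
  have "presents C E X A \<delta> G x"
    unfolding presents_def using gen s_triangleD[OF t] push_zero_iff_factors[OF t] by blast
  then show thesis by (rule that)
qed

lemma enough_projectives_iff_generated:
  "enough_projective_morphisms C E \<ss> \<longleftrightarrow> (\<forall>X\<in>Obj C. \<exists>A \<delta>. generates C E X A \<delta>)"
proof
  assume *: "enough_projective_morphisms C E \<ss>"
  show "\<forall>X\<in>Obj C. \<exists>A \<delta>. generates C E X A \<delta>"
  proof
    fix X assume "X \<in> Obj C"
    then obtain G g A x \<delta> where "is_projective_morphism C E G X g" "s_triangle C E \<ss> A x G g X \<delta>"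
      using * unfolding enough_projective_morphisms_def is_deflation_def by blast
    then show "\<exists>A \<delta>. generates C E X A \<delta>" using projective_deflation_generates by blast
  qed
next
  assume *: "\<forall>X\<in>Obj C. \<exists>A \<delta>. generates C E X A \<delta>"
  show "enough_projective_morphisms C E \<ss>"
    unfolding enough_projective_morphisms_def is_deflation_def
  proof
    fix X assume X: "X \<in> Obj C"
    obtain A \<delta> where gen: "generates C E X A \<delta>" using * X by blast
    then obtain x G g where t: "s_triangle C E \<ss> A x G g X \<delta>"
      using realization_exists[OF X] unfolding generates_def by blast
    then show "\<exists>G\<in>Obj C. \<exists>g. (\<exists>A x \<delta>. s_triangle C E \<ss> A x G g X \<delta>) \<and> is_projective_morphism C E G X g"
      using generator_deflation_projective[OF gen t] s_triangleD(2)[OF t] by blast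
  qed
qed

text \<open>
  The step from \<open>E\<^sup>n\<close> to \<open>E\<^sup>n\<^sup>+\<^sup>1\<close> at \<open>X\<close> uses the objects \<open>A\<close> and \<open>G\<close> of a presentation of \<open>E(X, -)\<close>,
  which is why all objects are treated simultaneously.
\<close>

lemma pos_ext_presents:
  assumes gen: "\<forall>X\<in>Obj C. \<exists>A \<delta>. generates C E X A \<delta>"
  shows "\<forall>X\<in>Obj C. \<exists>A m G f. presents C (pos_ext R C E n) X A m G f"
proof (induction n)
  case 0
  show ?case unfolding pos_ext.simps
    using transported_bifunctor.presents_transport[OF transported_PHom _ presents_Hom] by blast
next
  case (Suc n)
  have E: "\<exists>A \<delta> G x. presents C E X A \<delta> G x" if X: "X \<in> Obj C" for X
    using gen X generates_imp_presents[OF _ X] by metis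
  show ?case
  proof (cases n)
    case 0
    show ?thesis unfolding 0 pos_ext.simps
      using transported_bifunctor.presents_transport[OF transported_PExt] E by blast
  next
    case (Suc k)
    let ?P = "pos_ext R C E (Suc k)"
    interpret bifunctor_pair R C ?P E by (rule bifunctor_pairI[OF pos_ext_linear])
    note tr = transported_coend[OF pos_ext_linear]
    show ?thesis
    proof
      fix X assume X: "X \<in> Obj C"
      obtain A \<delta> G x where p: "presents C E X A \<delta> G x" using E[OF X] by blast
      then have A: "A \<in> Obj C" and G: "G \<in> Obj C" by (auto simp: presents_def generates_def)
      obtain B m D f where pA: "presents C ?P A B m D f" using Suc.IH A unfolding Suc by blast
      obtain B' m' D' f' where pG: "presents C ?P G B' m' D' f'" using Suc.IH G unfolding Suc by blast
      have gG: "generates C ?P G B' m'" using pG by (simp add: presents_def)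
      have "D \<in> Obj C" "B' \<in> Obj C" using pA gG by (auto simp: presents_def generates_def)
      then obtain Q i j r q where b: "is_biproduct C D B' Q i j r q" using biproducts by blast
      show "\<exists>A m G f. presents C (pos_ext R C E (Suc n)) X A m G f"
        unfolding Suc pos_ext.simps Let_def
        using presents_coend[OF X p pA gG b] transported_bifunctor.presents_transport[OF tr X] by blast
    qed
  qed
qed

end

theorem corollary3p26:
  fixes R :: "'r ring" and C :: "('r, 'o, 'm) lincat" and E :: "('r, 'o, 'm, 'e) bifun"
    and \<ss> :: "'o \<Rightarrow> 'o \<Rightarrow> 'e \<Rightarrow> ('m \<times> 'm) set"
  assumes "extriangulated_category R C E \<ss>"
  shows "(enough_projective_morphisms C E \<ss> \<longleftrightarrow>
            (\<forall>X\<in>Obj C. finitely_generated R C (covariant_part C E X))) \<and>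
         ((\<forall>X\<in>Obj C. finitely_generated R C (covariant_part C E X)) \<longleftrightarrow>
            (\<forall>X\<in>Obj C. \<forall>n. finitely_presented R C (covariant_part C (pos_ext R C E n) X)))"
proof -
  interpret extriangulated_category R C E \<ss> by fact
  have fg: "(\<forall>X\<in>Obj C. finitely_generated R C (covariant_part C E X)) \<longleftrightarrow>
      (\<forall>X\<in>Obj C. \<exists>A \<delta>. generates C E X A \<delta>)"
    using finitely_generated_iff by blast
  have up: "finitely_presented R C (covariant_part C (pos_ext R C E n) X)"
    if "\<forall>X\<in>Obj C. \<exists>A \<delta>. generates C E X A \<delta>" "X \<in> Obj C" for X n
    using pos_ext_presents[OF that(1), of n] that(2)
      linear_bifunctor.presents_imp_finitely_presented[OF pos_ext_linear] by blast
  have down: "\<exists>A \<delta>. generates C E X A \<delta>"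
    if X: "X \<in> Obj C" and fp: "finitely_presented R C (covariant_part C (pos_ext R C E 1) X)" for X
  proof -
    interpret T: transported_bifunctor R C E "\<lambda>_ _. PExt :: 'e \<Rightarrow> ('o, 'm, 'e) pext" by (rule transported_PExt)
    have "finitely_generated R C (covariant_part C T.F' X)"
      using finitely_presented_imp_generated[OF fp] by simp
    then obtain A m where gen: "generates C T.F' X A m"
      using linear_bifunctor.finitely_generated_iff[OF T.F'_linear X] by blast
    then have "m \<in> carrier (BObj T.F' X A)" by (simp add: generates_def)
    then obtain \<delta> where "\<delta> \<in> carrier (BObj E X A)" "m = PExt \<delta>" by (rule T.F'_cases)
    then show ?thesis using gen T.generates_transport[OF X] by blast
  qed
  show ?thesis unfolding fg enough_projectives_iff_generated using up down by blast
qed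

end
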